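(* There is a combinatorial algorithm solving the problem WOPP in time $O((d^3+\log n)n)$, where $n$ is the number of vertices and $d$ the dimension of the input simplex graph.
   Context: A simplex graph is a graph $K(H)$ obtained from a graph $H$ by taking as vertices all vertex sets of cliques of $H$ (including the empty one), with $C,C'$ adjacent iff $C\subsetneq C'$ and $|C'|=|C|+1$; simplex graphs are median graphs. Two edges $uv,xy$ are in relation $\Theta_0$ if $u,v,y,x$ form a 4-cycle in which $uv$ and $xy$ are opposite; $\Theta$ is the reflexive-transitive closure of $\Theta_0$, and its classes are the $\Theta$-classes. Two $\Theta$-classes $E_i,E_j$ are orthogonal if there is a 4-cycle $uvyx$ with $uv,xy\in E_i$ and $ux,vy\in E_j$. A POF is a set of pairwise orthogonal $\Theta$-classes (possibly empty); $\mathcal{L}$ denotes the set of all POFs. A central vertex of a simplex graph is a vertex $v_0$ such that every $\Theta$-class contains an edge incident to $v_0$ (such a vertex exists). The dimension $d$ is the largest $k$ with $Q_k$ an induced subgraph. Problem WOPP: Input: a simplex graph $G$, a central vertex $v_0$, and a weight function $\omega:\mathcal{L}\to\mathbb{N}^+$. Output: for each POF $X$, a POF $Y$ with $X\cap Y=\emptyset$ maximizing $\omega(Y)$. *)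

theory Defs
  imports Complex_Main "HOL-Library.Ramsey"
begin

section \<open>Simplex graphs, Theta-classes and POFs\<close>

text \<open>A finite simple graph is a vertex set together with a set of two-element edges.\<close>

definition ugraph :: "'a set \<Rightarrow> 'a set set \<Rightarrow> bool" where
  "ugraph V E \<longleftrightarrow> finite V \<and> E \<subseteq> [V]\<^bsup>2\<^esup>"

definition ugraph_iso :: "'a set \<Rightarrow> 'a set set \<Rightarrow> 'b set \<Rightarrow> 'b set set \<Rightarrow> bool" where
  "ugraph_iso V E V' E' \<longleftrightarrow>
     (\<exists>f. bij_betw f V V' \<and> (\<forall>u\<in>V. \<forall>v\<in>V. {u, v} \<in> E \<longleftrightarrow> {f u, f v} \<in> E'))"

definition simplex_verts :: "'a set \<Rightarrow> 'a set set \<Rightarrow> 'a set set" where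
  "simplex_verts V E = {C. C \<subseteq> V \<and> clique C E}"

definition simplex_edges :: "'a set \<Rightarrow> 'a set set \<Rightarrow> 'a set set set" where
  "simplex_edges V E =
     {{C, C'} | C C'. C \<in> simplex_verts V E \<and> C' \<in> simplex_verts V E \<and>
                      C \<subset> C' \<and> card C' = card C + 1}"

text \<open>As \<open>H\<close> is finite, its vertices may be taken to be natural numbers.\<close>

definition simplex_graph :: "'a set \<Rightarrow> 'a set set \<Rightarrow> bool" where
  "simplex_graph V E \<longleftrightarrow> ugraph V E \<and>
     (\<exists>(VH :: nat set) EH. ugraph VH EH \<and>
        ugraph_iso V E (simplex_verts VH EH) (simplex_edges VH EH))"

definition four_cycle :: "'a set set \<Rightarrow> 'a \<Rightarrow> 'a \<Rightarrow> 'a \<Rightarrow> 'a \<Rightarrow> bool" where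
  "four_cycle E a b c d \<longleftrightarrow> distinct [a, b, c, d] \<and>
     {a, b} \<in> E \<and> {b, c} \<in> E \<and> {c, d} \<in> E \<and> {d, a} \<in> E"

definition Theta0 :: "'a set set \<Rightarrow> 'a set rel" where
  "Theta0 E = {({u, v}, {x, y}) | u v x y. four_cycle E u v y x}"

definition Theta :: "'a set set \<Rightarrow> 'a set rel" where
  "Theta E = (Theta0 E)\<^sup>*"

definition Theta_classes :: "'a set set \<Rightarrow> 'a set set set" where
  "Theta_classes E = E // Theta E"

definition orthogonal :: "'a set set \<Rightarrow> 'a set set \<Rightarrow> 'a set set \<Rightarrow> bool" where
  "orthogonal E Ei Ej \<longleftrightarrow>
     (\<exists>u v x y. four_cycle E u v y x \<and>
        {u, v} \<in> Ei \<and> {x, y} \<in> Ei \<and> {u, x} \<in> Ej \<and> {v, y} \<in> Ej)"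

definition POFs :: "'a set set \<Rightarrow> 'a set set set set" where
  "POFs E = {X. X \<subseteq> Theta_classes E \<and> pairwise (orthogonal E) X}"

definition central :: "'a set \<Rightarrow> 'a set set \<Rightarrow> 'a \<Rightarrow> bool" where
  "central V E v0 \<longleftrightarrow> v0 \<in> V \<and> (\<forall>T \<in> Theta_classes E. \<exists>e \<in> T. v0 \<in> e)"

text \<open>The vertices of the hypercube \<open>Q\<^sub>k\<close> are the subsets of \<open>{..<k}\<close>.\<close>

definition induced_hypercube :: "'a set \<Rightarrow> 'a set set \<Rightarrow> nat \<Rightarrow> bool" where
  "induced_hypercube V E k \<longleftrightarrow>
     (\<exists>f. inj_on f (Pow {..<k}) \<and> f ` Pow {..<k} \<subseteq> V \<and>
        (\<forall>A \<in> Pow {..<k}. \<forall>B \<in> Pow {..<k}. {f A, f B} \<in> E \<longleftrightarrow> card (sym_diff A B) = 1))"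

definition dimension :: "'a set \<Rightarrow> 'a set set \<Rightarrow> nat" where
  "dimension V E = Max {k. induced_hypercube V E k}"

definition WOPP_instance ::
    "'a set \<Rightarrow> 'a set set \<Rightarrow> 'a \<Rightarrow> ('a set set set \<Rightarrow> nat) \<Rightarrow> bool" where
  "WOPP_instance V E v0 \<omega> \<longleftrightarrow>
     simplex_graph V E \<and> central V E v0 \<and> (\<forall>X \<in> POFs E. \<omega> X > 0)"

definition max_opposite ::
    "'a set set \<Rightarrow> ('a set set set \<Rightarrow> nat) \<Rightarrow> 'a set set set \<Rightarrow> 'a set set set \<Rightarrow> bool" where
  "max_opposite E \<omega> X Y \<longleftrightarrow> Y \<in> POFs E \<and> X \<inter> Y = {} \<and>
     (\<forall>Z \<in> POFs E. X \<inter> Z = {} \<longrightarrow> \<omega> Z \<le> \<omega> Y)"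

section \<open>A word RAM with structured control flow\<close>

text \<open>
  The memory consists of named arrays of natural numbers; a program mentions only finitely many of
  them, and a scalar variable is cell 0 of an array. The arithmetic operations are addition and
  truncated subtraction. An execution with word bound \<open>W\<close> exists only if every
  value that is computed on the way, including array indices, is less than \<open>W\<close>.
\<close>

type_synonym memory = "string \<Rightarrow> nat \<Rightarrow> nat"

datatype aexp =
    Const nat
  | Read string aexp
  | Plus aexp aexp
  | Minus aexp aexp

datatype bexp =
    Less aexp aexp
  | Equal aexp aexp
  | Not bexp
  | And bexp bexp

datatype com =
    Skip
  | Write string aexp aexp
  | Seq com com
  | If bexp com com
  | While bexp com

fun aval :: "memory \<Rightarrow> aexp \<Rightarrow> nat" where
  "aval s (Const k) = k"
| "aval s (Read x i) = s x (aval s i)"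
| "aval s (Plus a b) = aval s a + aval s b"
| "aval s (Minus a b) = aval s a - aval s b"

fun afits :: "nat \<Rightarrow> memory \<Rightarrow> aexp \<Rightarrow> bool" where
  "afits W s (Const k) \<longleftrightarrow> k < W"
| "afits W s (Read x i) \<longleftrightarrow> afits W s i \<and> s x (aval s i) < W"
| "afits W s (Plus a b) \<longleftrightarrow> afits W s a \<and> afits W s b \<and> aval s a + aval s b < W"
| "afits W s (Minus a b) \<longleftrightarrow> afits W s a \<and> afits W s b"

fun acost :: "aexp \<Rightarrow> nat" where
  "acost (Const k) = 1"
| "acost (Read x i) = acost i + 1"
| "acost (Plus a b) = acost a + acost b + 1"
| "acost (Minus a b) = acost a + acost b + 1"

fun bval :: "memory \<Rightarrow> bexp \<Rightarrow> bool" where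
  "bval s (Less a b) \<longleftrightarrow> aval s a < aval s b"
| "bval s (Equal a b) \<longleftrightarrow> aval s a = aval s b"
| "bval s (Not p) \<longleftrightarrow> \<not> bval s p"
| "bval s (And p q) \<longleftrightarrow> bval s p \<and> bval s q"

fun bfits :: "nat \<Rightarrow> memory \<Rightarrow> bexp \<Rightarrow> bool" where
  "bfits W s (Less a b) \<longleftrightarrow> afits W s a \<and> afits W s b"
| "bfits W s (Equal a b) \<longleftrightarrow> afits W s a \<and> afits W s b"
| "bfits W s (Not p) \<longleftrightarrow> bfits W s p"
| "bfits W s (And p q) \<longleftrightarrow> bfits W s p \<and> bfits W s q"

fun bcost :: "bexp \<Rightarrow> nat" where
  "bcost (Less a b) = acost a + acost b + 1"
| "bcost (Equal a b) = acost a + acost b + 1"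
| "bcost (Not p) = bcost p + 1"
| "bcost (And p q) = bcost p + bcost q + 1"

text \<open>\<open>exec W c s t s'\<close>: with word bound \<open>W\<close>, started in memory \<open>s\<close>, the program \<open>c\<close> halts after
  \<open>t\<close> elementary steps in memory \<open>s'\<close>.\<close>

inductive exec :: "nat \<Rightarrow> com \<Rightarrow> memory \<Rightarrow> nat \<Rightarrow> memory \<Rightarrow> bool" for W :: nat where
  exec_Skip: "exec W Skip s 1 s"
| exec_Write: "afits W s i \<Longrightarrow> afits W s a \<Longrightarrow>
    exec W (Write x i a) s (acost i + acost a + 1) (s(x := (s x)(aval s i := aval s a)))"
| exec_Seq: "exec W c1 s t1 s1 \<Longrightarrow> exec W c2 s1 t2 s2 \<Longrightarrow> exec W (Seq c1 c2) s (t1 + t2) s2"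
| exec_IfTrue: "bfits W s b \<Longrightarrow> bval s b \<Longrightarrow> exec W c1 s t s1 \<Longrightarrow>
    exec W (If b c1 c2) s (bcost b + t + 1) s1"
| exec_IfFalse: "bfits W s b \<Longrightarrow> \<not> bval s b \<Longrightarrow> exec W c2 s t s1 \<Longrightarrow>
    exec W (If b c1 c2) s (bcost b + t + 1) s1"
| exec_WhileFalse: "bfits W s b \<Longrightarrow> \<not> bval s b \<Longrightarrow> exec W (While b c) s (bcost b + 1) s"
| exec_WhileTrue: "bfits W s b \<Longrightarrow> bval s b \<Longrightarrow> exec W c s t1 s1 \<Longrightarrow>
    exec W (While b c) s1 t2 s2 \<Longrightarrow> exec W (While b c) s (bcost b + t1 + t2 + 1) s2"

section \<open>Input and output of WOPP on the machine\<close>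

text \<open>
  The vertices are \<open>0, \<dots>, n - 1\<close> and \<open>es\<close> lists every edge once, with arbitrary order and orientation.
  A Theta-class is named by the index of any one of its edges, and a POF by a list
  containing one such name for each of its members. The list \<open>ps\<close> names every POF exactly once, in
  arbitrary order.
\<close>

definition edge_at :: "(nat \<times> nat) list \<Rightarrow> nat \<Rightarrow> nat set" where
  "edge_at es i = {fst (es ! i), snd (es ! i)}"

definition class_of :: "(nat \<times> nat) list \<Rightarrow> nat set set \<Rightarrow> nat \<Rightarrow> nat set set" where
  "class_of es E i = Theta E `` {edge_at es i}"

definition pof_of :: "(nat \<times> nat) list \<Rightarrow> nat set set \<Rightarrow> nat list \<Rightarrow> nat set set set" where
  "pof_of es E p = class_of es E ` set p"

definition encodes_edges :: "(nat \<times> nat) list \<Rightarrow> nat set set \<Rightarrow> bool" where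
  "encodes_edges es E \<longleftrightarrow> bij_betw (edge_at es) {..<length es} E"

definition encodes_POFs :: "nat list list \<Rightarrow> (nat \<times> nat) list \<Rightarrow> nat set set \<Rightarrow> bool" where
  "encodes_POFs ps es E \<longleftrightarrow>
     (\<forall>p \<in> set ps. set p \<subseteq> {..<length es} \<and> distinct (map (class_of es E) p)) \<and>
     bij_betw (\<lambda>i. pof_of es E (ps ! i)) {..<length ps} (POFs E)"

definition array_of :: "nat list \<Rightarrow> nat \<Rightarrow> nat" where
  "array_of xs i = (if i < length xs then xs ! i else 0)"

text \<open>The names of the \<open>i\<close>-th POF are stored in the cells \<open>pof_start i, \<dots>, pof_start (i + 1) - 1\<close> of
  the array \<open>pof_elem\<close>. Memory not occupied by the input is zero.\<close>

definition WOPP_input ::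
    "nat \<Rightarrow> (nat \<times> nat) list \<Rightarrow> nat \<Rightarrow> nat list list \<Rightarrow> nat list \<Rightarrow> memory" where
  "WOPP_input n es v0 ps ws = (\<lambda>x i. 0)
     (''n'' := array_of [n],
      ''m'' := array_of [length es],
      ''edge_fst'' := array_of (map fst es),
      ''edge_snd'' := array_of (map snd es),
      ''v0'' := array_of [v0],
      ''num_pofs'' := array_of [length ps],
      ''pof_start'' := array_of (map (\<lambda>i. length (concat (take i ps))) [0..<length ps + 1]),
      ''pof_elem'' := array_of (concat ps),
      ''weight'' := array_of ws)"

text \<open>For each POF, given by its position \<open>i\<close> in \<open>ps\<close>, the output array holds the position of the
  computed POF.\<close>

definition WOPP_output ::
    "(nat \<times> nat) list \<Rightarrow> nat set set \<Rightarrow> nat list list \<Rightarrow> (nat set set set \<Rightarrow> nat) \<Rightarrow> memory \<Rightarrow> bool"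
  where
  "WOPP_output es E ps \<omega> s \<longleftrightarrow>
     (\<forall>i < length ps. s ''opp'' i < length ps \<and>
        max_opposite E \<omega> (pof_of es E (ps ! i)) (pof_of es E (ps ! (s ''opp'' i))))"

end

theory Submission
  imports Defs
begin

text \<open>
  Write a simplex graph as the clique complex of \<open>H\<close>, with \<open>v0\<close> as the empty clique: the Theta-classes
  are the vertices of \<open>H\<close> and the POFs are the cliques. For a family of cliques inside a vertex set \<open>U\<close>
  let \<open>Z\<close> be the heaviest one. It is optimal for every clique disjoint from \<open>Z\<close>. A clique \<open>X\<close> that
  meets \<open>Z\<close> first in \<open>x\<close> is sent to a subproblem in which \<open>x\<close> has been removed from \<open>X\<close> and only
  the neighbours of \<open>x\<close> in \<open>U\<close> not listed before \<open>x\<close> in \<open>Z\<close> matter; every competing clique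
  that avoids \<open>x\<close> is replaced by its intersection with these neighbours, which is again a clique of
  the subproblem, so that a subproblem has as many competitors as clients. Each clique takes part in at most \<open>d + 1\<close>
  problems, since it loses an element each time, and a problem of size \<open>s\<close> with at most \<open>d\<close> children
  costs \<open>O(s d\<^sup>2)\<close>. This gives \<open>O(d\<^sup>3 n)\<close> without sorting the weights.
\<close>

section \<open>Running times by weakest preconditions\<close>

text \<open>The machine sees only numbered vertices and unordered edges, so the clique complex has
  to be recovered first. The distance from \<open>v0\<close> is the size of the clique, a clique
  with at least two elements is the union of its lower neighbours, and the label of an edge is the
  element that its upper end has in excess. Scanning all m edges once per level, with d work per
  edge, costs O(m d^2), and m is at most n d, so even this naive reconstruction stays within d^3 n.

  Programs have no procedures, so the recursion becomes a queue in which every subproblem is a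
  segment. A segment lists subcliques first; the trace of a clique on a child is therefore known
  from a smaller clique and is found in O(d). Of all cliques with the same trace only a heaviest one
  is kept. This loses nothing: among cliques that avoid the removed elements, being disjoint from a
  wanted clique depends on the trace alone. The potential that pays for time and for the queue
  length is the sum of size plus one over the waiting entries.\<close>

definition bnd :: "nat \<Rightarrow> memory \<Rightarrow> bool" where
  "bnd W s \<longleftrightarrow> (\<forall>x i. s x i < W)"

fun fits :: "nat \<Rightarrow> memory \<Rightarrow> aexp \<Rightarrow> bool" where
  "fits W s (Const k) \<longleftrightarrow> k < W"
| "fits W s (Read x i) \<longleftrightarrow> fits W s i"
| "fits W s (Plus a b) \<longleftrightarrow> fits W s a \<and> fits W s b \<and> aval s a + aval s b < W"
| "fits W s (Minus a b) \<longleftrightarrow> fits W s a \<and> fits W s b"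

fun bfit :: "nat \<Rightarrow> memory \<Rightarrow> bexp \<Rightarrow> bool" where
  "bfit W s (Less a b) \<longleftrightarrow> fits W s a \<and> fits W s b"
| "bfit W s (Equal a b) \<longleftrightarrow> fits W s a \<and> fits W s b"
| "bfit W s (Not p) \<longleftrightarrow> bfit W s p"
| "bfit W s (And p q) \<longleftrightarrow> bfit W s p \<and> bfit W s q"

text \<open>Reads need no bound of their own as long as all memory cells stay below \<open>W\<close>, so \<open>fits\<close> only
  checks constants and sums.\<close>

lemma fits_afits: "bnd W s \<Longrightarrow> fits W s a \<Longrightarrow> afits W s a \<and> aval s a < W"
proof (induction a)
  case (Minus a b)
  then show ?case by (auto intro: le_less_trans[OF diff_le_self])
qed (auto simp: bnd_def)

lemma bfit_bfits: "bnd W s \<Longrightarrow> bfit W s b \<Longrightarrow> bfits W s b"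
  by (induction b) (auto simp: fits_afits)

text \<open>\<open>exec\<close> with its side conditions weakened to \<open>fits\<close> and
  \<open>bfit\<close>: reads carry no check, so weakest preconditions need not mention the size of
  cell contents. \<open>run_exec\<close> restores the checks once and for all from a bound on the
  initial memory.\<close>

inductive run :: "nat \<Rightarrow> com \<Rightarrow> memory \<Rightarrow> nat \<Rightarrow> memory \<Rightarrow> bool" for W :: nat where
  run_Skip: "run W Skip s 1 s"
| run_Write: "fits W s i \<Longrightarrow> fits W s a \<Longrightarrow>
    run W (Write x i a) s (acost i + acost a + 1) (s(x := (s x)(aval s i := aval s a)))"
| run_Seq: "run W c1 s t1 s1 \<Longrightarrow> run W c2 s1 t2 s2 \<Longrightarrow> run W (Seq c1 c2) s (t1 + t2) s2"
| run_IfTrue: "bfit W s b \<Longrightarrow> bval s b \<Longrightarrow> run W c1 s t s1 \<Longrightarrow>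
    run W (If b c1 c2) s (bcost b + t + 1) s1"
| run_IfFalse: "bfit W s b \<Longrightarrow> \<not> bval s b \<Longrightarrow> run W c2 s t s1 \<Longrightarrow>
    run W (If b c1 c2) s (bcost b + t + 1) s1"
| run_WhileFalse: "bfit W s b \<Longrightarrow> \<not> bval s b \<Longrightarrow> run W (While b c) s (bcost b + 1) s"
| run_WhileTrue: "bfit W s b \<Longrightarrow> bval s b \<Longrightarrow> run W c s t1 s1 \<Longrightarrow>
    run W (While b c) s1 t2 s2 \<Longrightarrow> run W (While b c) s (bcost b + t1 + t2 + 1) s2"

inductive_cases run_SkipE: "run W Skip s t s'"
inductive_cases run_WriteE: "run W (Write x i a) s t s'"
inductive_cases run_SeqE: "run W (Seq c1 c2) s t s'"
inductive_cases run_IfE: "run W (If b c1 c2) s t s'"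

text \<open>The bound on all cells is preserved because a write stores the value of a fitting
  expression, which \<open>fits_afits\<close> puts below \<open>W\<close>.\<close>

lemma run_exec: "run W c s t s' \<Longrightarrow> bnd W s \<Longrightarrow> exec W c s t s' \<and> bnd W s'"
proof (induction rule: run.induct)
  case (run_Write s i a x)
  then have "afits W s i" "afits W s a" "aval s a < W" using fits_afits by blast+
  moreover have "bnd W (s(x := (s x)(aval s i := aval s a)))"
    using run_Write(3) \<open>aval s a < W\<close> by (simp add: bnd_def)
  ultimately show ?case using exec_Write[of W s i a x] by blast
next
  case run_IfTrue
  then show ?case using exec_IfTrue bfit_bfits by blast
next
  case run_IfFalse
  then show ?case using exec_IfFalse bfit_bfits by blast
next
  case run_WhileFalse
  then show ?case using exec_WhileFalse bfit_bfits by blast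
next
  case run_WhileTrue
  then show ?case using exec_WhileTrue bfit_bfits by blast
qed (use exec_Skip exec_Seq in blast)+

text \<open>Total correctness, with the exact step count as an argument of the postcondition. The
  rules below are equivalences, so that the simplifier can execute loop-free code.\<close>

definition wp :: "nat \<Rightarrow> com \<Rightarrow> (nat \<Rightarrow> memory \<Rightarrow> bool) \<Rightarrow> memory \<Rightarrow> bool" where
  "wp W c Q s \<longleftrightarrow> (\<exists>t s'. run W c s t s' \<and> Q t s')"

lemma wp_conseq: "wp W c Q s \<Longrightarrow> (\<And>t s'. Q t s' \<Longrightarrow> Q' t s') \<Longrightarrow> wp W c Q' s"
  unfolding wp_def by blast

lemma wp_Skip [simp]: "wp W Skip Q s \<longleftrightarrow> Q 1 s"
  unfolding wp_def by (metis run_Skip run_SkipE)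

lemma wp_Write [simp]: "wp W (Write x i a) Q s \<longleftrightarrow> fits W s i \<and> fits W s a \<and>
    Q (acost i + acost a + 1) (s(x := (s x)(aval s i := aval s a)))"
  unfolding wp_def by (metis run_Write run_WriteE)

lemma wp_Seq [simp]: "wp W (Seq c1 c2) Q s \<longleftrightarrow> wp W c1 (\<lambda>t1. wp W c2 (\<lambda>t2. Q (t1 + t2))) s"
  unfolding wp_def by (blast intro: run_Seq elim: run_SeqE)

lemma wp_If [simp]: "wp W (If b c1 c2) Q s \<longleftrightarrow> bfit W s b \<and>
    (bval s b \<longrightarrow> wp W c1 (\<lambda>t. Q (bcost b + t + 1)) s) \<and>
    (\<not> bval s b \<longrightarrow> wp W c2 (\<lambda>t. Q (bcost b + t + 1)) s)"
proof
  assume "wp W (If b c1 c2) Q s"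
  then obtain t s' where "run W (If b c1 c2) s t s'" "Q t s'" unfolding wp_def by blast
  then show "bfit W s b \<and> (bval s b \<longrightarrow> wp W c1 (\<lambda>t. Q (bcost b + t + 1)) s) \<and>
    (\<not> bval s b \<longrightarrow> wp W c2 (\<lambda>t. Q (bcost b + t + 1)) s)"
    unfolding wp_def by (elim run_IfE) auto
next
  assume "bfit W s b \<and> (bval s b \<longrightarrow> wp W c1 (\<lambda>t. Q (bcost b + t + 1)) s) \<and>
    (\<not> bval s b \<longrightarrow> wp W c2 (\<lambda>t. Q (bcost b + t + 1)) s)"
  then show "wp W (If b c1 c2) Q s"
    unfolding wp_def by (cases "bval s b") (use run_IfTrue run_IfFalse in fast)+
qed

text \<open>Names the memory \<open>s'\<close> after the write, so that a fact about the rest of the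
  program can be prepared for an update term chosen in advance.\<close>

lemma wp_Write_Seq:
  assumes "fits W s i" "fits W s a" "s(x := (s x)(aval s i := aval s a)) = s'"
    and "wp W c (\<lambda>t. Q (acost i + acost a + 1 + t)) s'"
  shows "wp W (Seq (Write x i a) c) Q s"
  using assms by simp

text \<open>The potential \<open>p\<close> pays for the running time and thereby also yields termination.\<close>

lemma wp_While:
  assumes "I s"
    and fit: "\<And>s. I s \<Longrightarrow> bfit W s b"
    and step: "\<And>s. I s \<Longrightarrow> bval s b \<Longrightarrow> wp W c (\<lambda>t s'. I s' \<and> p s' + t + bcost b + 1 \<le> p s) s"
    and post: "\<And>t s'. I s' \<Longrightarrow> \<not> bval s' b \<Longrightarrow> t \<le> p s + bcost b + 1 \<Longrightarrow> Q t s'"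
  shows "wp W (While b c) Q s"
proof -
  have "\<exists>t s'. run W (While b c) s t s' \<and> I s' \<and> \<not> bval s' b \<and> t \<le> p s + bcost b + 1"
    if "I s" for s
    using that
  proof (induction "p s" arbitrary: s rule: less_induct)
    case less
    have f: "bfit W s b" using fit less.prems by blast
    show ?case
    proof (cases "bval s b")
      case False
      then show ?thesis using run_WhileFalse[OF f] less.prems by fastforce
    next
      case True
      from step[OF less.prems True] obtain t s' where
        e: "run W c s t s'" "I s'" and le: "p s' + t + bcost b + 1 \<le> p s"
        unfolding wp_def by blast
      from le have "p s' < p s" by simp
      from less.hyps[OF this e(2)] obtain t2 s2 where
        e2: "run W (While b c) s' t2 s2" "I s2" "\<not> bval s2 b" "t2 \<le> p s' + bcost b + 1"
        by blast
      from run_WhileTrue[OF f True e(1) e2(1)] e2 le show ?thesis by fastforce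
    qed
  qed
  from this[OF assms(1)] post show ?thesis unfolding wp_def by blast
qed

abbreviation V :: "string \<Rightarrow> aexp" where "V x \<equiv> Read x (Const 0)"

abbreviation Assign :: "string \<Rightarrow> aexp \<Rightarrow> com" (infix "::=" 65) where
  "x ::= a \<equiv> Write x (Const 0) a"

abbreviation Seq_infix :: "com \<Rightarrow> com \<Rightarrow> com" (infixr ";;" 60) where
  "c1 ;; c2 \<equiv> Seq c1 c2"

definition For :: "string \<Rightarrow> aexp \<Rightarrow> com \<Rightarrow> com" where
  "For i hi c =
     i ::= Const 0 ;; While (Less (V i) hi) (c ;; i ::= Plus (V i) (Const 1))"

text \<open>The limit \<open>hi\<close> is evaluated anew before every round, hence the demand that
  the invariant fixes its value to \<open>h\<close>. The counter is advanced after the body, so the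
  body has to keep it and to establish the invariant for the memory with the counter already
  advanced.\<close>

lemma wp_For:
  assumes init: "I 0 (s(i := (s i)(0 := 0)))"
    and hi: "\<And>k s. I k s \<Longrightarrow> s i 0 = k \<Longrightarrow> k \<le> h \<Longrightarrow> aval s hi = h \<and> fits W s hi"
    and h: "h < W" "1 < W"
    and step: "\<And>k s. I k s \<Longrightarrow> s i 0 = k \<Longrightarrow> k < h \<Longrightarrow>
      wp W c (\<lambda>t s'. t \<le> B \<and> s' i 0 = k \<and> I (Suc k) (s'(i := (s' i)(0 := Suc k)))) s"
    and post: "\<And>t s'. I h s' \<Longrightarrow> s' i 0 = h \<Longrightarrow> t \<le> h * (B + acost hi + 10) + acost hi + 10 \<Longrightarrow> Q t s'"
  shows "wp W (For i hi c) Q s"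
  unfolding For_def
proof -
  \<comment> \<open>Per round: \<open>B\<close> for the body, \<open>acost hi + 3\<close> for the
    test, 6 for the increment and 1 for the loop itself.\<close>
  define K where "K = B + acost hi + 10"
  let ?s0 = "s(i := (s i)(aval s (Const 0) := aval s (Const 0)))"
  let ?I = "\<lambda>s. I (s i 0) s \<and> s i 0 \<le> h"
  have "wp W (While (Less (V i) hi) (c ;; i ::= Plus (V i) (Const 1)))
     (\<lambda>t2. Q (acost (Const 0) + acost (Const 0) + 1 + t2)) ?s0"
  proof (rule wp_While[where I = ?I and p = "\<lambda>s. (h - s i 0) * K"])
    show "?I ?s0" using init by simp
  next
    fix s assume "?I s"
    then show "bfit W s (Less (V i) hi)" using hi[of "s i 0" s] h by simp
  next
    fix s assume I: "?I s" and b: "bval s (Less (V i) hi)"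
    then have k: "s i 0 < h" using hi[of "s i 0" s] by simp
    have e: "(h - s i 0) * K = (h - Suc (s i 0)) * K + K"
      using k by (metis Suc_diff_Suc add.commute mult_Suc)
    show "wp W (c ;; i ::= Plus (V i) (Const 1)) (\<lambda>t s'. ?I s' \<and>
        (h - s' i 0) * K + t + bcost (Less (V i) hi) + 1 \<le> (h - s i 0) * K) s"
      unfolding wp_Seq
      by (rule wp_conseq[OF step[of "s i 0" s]]) (use I k h e in \<open>auto simp: K_def\<close>)
  next
    fix t s' assume "?I s'" "\<not> bval s' (Less (V i) hi)"
      and t: "t \<le> (h - ?s0 i 0) * K + bcost (Less (V i) hi) + 1"
    then have "s' i 0 = h" "I h s'" using hi[of "s' i 0" s'] by auto
    then show "Q (acost (Const 0) + acost (Const 0) + 1 + t) s'"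
      using t by (intro post) (auto simp: K_def)
  qed
  then show "wp W (i ::= Const 0 ;; While (Less (V i) hi) (c ;; i ::= Plus (V i) (Const 1))) Q s"
    using h by simp
qed

text \<open>Frame condition; \<open>M\<close> collects the arrays that a piece of code may
  write.\<close>

definition same :: "string set \<Rightarrow> memory \<Rightarrow> memory \<Rightarrow> bool" where
  "same M s s' \<longleftrightarrow> (\<forall>x. x \<notin> M \<longrightarrow> s' x = s x)"

lemma same_refl [simp]: "same M s s"
  by (simp add: same_def)

lemma same_upd [simp]: "same M s s' \<Longrightarrow> x \<in> M \<Longrightarrow> same M s (s'(x := f))"
  by (auto simp: same_def)

lemma sameD: "same M s s' \<Longrightarrow> x \<notin> M \<Longrightarrow> s' x = s x"
  by (simp add: same_def)

lemma same_trans: "same M s s' \<Longrightarrow> same N s' s'' \<Longrightarrow> M \<union> N \<subseteq> L \<Longrightarrow> same L s s''"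
  unfolding same_def by (metis Un_iff subsetD)

section \<open>Theta-classes and POFs of a simplex graph\<close>

text \<open>Families closed downwards that contain a finite set once they contain all its pairs are
  the clique complexes; pairs with \<open>x = y\<close> account for the singletons. Stated without
  \<open>H\<close>, the locale can be interpreted again after a symmetric difference with a central
  clique and after a renaming of the elements.\<close>

locale clique_graph =
  fixes n :: nat and E :: "nat set set" and el :: "nat \<Rightarrow> 'b set"
  assumes inj: "inj_on el {..<n}"
    and finite_el: "v < n \<Longrightarrow> finite (el v)"
    and down: "v < n \<Longrightarrow> S \<subseteq> el v \<Longrightarrow> S \<in> el ` {..<n}"
    and flag: "finite S \<Longrightarrow> (\<And>x y. x \<in> S \<Longrightarrow> y \<in> S \<Longrightarrow> {x, y} \<in> el ` {..<n}) \<Longrightarrow> S \<in> el ` {..<n}"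
    and edges: "{u, v} \<in> E \<longleftrightarrow> u < n \<and> v < n \<and> (\<exists>x. sym_diff (el u) (el v) = {x})"
    and edge_pair: "e \<in> E \<Longrightarrow> \<exists>u v. e = {u, v}"
begin

definition K :: "'b set set" where "K = el ` {..<n}"

definition ver :: "'b set \<Rightarrow> nat" where "ver = the_inv_into {..<n} el"

text \<open>The edges labelled \<open>x\<close>. By \<open>Theta_image\<close> this is the
  Theta-class of each of its edges.\<close>

definition cl :: "'b \<Rightarrow> nat set set" where
  "cl x = {{u, v} | u v. u < n \<and> v < n \<and> sym_diff (el u) (el v) = {x}}"

lemma ver_in: "S \<in> K \<Longrightarrow> ver S < n"
  unfolding K_def ver_def using the_inv_into_into[OF inj, of S "{..<n}"] by auto

lemma el_ver [simp]: "S \<in> K \<Longrightarrow> el (ver S) = S"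
  unfolding K_def ver_def by (rule f_the_inv_into_f[OF inj])

lemma ver_el [simp]: "v < n \<Longrightarrow> ver (el v) = v"
  unfolding ver_def by (simp add: inj the_inv_into_f_f)

lemma el_K [simp]: "v < n \<Longrightarrow> el v \<in> K"
  by (simp add: K_def)

lemma K_down: "C \<in> K \<Longrightarrow> S \<subseteq> C \<Longrightarrow> S \<in> K"
  unfolding K_def using down by blast

lemma K_finite: "C \<in> K \<Longrightarrow> finite C"
  unfolding K_def using finite_el by auto

lemma K_flag: "finite S \<Longrightarrow> (\<And>x y. x \<in> S \<Longrightarrow> y \<in> S \<Longrightarrow> {x, y} \<in> K) \<Longrightarrow> S \<in> K"
  unfolding K_def by (rule flag)

lemma finite_K: "finite K"
  by (simp add: K_def)

lemma empty_K: "{} \<in> K"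
  by (rule K_flag) auto

lemma n_pos: "0 < n"
  using empty_K by (auto simp: K_def)

lemma el_inj: "u < n \<Longrightarrow> v < n \<Longrightarrow> el u = el v \<longleftrightarrow> u = v"
  using inj by (auto simp: inj_on_def)

section \<open>Edge labels and Theta-classes\<close>

lemma pair_cl: "{u, v} \<in> cl x \<longleftrightarrow> u < n \<and> v < n \<and> sym_diff (el u) (el v) = {x}"
  by (auto simp: cl_def doubleton_eq_iff)

lemma cl_subset: "cl x \<subseteq> E"
  using edges by (auto simp: cl_def)

lemma edge_cl: "e \<in> E \<Longrightarrow> \<exists>x. e \<in> cl x"
  by (metis edge_pair edges pair_cl)

lemma cl_unique: "e \<in> cl x \<Longrightarrow> e \<in> cl y \<Longrightarrow> x = y"
proof -
  assume a: "e \<in> cl x" "e \<in> cl y"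
  then obtain u v where "e = {u, v}" by (auto simp: cl_def)
  then show ?thesis using a by (simp add: pair_cl)
qed

lemma insert_pair_cl:
  "x \<notin> C \<Longrightarrow> insert x C \<in> K \<Longrightarrow> {ver C, ver (insert x C)} \<in> cl x"
proof -
  assume a: "x \<notin> C" "insert x C \<in> K"
  then have "C \<in> K" using K_down by blast
  then show ?thesis using a by (auto simp: pair_cl ver_in)
qed

lemma pair_cl_insert:
  assumes "e \<in> cl x"
  obtains C where "x \<notin> C" "insert x C \<in> K" "e = {ver C, ver (insert x C)}"
proof -
  obtain u v where e: "e = {u, v}" "u < n" "v < n" "sym_diff (el u) (el v) = {x}"
    using assms by (auto simp: cl_def)
  have p: "z \<in> el v \<longleftrightarrow> (z \<in> el u) = (z \<noteq> x)" for z
    using eqset_imp_iff[OF e(4), of z] by (simp only: Un_iff Diff_iff singleton_iff) argo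
  show ?thesis
  proof (cases "x \<in> el v")
    case True
    then have x: "x \<notin> el u" "insert x (el u) = el v" by (auto simp: set_eq_iff p)
    show ?thesis
    proof (rule that)
      show "insert x (el u) \<in> K" "e = {ver (el u), ver (insert x (el u))}"
        unfolding x(2) by (simp_all add: e(1-3))
    qed (rule x(1))
  next
    case False
    then have x: "insert x (el v) = el u" by (auto simp: set_eq_iff p)
    show ?thesis
    proof (rule that)
      show "insert x (el v) \<in> K" "e = {ver (el v), ver (insert x (el v))}"
        unfolding x by (simp_all add: e(1-3) insert_commute)
    qed (rule False)
  qed
qed

text \<open>Around the cycle every element is toggled an even number of times. Consecutive sides
  have different labels because opposite corners are different vertices, hence opposite sides have
  the same label.\<close>

lemma four_cycle_labels:
  assumes "four_cycle E u v y x" "{u, v} \<in> cl i"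
  shows "{x, y} \<in> cl i" "\<exists>j. j \<noteq> i \<and> {u, x} \<in> cl j \<and> {v, y} \<in> cl j"
proof -
  from assms(1) have d: "distinct [u, v, y, x]" and e: "{u, v} \<in> E" "{v, y} \<in> E" "{y, x} \<in> E" "{x, u} \<in> E"
    by (auto simp: four_cycle_def)
  from e obtain b c d where l: "{v, y} \<in> cl b" "{y, x} \<in> cl c" "{x, u} \<in> cl d"
    using edge_cl by meson
  have lt: "u < n" "v < n" "x < n" "y < n" using e edges by auto
  then have ne: "el u \<noteq> el y" "el v \<noteq> el x" using d el_inj by auto
  have s: "sym_diff (el u) (el v) = {i}" "sym_diff (el v) (el y) = {b}"
     "sym_diff (el y) (el x) = {c}" "sym_diff (el x) (el u) = {d}"
    using l assms(2) by (auto simp: pair_cl)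
  have p: "(z \<in> el u) \<noteq> (z \<in> el v) \<longleftrightarrow> z = i" "(z \<in> el v) \<noteq> (z \<in> el y) \<longleftrightarrow> z = b"
    "(z \<in> el y) \<noteq> (z \<in> el x) \<longleftrightarrow> z = c" "(z \<in> el x) \<noteq> (z \<in> el u) \<longleftrightarrow> z = d" for z
    using s by (auto simp only: set_eq_iff Un_iff Diff_iff singleton_iff)
  have "i \<noteq> b" using ne(1) p(1,2) by (metis set_eqI)
  moreover have "b \<noteq> c" using ne(2) p(2,3) by (metis set_eqI)
  ultimately have "i = c" "b = d" using p[of i] p[of b] p[of c] by metis+
  then show "{x, y} \<in> cl i" "\<exists>j. j \<noteq> i \<and> {u, x} \<in> cl j \<and> {v, y} \<in> cl j"
    using l \<open>i \<noteq> b\<close> by (auto simp: insert_commute)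
qed

lemma Theta0_cl: "(e, f) \<in> Theta0 E \<Longrightarrow> e \<in> cl i \<Longrightarrow> f \<in> cl i"
  unfolding Theta0_def using four_cycle_labels(1) by blast

lemma Theta_cl: "(e, f) \<in> Theta E \<Longrightarrow> e \<in> cl i \<Longrightarrow> f \<in> cl i"
  unfolding Theta_def by (induction rule: rtrancl_induct) (auto intro: Theta0_cl)

lemma sym_Theta: "sym (Theta E)"
  unfolding Theta_def
proof (rule sym_rtrancl, rule symI)
  fix e f assume "(e, f) \<in> Theta0 E"
  then obtain u v x y where "e = {u, v}" "f = {x, y}" "four_cycle E u v y x"
    by (auto simp: Theta0_def)
  moreover then have "four_cycle E x y v u" by (auto simp: four_cycle_def insert_commute)
  ultimately show "(f, e) \<in> Theta0 E" by (auto simp: Theta0_def)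
qed

lemma square:
  assumes "i \<noteq> j" "i \<notin> C" "j \<notin> C" "insert i (insert j C) \<in> K"
  shows "four_cycle E (ver C) (ver (insert i C)) (ver (insert i (insert j C))) (ver (insert j C))"
proof -
  have k: "C \<in> K" "insert i C \<in> K" "insert j C \<in> K" using assms(4) K_down by blast+
  have "distinct (map el [ver C, ver (insert i C), ver (insert i (insert j C)), ver (insert j C)])"
    using assms k by auto
  then have "distinct [ver C, ver (insert i C), ver (insert i (insert j C)), ver (insert j C)]"
    by (simp only: distinct_map)
  moreover have "{ver C, ver (insert i C)} \<in> cl i" "{ver C, ver (insert j C)} \<in> cl j"
    "{ver (insert i C), ver (insert i (insert j C))} \<in> cl j"
    "{ver (insert j C), ver (insert i (insert j C))} \<in> cl i"
    using insert_pair_cl[of i C] insert_pair_cl[of j C] insert_pair_cl[of i "insert j C"]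
      insert_pair_cl[of j "insert i C"] assms k by (auto simp: insert_commute)
  ultimately show ?thesis
    unfolding four_cycle_def using cl_subset by (auto simp: insert_commute)
qed

text \<open>The elements of \<open>C\<close> are inserted one at a time, each insertion crossing one
  square; so every edge labelled \<open>i\<close> is linked to the edge at the empty clique.\<close>

lemma Theta_root:
  assumes "i \<notin> C" "insert i C \<in> K"
  shows "({ver {}, ver {i}}, {ver C, ver (insert i C)}) \<in> Theta E"
proof -
  have "finite C" using K_finite[OF assms(2)] by simp
  then show ?thesis using assms
  proof (induction C)
    case empty
    then show ?case by (simp add: Theta_def)
  next
    case (insert j C)
    have "({ver {}, ver {i}}, {ver C, ver (insert i C)}) \<in> Theta E"
      using insert.prems by (intro insert.IH) (auto intro: K_down)
    moreover have "({ver C, ver (insert i C)}, {ver (insert j C), ver (insert i (insert j C))}) \<in> Theta0 E"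
      using square[of i j C] insert unfolding Theta0_def by blast
    ultimately show ?case unfolding Theta_def by (rule rtrancl_into_rtrancl)
  qed
qed

text \<open>Labels are constant along Theta, and two edges with the same label are linked through
  the root edge of \<open>Theta_root\<close>.\<close>

lemma Theta_image: "e \<in> cl x \<Longrightarrow> Theta E `` {e} = cl x"
proof (intro equalityI subsetI)
  assume e: "e \<in> cl x"
  fix f assume "f \<in> cl x"
  then have "({ver {}, ver {x}}, f) \<in> Theta E" "({ver {}, ver {x}}, e) \<in> Theta E"
    using e Theta_root by (metis pair_cl_insert)+
  then show "f \<in> Theta E `` {e}"
    using sym_Theta unfolding Theta_def by (metis Image_singleton_iff rtrancl_trans symD)
qed (auto dest: Theta_cl)

lemma cl_nonempty: "{x} \<in> K \<Longrightarrow> {ver {}, ver {x}} \<in> cl x"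
  using insert_pair_cl[of x "{}"] by simp

lemma cl_inj: "{x} \<in> K \<Longrightarrow> cl x = cl y \<Longrightarrow> x = y"
  using cl_nonempty cl_unique by blast

lemma cl_label: "e \<in> cl x \<Longrightarrow> {x} \<in> K"
  by (metis pair_cl_insert K_down insert_mono empty_subsetI)

lemma Theta_classes_eq: "Theta_classes E = cl ` {x. {x} \<in> K}"
proof (intro equalityI subsetI)
  fix T assume "T \<in> Theta_classes E"
  then obtain e where "e \<in> E" "T = Theta E `` {e}" by (auto simp: Theta_classes_def quotient_def)
  then show "T \<in> cl ` {x. {x} \<in> K}" using edge_cl Theta_image cl_label by blast
next
  fix T assume "T \<in> cl ` {x. {x} \<in> K}"
  then obtain x where x: "{x} \<in> K" "T = cl x" by blast
  then have "{ver {}, ver {x}} \<in> E" using cl_nonempty cl_subset by blast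
  then show "T \<in> Theta_classes E"
    unfolding Theta_classes_def quotient_def using x cl_nonempty Theta_image by blast
qed

text \<open>In a square one pair of sides toggles \<open>i\<close> and the other \<open>j\<close>,
  so one of the four corners contains both. Conversely the subsets of \<open>{i, j}\<close> form
  such a square.\<close>

lemma orthogonal_cl: "orthogonal E (cl i) (cl j) \<longleftrightarrow> i \<noteq> j \<and> {i, j} \<in> K"
proof
  assume "orthogonal E (cl i) (cl j)"
  then obtain u v x y where c: "four_cycle E u v y x" "{u, v} \<in> cl i" "{x, y} \<in> cl i"
    "{u, x} \<in> cl j" "{v, y} \<in> cl j"
    unfolding orthogonal_def by blast
  from four_cycle_labels(2)[OF c(1,2)] c(4) have ij: "i \<noteq> j" using cl_unique by blast
  have l: "u < n" "v < n" "x < n" "y < n" and s: "sym_diff (el u) (el v) = {i}"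
    "sym_diff (el x) (el y) = {i}" "sym_diff (el u) (el x) = {j}"
    using c by (auto simp: pair_cl)
  have "(i \<in> el u) \<noteq> (i \<in> el v)" "(i \<in> el x) \<noteq> (i \<in> el y)" "(j \<in> el u) \<noteq> (j \<in> el x)"
    "(j \<in> el u) = (j \<in> el v)" "(j \<in> el x) = (j \<in> el y)"
    using eqset_imp_iff[OF s(1), of i] eqset_imp_iff[OF s(2), of i] eqset_imp_iff[OF s(3), of j]
      eqset_imp_iff[OF s(1), of j] eqset_imp_iff[OF s(2), of j] ij by auto
  then have "\<exists>w<n. i \<in> el w \<and> j \<in> el w" using l by metis
  then have "{i, j} \<in> K" using K_down el_K by (metis empty_subsetI insert_subset)
  then show "i \<noteq> j \<and> {i, j} \<in> K" using ij by blast
next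
  assume "i \<noteq> j \<and> {i, j} \<in> K"
  then have k: "i \<noteq> j" "{i, j} \<in> K" "{i} \<in> K" "{j} \<in> K" using K_down by blast+
  have "four_cycle E (ver {}) (ver {i}) (ver {i, j}) (ver {j})"
    using square[of i j "{}"] k by simp
  moreover have "{ver {}, ver {i}} \<in> cl i" "{ver {j}, ver {i, j}} \<in> cl i"
    "{ver {}, ver {j}} \<in> cl j" "{ver {i}, ver {i, j}} \<in> cl j"
    using insert_pair_cl[of i "{}"] insert_pair_cl[of i "{j}"]
      insert_pair_cl[of j "{}"] insert_pair_cl[of j "{i}"] k by (auto simp: insert_commute)
  ultimately show "orthogonal E (cl i) (cl j)" unfolding orthogonal_def by blast
qed

lemma in_K_single: "C \<in> K \<Longrightarrow> x \<in> C \<Longrightarrow> {x} \<in> K"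
  by (rule K_down) auto

lemma finite_labels: "finite {x. {x} \<in> K}"
proof -
  have "{x. {x} \<in> K} \<subseteq> \<Union> K" by blast
  then show ?thesis using finite_K K_finite by (meson finite_Union finite_subset)
qed

text \<open>The flag property turns pairwise orthogonality of labels into a clique.\<close>

lemma POFs_eq: "POFs E = (`) cl ` K"
proof (intro equalityI subsetI)
  fix X assume "X \<in> POFs E"
  then have X: "X \<subseteq> cl ` {x. {x} \<in> K}" "pairwise (orthogonal E) X"
    by (auto simp: POFs_def Theta_classes_eq)
  then obtain C where C: "C \<subseteq> {x. {x} \<in> K}" "X = cl ` C" by (meson subset_imageE)
  have "C \<in> K"
  proof (rule K_flag)
    show "finite C" using C finite_labels finite_subset by blast
    fix x y assume xy: "x \<in> C" "y \<in> C"
    show "{x, y} \<in> K"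
    proof (cases "x = y")
      case False
      then have "cl x \<noteq> cl y" using xy C cl_inj by blast
      then have "orthogonal E (cl x) (cl y)" using X xy C by (auto simp: pairwise_def)
      then show ?thesis using orthogonal_cl by blast
    qed (use xy C in auto)
  qed
  then show "X \<in> (`) cl ` K" using C by blast
next
  fix X assume "X \<in> (`) cl ` K"
  then obtain C where C: "C \<in> K" "X = cl ` C" by blast
  have "pairwise (orthogonal E) X"
    unfolding pairwise_def C(2) using K_down[OF C(1)] by (auto simp: orthogonal_cl)
  moreover have "X \<subseteq> Theta_classes E"
    unfolding Theta_classes_eq using C in_K_single by blast
  ultimately show "X \<in> POFs E" by (simp add: POFs_def)
qed

lemma cl_inj_on: "inj_on cl {x. {x} \<in> K}"
  using cl_inj by (auto simp: inj_on_def)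

lemma cl_image_inj: "inj_on ((`) cl) K"
proof (rule inj_onI)
  fix C D assume "C \<in> K" "D \<in> K" "cl ` C = cl ` D"
  then show "C = D"
    using inj_on_image_eq_iff[OF cl_inj_on, of C D] in_K_single by blast
qed

lemma cl_image_disjoint:
  assumes "C \<in> K" "D \<in> K"
  shows "cl ` C \<inter> cl ` D = {} \<longleftrightarrow> C \<inter> D = {}"
  using assms cl_inj in_K_single by blast

text \<open>The subsets of a clique span an induced cube. As \<open>dimension\<close> is a
  \<open>Max\<close>, the set of admissible \<open>k\<close> must also be seen to be finite, which
  follows from \<open>2 ^ k \<le> n\<close>.\<close>

lemma card_el_le_dimension:
  assumes "v < n"
  shows "card (el v) \<le> dimension {..<n} E"
proof -
  let ?k = "card (el v)"
  obtain g where g: "bij_betw g {..<?k} (el v)"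
    using ex_bij_betw_nat_finite[OF finite_el[OF assms]] by (auto simp: atLeast0LessThan)
  have gK: "g ` A \<in> K" if "A \<subseteq> {..<?k}" for A
    using K_down[OF el_K[OF assms]] g that by (metis bij_betw_def image_mono)
  have ginj: "inj_on g {..<?k}" using g by (simp add: bij_betw_def)
  have "induced_hypercube {..<n} E ?k"
    unfolding induced_hypercube_def
  proof (intro exI[of _ "\<lambda>A. ver (g ` A)"] conjI ballI)
    show "inj_on (\<lambda>A. ver (g ` A)) (Pow {..<?k})"
    proof (rule inj_onI)
      fix A B assume AB: "A \<in> Pow {..<?k}" "B \<in> Pow {..<?k}" "ver (g ` A) = ver (g ` B)"
      then have "g ` A = g ` B" using gK el_ver by (metis PowD)
      then show "A = B" using ginj AB by (simp add: inj_on_image_eq_iff)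
    qed
    show "(\<lambda>A. ver (g ` A)) ` Pow {..<?k} \<subseteq> {..<n}" using gK ver_in by auto
    fix A B assume AB: "A \<in> Pow {..<?k}" "B \<in> Pow {..<?k}"
    have "sym_diff (g ` A) (g ` B) = g ` sym_diff A B"
      using AB inj_on_image_set_diff[OF ginj, of A B] inj_on_image_set_diff[OF ginj, of B A]
      by (auto simp: image_Un)
    then have "(\<exists>x. sym_diff (g ` A) (g ` B) = {x}) \<longleftrightarrow> card (g ` sym_diff A B) = 1"
      by (auto simp: card_1_singleton_iff)
    also have "card (g ` sym_diff A B) = card (sym_diff A B)"
      using AB by (intro card_image inj_on_subset[OF ginj]) auto
    finally show "{ver (g ` A), ver (g ` B)} \<in> E \<longleftrightarrow> card (sym_diff A B) = 1"
      using gK AB by (simp add: edges ver_in)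
  qed
  moreover have "finite {k. induced_hypercube {..<n} E k}"
  proof (rule finite_subset)
    show "{k. induced_hypercube {..<n} E k} \<subseteq> {..n}"
    proof
      fix k assume "k \<in> {k. induced_hypercube {..<n} E k}"
      then obtain f where "inj_on f (Pow {..<k})" "f ` Pow {..<k} \<subseteq> {..<n}"
        by (auto simp: induced_hypercube_def)
      then have "card (Pow {..<k}) \<le> card {..<n}" by (meson card_inj_on_le finite_lessThan)
      then have "2 ^ k \<le> n" by (simp add: card_Pow)
      then show "k \<in> {..n}" using less_exp[of k] by (meson atMost_iff less_imp_le_nat less_le_trans)
    qed
  qed simp
  ultimately show ?thesis unfolding dimension_def by (intro Max_ge) auto
qed

end

section \<open>Moving the central vertex to the empty clique\<close>

locale rooted_clique_graph = clique_graph n E el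
  for n :: nat and E :: "nat set set" and el :: "nat \<Rightarrow> nat set" +
  fixes v0 :: nat
  assumes v0: "v0 < n" "el v0 = {}"
    and sing: "v < n \<Longrightarrow> x \<in> el v \<Longrightarrow> x < n \<and> el x = {x}"

lemma sym_diff_singleton:
  "(\<exists>x. sym_diff A B = {x}) \<longleftrightarrow> (\<exists>x. x \<notin> A \<and> B = insert x A) \<or> (\<exists>x. x \<notin> B \<and> A = insert x B)"
proof
  assume "\<exists>x. sym_diff A B = {x}"
  then obtain x where x: "sym_diff A B = {x}" by blast
  have p: "z \<in> B \<longleftrightarrow> (z \<in> A) = (z \<noteq> x)" for z
    using eqset_imp_iff[OF x, of z] by (simp only: Un_iff Diff_iff singleton_iff) argo
  show "(\<exists>x. x \<notin> A \<and> B = insert x A) \<or> (\<exists>x. x \<notin> B \<and> A = insert x B)"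
  proof (cases "x \<in> A")
    case True
    then have "x \<notin> B" "A = insert x B" by (auto simp: set_eq_iff p)
    then show ?thesis by blast
  next
    case False
    then have "B = insert x A" by (auto simp: set_eq_iff p)
    with False show ?thesis by blast
  qed
next
  assume "(\<exists>x. x \<notin> A \<and> B = insert x A) \<or> (\<exists>x. x \<notin> B \<and> A = insert x B)"
  then show "\<exists>x. sym_diff A B = {x}"
  proof (elim disjE exE conjE)
    fix x assume "x \<notin> A" "B = insert x A"
    then have "sym_diff A B = {x}" by blast
    then show ?thesis ..
  next
    fix x assume "x \<notin> B" "A = insert x B"
    then have "sym_diff A B = {x}" by blast
    then show ?thesis ..
  qed
qed

lemma psubset_card_Suc:
  assumes "finite B"
  shows "A \<subset> B \<and> card B = card A + 1 \<longleftrightarrow> (\<exists>x. x \<notin> A \<and> B = insert x A)"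
proof
  assume a: "A \<subset> B \<and> card B = card A + 1"
  then have "card (B - A) = 1" using assms by (auto simp: card_Diff_subset finite_subset psubset_eq)
  then obtain x where "B - A = {x}" by (auto simp: card_1_singleton_iff)
  then have "x \<notin> A" "B = insert x A" using a by blast+
  then show "\<exists>x. x \<notin> A \<and> B = insert x A" by blast
qed (use assms in auto)

text \<open>An unordered edge does not tell which end is the larger clique, so inclusion with one
  more element is symmetrised to a symmetric difference with one element.\<close>

lemma simplex_clique_graph:
  assumes "simplex_graph {..<n} E"
  shows "\<exists>el :: nat \<Rightarrow> nat set. clique_graph n E el"
proof -
  from assms obtain VH :: "nat set" and EH and f where
    u: "ugraph {..<n} E" "ugraph VH EH" and
    f: "bij_betw f {..<n} (simplex_verts VH EH)" and
    iso: "\<And>u v. u < n \<Longrightarrow> v < n \<Longrightarrow> {u, v} \<in> E \<longleftrightarrow> {f u, f v} \<in> simplex_edges VH EH"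
    unfolding simplex_graph_def ugraph_iso_def by blast
  have img: "f ` {..<n} = simplex_verts VH EH" using f by (simp add: bij_betw_def)
  have fv: "v < n \<Longrightarrow> f v \<in> simplex_verts VH EH" for v using img by blast
  have fin: "C \<in> simplex_verts VH EH \<Longrightarrow> finite C" for C
    using u(2) finite_subset by (auto simp: simplex_verts_def ugraph_def)
  have lt: "a \<in> e \<Longrightarrow> e \<in> E \<Longrightarrow> a < n" for a e
    using u(1) by (auto simp: ugraph_def nsets_def)
  have "clique_graph n E f"
  proof
    show "inj_on f {..<n}" using f by (simp add: bij_betw_def)
    show "finite (f v)" if "v < n" for v using fv fin that by blast
    show "S \<in> f ` {..<n}" if "v < n" "S \<subseteq> f v" for v S
      using fv[OF that(1)] that(2) unfolding img simplex_verts_def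
      by (auto intro: smaller_clique)
    show "S \<in> f ` {..<n}"
      if "finite S" "\<And>x y. x \<in> S \<Longrightarrow> y \<in> S \<Longrightarrow> {x, y} \<in> f ` {..<n}" for S
      using that(2) unfolding img simplex_verts_def clique_def by blast
    show "\<exists>u v. e = {u, v}" if "e \<in> E" for e
      using that u(1) unfolding ugraph_def nsets_def card_2_iff by blast
    fix u v
    have eq: "{f u, f v} \<in> simplex_edges VH EH \<longleftrightarrow> (\<exists>x. sym_diff (f u) (f v) = {x})"
      if "u < n" "v < n"
    proof -
      have "{f u, f v} \<in> simplex_edges VH EH \<longleftrightarrow>
        f u \<subset> f v \<and> card (f v) = card (f u) + 1 \<or> f v \<subset> f u \<and> card (f u) = card (f v) + 1"
        using fv[OF that(1)] fv[OF that(2)] unfolding simplex_edges_def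
        by (auto simp: doubleton_eq_iff)
      also have "\<dots> \<longleftrightarrow> (\<exists>x. sym_diff (f u) (f v) = {x})"
        unfolding sym_diff_singleton
          psubset_card_Suc[OF fin[OF fv[OF that(1)]]] psubset_card_Suc[OF fin[OF fv[OF that(2)]]] ..
      finally show ?thesis .
    qed
    show "{u, v} \<in> E \<longleftrightarrow> u < n \<and> v < n \<and> (\<exists>x. sym_diff (f u) (f v) = {x})"
    proof (cases "u < n \<and> v < n")
      case True
      then show ?thesis using eq iso by simp
    next
      case False
      then show ?thesis using lt[of u "{u, v}"] lt[of v "{u, v}"] by auto
    qed
  qed
  then show ?thesis by blast
qed

text \<open>Some edge in the class of \<open>y\<close> is incident to \<open>v0\<close>; its upper
  end contains both \<open>y\<close> and the whole clique of \<open>v0\<close>.\<close>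

lemma (in clique_graph) central_universal:
  assumes c: "central {..<n} E v0" and x: "x \<in> el v0" and y: "{y} \<in> K"
  shows "{x, y} \<in> K"
proof -
  have v0: "v0 < n" using c by (simp add: central_def)
  have "cl y \<in> Theta_classes E" using y Theta_classes_eq by blast
  then obtain e where e: "e \<in> cl y" "v0 \<in> e" using c unfolding central_def by blast
  obtain C where C: "y \<notin> C" "insert y C \<in> K" "e = {ver C, ver (insert y C)}"
    using e(1) by (rule pair_cl_insert)
  have "C \<in> K" using C(2) by (rule K_down) blast
  then have "el v0 = C \<or> el v0 = insert y C" using C e(2) el_ver by auto
  then have "{x, y} \<subseteq> insert y C" using x by auto
  then show ?thesis by (rule K_down[OF C(2)])
qed

text \<open>The union with the central clique is a clique by universality and the flag property, and
  the symmetric difference is a subset of it.\<close>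

lemma (in clique_graph) sym_diff_central_K:
  assumes c: "central {..<n} E v0" and C: "C \<in> K"
  shows "sym_diff C (el v0) \<in> K"
proof (rule K_down)
  have v0: "v0 < n" using c by (simp add: central_def)
  show "C \<union> el v0 \<in> K"
  proof (rule K_flag)
    show "finite (C \<union> el v0)" using K_finite[OF C] finite_el[OF v0] by simp
    fix x y assume "x \<in> C \<union> el v0" "y \<in> C \<union> el v0"
    then consider "x \<in> C" "y \<in> C" | "x \<in> el v0" "{y} \<in> K" | "y \<in> el v0" "{x} \<in> K"
      using in_K_single[OF C] in_K_single[OF el_K[OF v0]] by blast
    then show "{x, y} \<in> K"
    proof cases
      case 1
      then show ?thesis using K_down[OF C] by simp
    next
      case 2
      then show ?thesis by (rule central_universal[OF c])
    next
      case 3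
      then show ?thesis using central_universal[OF c] by (metis insert_commute)
    qed
  qed
qed blast

lemma sym_diff_cancel: "sym_diff (sym_diff A C) C = A"
  by blast

lemma sym_diff_cancel2: "sym_diff (sym_diff A C) (sym_diff B C) = sym_diff A B"
  by blast

text \<open>The members of a central clique are universal, so the symmetric difference with it is an
  automorphism of the simplex graph that moves the central vertex to the empty clique.\<close>

lemma (in clique_graph) clique_graph_at_central:
  assumes c: "central {..<n} E v0"
  shows "clique_graph n E (\<lambda>v. sym_diff (el v) (el v0))" (is "clique_graph n E ?f")
proof -
  \<comment> \<open>The symmetric difference is an involution, so it permutes \<open>K\<close>, and
    all closure properties are inherited from \<open>K\<close>.\<close>
  have "K \<subseteq> ?f ` {..<n}"
  proof
    fix C assume C: "C \<in> K"
    have k: "sym_diff C (el v0) \<in> K" by (rule sym_diff_central_K[OF c C])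
    have "?f (ver (sym_diff C (el v0))) = C" by (simp only: el_ver[OF k] sym_diff_cancel)
    moreover have "ver (sym_diff C (el v0)) \<in> {..<n}" using ver_in[OF k] by simp
    ultimately show "C \<in> ?f ` {..<n}" by (metis (no_types, lifting) imageI)
  qed
  moreover have "?f ` {..<n} \<subseteq> K" using sym_diff_central_K[OF c] by auto
  ultimately have img: "?f ` {..<n} = K" by blast
  show ?thesis
  proof
    show "inj_on ?f {..<n}"
    proof (rule inj_onI)
      fix u v assume uv: "u \<in> {..<n}" "v \<in> {..<n}" "?f u = ?f v"
      then have "el u = el v" using sym_diff_cancel[of "el u" "el v0"] sym_diff_cancel[of "el v" "el v0"] by argo
      then show "u = v" using uv el_inj by simp
    qed
    show "finite (?f v)" if "v < n" for v
    proof -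
      have "?f v \<in> K" using img that by blast
      then show ?thesis by (rule K_finite)
    qed
    show "S \<in> ?f ` {..<n}" if "v < n" "S \<subseteq> ?f v" for v S
    proof -
      have "?f v \<in> K" using img that(1) by blast
      then show ?thesis unfolding img using that(2) by (rule K_down)
    qed
    show "S \<in> ?f ` {..<n}"
      if "finite S" "\<And>x y. x \<in> S \<Longrightarrow> y \<in> S \<Longrightarrow> {x, y} \<in> ?f ` {..<n}" for S
      using that unfolding img by (rule K_flag)
    show "{u, v} \<in> E \<longleftrightarrow> u < n \<and> v < n \<and> (\<exists>x. sym_diff (?f u) (?f v) = {x})" for u v
      unfolding sym_diff_cancel2 by (rule edges)
  qed (rule edge_pair)
qed

text \<open>Naming an element by the vertex of its singleton clique lets the program store elements as
  vertices.\<close>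

lemma (in clique_graph) rooted_relabelling:
  assumes v0: "v0 < n" "el v0 = {}"
  shows "rooted_clique_graph n E (\<lambda>v. (\<lambda>x. ver {x}) ` el v) v0"
proof -
  let ?g = "\<lambda>x. ver {x}" and ?U = "{x. {x} \<in> K}"
  have ginj: "inj_on ?g ?U" by (rule inj_onI) (metis el_ver mem_Collect_eq singleton_inject)
  have sub: "C \<subseteq> ?U" if "C \<in> K" for C using in_K_single[OF that] by blast
  have elU: "el v \<subseteq> ?U" if "v < n" for v using sub that by simp
  have img: "(\<lambda>v. ?g ` el v) ` {..<n} = (`) ?g ` K" by (auto simp: K_def)
  have Kinj: "inj_on ((`) ?g) K"
    by (rule inj_onI) (use inj_on_image_eq_iff[OF ginj] sub in blast)
  show ?thesis
  proof
    show "inj_on (\<lambda>v. ?g ` el v) {..<n}"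
      by (rule inj_onI) (use inj_on_image_eq_iff[OF ginj] elU el_inj in auto)
    show "finite (?g ` el v)" if "v < n" for v using finite_el[OF that] by simp
    show "S \<in> (\<lambda>v. ?g ` el v) ` {..<n}" if "v < n" "S \<subseteq> ?g ` el v" for v S
    proof -
      obtain T where "T \<subseteq> el v" "S = ?g ` T" using \<open>S \<subseteq> ?g ` el v\<close> by (meson subset_imageE)
      then show ?thesis unfolding img using that(1) K_down el_K by blast
    qed
    show "S \<in> (\<lambda>v. ?g ` el v) ` {..<n}"
      if S: "finite S" "\<And>x y. x \<in> S \<Longrightarrow> y \<in> S \<Longrightarrow> {x, y} \<in> (\<lambda>v. ?g ` el v) ` {..<n}" for S
    proof -
      have "\<exists>x\<in>?U. s = ?g x" if s: "s \<in> S" for s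
      proof -
        obtain C where "C \<in> K" "{s} = ?g ` C" using S(2)[OF s s] img by auto
        then show ?thesis using sub by blast
      qed
      then have "S \<subseteq> ?g ` ?U" by blast
      then obtain T where T: "T \<subseteq> ?U" "S = ?g ` T" by (meson subset_imageE)
      have "finite T" using T S(1) ginj by (metis finite_imageD inj_on_subset)
      have "T \<in> K"
      proof (rule K_flag[OF \<open>finite T\<close>])
        fix x y assume xy: "x \<in> T" "y \<in> T"
        then have "{?g x, ?g y} \<in> (`) ?g ` K" using S(2) T(2) img by auto
        then obtain C where C: "C \<in> K" "?g ` {x, y} = ?g ` C" by auto
        then have "{x, y} = C" using inj_on_image_eq_iff[OF ginj, of "{x, y}" C] sub xy T(1) by auto
        then show "{x, y} \<in> K" using C by simp
      qed
      then show ?thesis unfolding img using T by blast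
    qed
    show "\<exists>u v. e = {u, v}" if "e \<in> E" for e using that by (rule edge_pair)
    show "{u, v} \<in> E \<longleftrightarrow> u < n \<and> v < n \<and> (\<exists>x. sym_diff (?g ` el u) (?g ` el v) = {x})" for u v
    proof -
      have "(\<exists>x. sym_diff (?g ` el u) (?g ` el v) = {x}) \<longleftrightarrow> (\<exists>x. sym_diff (el u) (el v) = {x})"
        if "u < n" "v < n"
      proof -
        have "sym_diff (?g ` el u) (?g ` el v) = ?g ` sym_diff (el u) (el v)"
          using elU[OF that(1)] elU[OF that(2)] inj_on_image_set_diff[OF ginj, of "el u" "el v"]
            inj_on_image_set_diff[OF ginj, of "el v" "el u"] by (auto simp: image_Un)
        moreover have "card (?g ` sym_diff (el u) (el v)) = card (sym_diff (el u) (el v))"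
          using elU[OF that(1)] elU[OF that(2)]
          by (intro card_image inj_on_subset[OF ginj]) blast
        ultimately show ?thesis by (simp only: card_1_singleton_iff[symmetric])
      qed
      then show ?thesis using edges[of u v] by metis
    qed
    show "v0 < n" "?g ` el v0 = {}" using v0 by simp_all
    show "x < n \<and> ?g ` el x = {x}" if "v < n" "x \<in> ?g ` el v" for v x
    proof -
      from that obtain y where y: "{y} \<in> K" "x = ver {y}" using elU by blast
      then show ?thesis by (simp add: ver_in)
    qed
  qed
qed

lemma ex_rooted_clique_graph:
  assumes "WOPP_instance {..<n} E v0 \<omega>"
  shows "\<exists>el. rooted_clique_graph n E el v0"
proof -
  have c: "central {..<n} E v0" and s: "simplex_graph {..<n} E"
    using assms by (auto simp: WOPP_instance_def)
  obtain el :: "nat \<Rightarrow> nat set" where "clique_graph n E el"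
    using simplex_clique_graph[OF s] by blast
  then interpret A: clique_graph n E el .
  interpret B: clique_graph n E "\<lambda>v. sym_diff (el v) (el v0)"
    by (rule A.clique_graph_at_central[OF c])
  show ?thesis using B.rooted_relabelling[of v0] c by (auto simp: central_def)
qed

section \<open>Instances of WOPP\<close>

text \<open>The bound on \<open>W\<close> covers the table indices \<open>v * n + x\<close>, the
  \<open>2 * m\<close> arcs and the queue, which is kept within \<open>n * n + 2 * n\<close>
  slots.\<close>

locale wopp = rooted_clique_graph n E el v0
  for n :: nat and E :: "nat set set" and el :: "nat \<Rightarrow> nat set" and v0 :: nat +
  fixes \<omega> :: "nat set set set \<Rightarrow> nat" and es :: "(nat \<times> nat) list" and ps :: "nat list list"
    and W :: nat
  assumes es: "encodes_edges es E" and ps: "encodes_POFs ps es E"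
    and \<omega>_pos: "X \<in> POFs E \<Longrightarrow> 0 < \<omega> X"
    and \<omega>_W: "X \<in> POFs E \<Longrightarrow> \<omega> X < W"
    and W: "4 * (n * n) + 4 * n + 10 \<le> W"
begin

abbreviation m :: nat where "m \<equiv> length es"

definition lab :: "nat \<Rightarrow> nat" where "lab e = (THE x. edge_at es e \<in> cl x)"

definition w :: "nat \<Rightarrow> nat" where "w v = \<omega> (cl ` el v)"

text \<open>The largest clique size, the parameter of all running times until
  \<open>D_le_dimension\<close> is applied at the very end.\<close>

definition D :: nat where "D = Max ((\<lambda>v. card (el v)) ` {..<n})"

definition pv :: "nat \<Rightarrow> nat" where "pv i = ver (lab ` set (ps ! i))"

lemma card_le_D: "v < n \<Longrightarrow> card (el v) \<le> D"
  unfolding D_def by (rule Max_ge) auto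

lemma D_attained: "\<exists>v<n. card (el v) = D"
proof -
  have "D \<in> (\<lambda>v. card (el v)) ` {..<n}"
    unfolding D_def using n_pos by (intro Max_in) auto
  then show ?thesis by auto
qed

lemma el_subset: "v < n \<Longrightarrow> el v \<subseteq> {..<n}"
  using sing by blast

lemma D_le_n: "D \<le> n"
proof -
  obtain v where "v < n" "card (el v) = D" using D_attained by blast
  then show ?thesis using card_mono[OF _ el_subset, of v] by simp
qed

lemma D_le_dimension: "D \<le> dimension {..<n} E"
proof -
  obtain v where "v < n" "card (el v) = D" using D_attained by blast
  then show ?thesis using card_el_le_dimension[of v] by simp
qed

lemma edge_at_E: "e < m \<Longrightarrow> edge_at es e \<in> E"
  using es unfolding encodes_edges_def bij_betw_def by blast

lemma lab_eqI: "edge_at es e \<in> cl x \<Longrightarrow> lab e = x"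
  unfolding lab_def using cl_unique by blast

lemma edge_at_lab: "e < m \<Longrightarrow> edge_at es e \<in> cl (lab e)"
  using edge_cl[OF edge_at_E] lab_eqI by blast

lemma class_of_eq: "e < m \<Longrightarrow> class_of es E e = cl (lab e)"
  unfolding class_of_def by (rule Theta_image[OF edge_at_lab])

lemma lab_lt: "e < m \<Longrightarrow> lab e < n"
  using cl_label[OF edge_at_lab] sing ver_in el_ver by (metis singletonI)

text \<open>An edge is determined by its upper end and the element that the lower end lacks.\<close>

lemma m_le: "m \<le> n * D"
proof -
  have "E \<subseteq> (\<lambda>(v, x). {ver (el v - {x}), v}) ` (SIGMA v:{..<n}. el v)"
  proof
    fix e assume "e \<in> E"
    then obtain x where "e \<in> cl x" using edge_cl by blast
    then obtain C where C: "x \<notin> C" "insert x C \<in> K" "e = {ver C, ver (insert x C)}"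
      by (rule pair_cl_insert)
    have "(ver (insert x C), x) \<in> (SIGMA v:{..<n}. el v)" using C ver_in by auto
    moreover have "e = (\<lambda>(v, x). {ver (el v - {x}), v}) (ver (insert x C), x)"
      using C by (auto simp: el_ver)
    ultimately show "e \<in> (\<lambda>(v, x). {ver (el v - {x}), v}) ` (SIGMA v:{..<n}. el v)" by blast
  qed
  moreover have fin: "finite (SIGMA v:{..<n}. el v)" using finite_el by auto
  ultimately have "card E \<le> card (SIGMA v:{..<n}. el v)" by (rule surj_card_le[rotated])
  also have "\<dots> = (\<Sum>v<n. card (el v))" using finite_el by (subst card_SigmaI) auto
  also have "\<dots> \<le> (\<Sum>v<n. D)" by (rule sum_mono) (simp add: card_le_D)
  also have "card E = m" using es unfolding encodes_edges_def by (metis bij_betw_same_card card_lessThan)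
  finally show ?thesis by simp
qed

lemma pof_of_eq: "set p \<subseteq> {..<m} \<Longrightarrow> pof_of es E p = cl ` (lab ` set p)"
  unfolding pof_of_def image_image by (rule image_cong) (auto simp: class_of_eq)

lemma bij_pof: "bij_betw (\<lambda>i. pof_of es E (ps ! i)) {..<length ps} (POFs E)"
  using ps by (simp add: encodes_POFs_def)

text \<open>Vertices and POFs are both in bijection with \<open>K\<close>, so the answers for all
  POFs form an output of linear size.\<close>

lemma length_ps: "length ps = n"
proof -
  have "length ps = card (POFs E)" using bij_betw_same_card[OF bij_pof] by simp
  also have "\<dots> = card K" unfolding POFs_eq by (rule card_image[OF cl_image_inj])
  also have "\<dots> = n" unfolding K_def using card_image[OF inj] by simp
  finally show ?thesis .
qed

lemma ps_set: "i < n \<Longrightarrow> set (ps ! i) \<subseteq> {..<m}"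
  using ps length_ps by (auto simp: encodes_POFs_def)

lemma lab_ps_K: "i < n \<Longrightarrow> lab ` set (ps ! i) \<in> K"
proof -
  assume i: "i < n"
  then have "pof_of es E (ps ! i) \<in> (`) cl ` K"
    using bij_pof length_ps unfolding bij_betw_def POFs_eq by blast
  then obtain C where C: "C \<in> K" "cl ` (lab ` set (ps ! i)) = cl ` C"
    using pof_of_eq[OF ps_set[OF i]] by auto
  have "lab ` set (ps ! i) \<subseteq> {x. {x} \<in> K}" using ps_set[OF i] edge_at_lab cl_label by blast
  moreover have "C \<subseteq> {x. {x} \<in> K}" using in_K_single[OF C(1)] by blast
  ultimately show ?thesis using C inj_on_image_eq_iff[OF cl_inj_on] by metis
qed

lemma el_pv: "i < n \<Longrightarrow> el (pv i) = lab ` set (ps ! i)"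
  unfolding pv_def using lab_ps_K by simp

lemma pv_lt: "i < n \<Longrightarrow> pv i < n"
  unfolding pv_def using lab_ps_K ver_in by simp

lemma pof_of_pv: "i < n \<Longrightarrow> pof_of es E (ps ! i) = cl ` el (pv i)"
  using pof_of_eq ps_set el_pv by simp

lemma pv_bij: "bij_betw pv {..<n} {..<n}"
proof -
  have "inj_on pv {..<n}"
  proof (rule inj_onI)
    fix i j assume ij: "i \<in> {..<n}" "j \<in> {..<n}" "pv i = pv j"
    then have "pof_of es E (ps ! i) = pof_of es E (ps ! j)" by (simp add: pof_of_pv)
    then show "i = j" using ij bij_pof length_ps by (auto simp: bij_betw_def dest: inj_onD)
  qed
  moreover have "pv ` {..<n} \<subseteq> {..<n}" using pv_lt by auto
  ultimately show ?thesis by (simp add: bij_betw_def endo_inj_surj)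
qed

lemma distinct_lab_ps: "i < n \<Longrightarrow> distinct (map lab (ps ! i))"
proof -
  assume i: "i < n"
  have "distinct (map (class_of es E) (ps ! i))"
    using ps i length_ps by (auto simp: encodes_POFs_def)
  also have "map (class_of es E) (ps ! i) = map (\<lambda>e. cl (lab e)) (ps ! i)"
    using ps_set[OF i] by (auto simp: class_of_eq)
  finally show ?thesis unfolding distinct_map inj_on_def by metis
qed

lemma length_ps_nth: "i < n \<Longrightarrow> length (ps ! i) = card (el (pv i))"
proof -
  assume i: "i < n"
  then have "card (lab ` set (ps ! i)) = length (ps ! i)" using distinct_lab_ps distinct_card by fastforce
  then show ?thesis using el_pv[OF i] by simp
qed

lemma cl_image_POFs: "C \<in> K \<Longrightarrow> cl ` C \<in> POFs E"
  using POFs_eq by blast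

lemma w_pos: "v < n \<Longrightarrow> 0 < w v"
  unfolding w_def by (intro \<omega>_pos cl_image_POFs el_K)

lemma max_opposite_cl:
  assumes "u < n" "v < n"
  shows "max_opposite E \<omega> (cl ` el u) (cl ` el v) \<longleftrightarrow>
    el u \<inter> el v = {} \<and> (\<forall>y<n. el u \<inter> el y = {} \<longrightarrow> w y \<le> w v)"
  unfolding max_opposite_def POFs_eq using assms
  by (auto simp: K_def w_def cl_image_disjoint[unfolded K_def])

lemma arc_up:
  assumes "{u, v} \<in> cl x" "card (el v) = card (el u) + 1"
  shows "u < n" "v < n" "x \<notin> el u" "el v = insert x (el u)"
proof -
  have l: "u < n" "v < n" and s: "sym_diff (el u) (el v) = {x}" using assms(1) by (auto simp: pair_cl)
  then consider "\<exists>x. x \<notin> el u \<and> el v = insert x (el u)" | "\<exists>x. x \<notin> el v \<and> el u = insert x (el v)"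
    using sym_diff_singleton by metis
  then have "x \<notin> el u \<and> el v = insert x (el u)"
  proof cases
    case 1
    then obtain y where y: "y \<notin> el u" "el v = insert y (el u)" by blast
    then have "sym_diff (el u) (el v) = {y}" by blast
    then show ?thesis using s y by simp
  next
    case 2
    then have "card (el u) = card (el v) + 1" using finite_el l by auto
    then show ?thesis using assms(2) by simp
  qed
  then show "u < n" "v < n" "x \<notin> el u" "el v = insert x (el u)" using l by auto
qed

lemma down_edge:
  assumes "v < n" "x \<in> el v"
  shows "{ver (el v - {x}), v} \<in> E" "ver (el v - {x}) < n" "el (ver (el v - {x})) = el v - {x}"
proof -
  have k: "el v - {x} \<in> K" using K_down[OF el_K[OF assms(1)]] by blast
  then show "ver (el v - {x}) < n" "el (ver (el v - {x})) = el v - {x}" by (simp_all add: ver_in)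
  have "{ver (el v - {x}), ver (insert x (el v - {x}))} \<in> cl x"
    using assms by (intro insert_pair_cl) (auto simp: insert_absorb)
  then show "{ver (el v - {x}), v} \<in> E" using assms cl_subset by (auto simp: insert_absorb)
qed

lemma idx_less: "v < n \<Longrightarrow> x < n \<Longrightarrow> v * n + x < n * n"
proof -
  assume a: "v < n" "x < n"
  have "v * n + x < v * n + n" using a by simp
  also have "v * n + n = Suc v * n" by simp
  also have "\<dots> \<le> n * n" using a by (intro mult_le_mono1) simp
  finally show ?thesis .
qed

lemma idx_eq: "x < n \<Longrightarrow> y < n \<Longrightarrow> u * n + x = v * n + y \<longleftrightarrow> u = v \<and> x = y"
proof
  assume a: "x < n" "y < n" "u * n + x = v * n + y"
  have "(u * n + x) div n = u" "(v * n + y) div n = v" using a(1,2) by simp_all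
  then have "u = v" using a(3) by simp
  then show "u = v \<and> x = y" using a(3) by simp
qed auto

lemma W_gt: "n < W" "n * n < W" "1 < W" "n * n + n < W" "2 * (n * n) < W"
  using W by auto

lemma m_le_nn: "m \<le> n * n"
  using m_le D_le_n by (meson le_trans mult_le_mono2)

end

section \<open>Tables of cliques and labels\<close>

text \<open>Two-dimensional tables are kept in one array at index \<open>v * n + x\<close>; as unused cells are zero they
  need no initialisation. The products \<open>v * n\<close> are tabulated in \<open>b\<close>, since the machine cannot multiply.\<close>

definition init_prog :: com where
  "init_prog =
     For ''i'' (V ''n'')
       (Write ''b'' (V ''i'') (V ''acc'') ;; ''acc'' ::= Plus (V ''acc'') (V ''n'')) ;;
     For ''i'' (V ''m'')
       (Write ''src'' (V ''i'') (Read ''edge_fst'' (V ''i'')) ;;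
        Write ''dst'' (V ''i'') (Read ''edge_snd'' (V ''i'')) ;;
        Write ''aid'' (V ''i'') (V ''i'') ;;
        ''j'' ::= Plus (V ''m'') (V ''i'') ;;
        Write ''src'' (V ''j'') (Read ''edge_snd'' (V ''i'')) ;;
        Write ''dst'' (V ''j'') (Read ''edge_fst'' (V ''i'')) ;;
        Write ''aid'' (V ''j'') (V ''i'')) ;;
     ''m2'' ::= Plus (V ''m'') (V ''m'')"

context wopp
begin

text \<open>Each edge occurs in both orientations, so a scan can pick the upward one without knowing
  it beforehand; \<open>aid\<close> leads back to the edge index that names the class.\<close>

definition arcs :: "memory \<Rightarrow> bool" where
  "arcs s \<longleftrightarrow> s ''m2'' 0 = 2 * m \<and>
    (\<forall>a<2 * m. s ''aid'' a < m \<and> edge_at es (s ''aid'' a) = {s ''src'' a, s ''dst'' a}) \<and>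
    (\<forall>e u v. e < m \<longrightarrow> edge_at es e = {u, v} \<longrightarrow>
       (\<exists>a<2 * m. s ''aid'' a = e \<and> s ''src'' a = u \<and> s ''dst'' a = v))"

definition bases :: "memory \<Rightarrow> bool" where
  "bases s \<longleftrightarrow> (\<forall>v<n. s ''b'' v = v * n)"

lemma wp_init_prog:
  assumes s0: "s0 ''n'' 0 = n" "s0 ''m'' 0 = m" "s0 ''acc'' 0 = 0"
    "\<And>e. e < m \<Longrightarrow> s0 ''edge_fst'' e = fst (es ! e) \<and> s0 ''edge_snd'' e = snd (es ! e)"
  shows "wp W init_prog (\<lambda>t s. t \<le> 50 * n + 100 * m + 100 \<and>
    same {''i'', ''b'', ''acc'', ''src'', ''dst'', ''aid'', ''j'', ''m2''} s0 s \<and> bases s \<and> arcs s) s0"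
  unfolding init_prog_def
proof (subst wp_Seq, rule wp_For[where h = n and B = 20 and
      I = "\<lambda>k s. same {''i'', ''b'', ''acc''} s0 s \<and> s ''acc'' 0 = k * n \<and> (\<forall>v<k. s ''b'' v = v * n)"],
    goal_cases)
  case 1
  then show ?case using s0 by simp
next
  case (2 k s)
  then show ?case using s0 W_gt by (simp add: same_def)
next
  case (5 k s)
  have "k * n \<le> n * n" using 5 by simp
  moreover have "Suc k \<le> n" using 5 by simp
  then have "k * n + n \<le> n * n" by (metis add.commute mult_Suc mult_le_mono1)
  ultimately show ?case using 5 s0 W_gt
    by (auto simp: less_Suc_eq same_def)
next
  case (6 t1 s1)
  let ?M = "{''i'', ''src'', ''dst'', ''aid'', ''j''}"
  let ?arc = "\<lambda>s a e u v. s ''aid'' a = e \<and> s ''src'' a = u \<and> s ''dst'' a = v"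
  note [simp] = sameD[OF conjunct1[OF 6(1)], of "''n''"] sameD[OF conjunct1[OF 6(1)], of "''m''"]
    sameD[OF conjunct1[OF 6(1)], of "''edge_fst''"] sameD[OF conjunct1[OF 6(1)], of "''edge_snd''"]
  show ?case
  proof (subst wp_Seq, rule wp_For[where h = m and B = 60 and
      I = "\<lambda>k s. same ?M s1 s \<and>
        (\<forall>e<k. ?arc s e e (fst (es ! e)) (snd (es ! e)) \<and> ?arc s (m + e) e (snd (es ! e)) (fst (es ! e)))"],
      goal_cases)
    case 1
    then show ?case by simp
  next
    case (2 k s)
    then show ?case using s0 W_gt by (simp add: same_def)
  next
    case (5 k s)
    have eq: "s ''m'' = s1 ''m''" "s ''edge_fst'' = s1 ''edge_fst''" "s ''edge_snd'' = s1 ''edge_snd''"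
      using 5 by (simp_all add: same_def)
    have lt: "m + k < W" "m + Suc k \<le> W" "k < m" "1 < W" using 5 m_le_nn W_gt by linarith+
    have I: "same ?M s1 s" "s ''i'' 0 = k"
      "\<And>e. e < k \<Longrightarrow> ?arc s e e (fst (es ! e)) (snd (es ! e)) \<and> ?arc s (m + e) e (snd (es ! e)) (fst (es ! e))"
      using 5 by simp_all
    show ?case
      using lt by (auto simp: I eq s0 elim!: less_SucE)
  next
    case (6 t2 s2)
    have s2: "\<And>e. e < m \<Longrightarrow> ?arc s2 e e (fst (es ! e)) (snd (es ! e))"
      "\<And>e. e < m \<Longrightarrow> ?arc s2 (m + e) e (snd (es ! e)) (fst (es ! e))"
      using 6 by auto
    have "s2 ''m'' = s1 ''m''" using 6 by (intro sameD[of ?M s1]) auto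
    moreover have "same {''i'', ''b'', ''acc'', ''src'', ''dst'', ''aid'', ''j'', ''m2''} s0 s2"
      using \<open>same {''i'', ''b'', ''acc''} s0 s1 \<and> _\<close> 6 by (auto intro: same_trans)
    moreover have "\<forall>v<n. s2 ''b'' v = v * n"
      using \<open>same {''i'', ''b'', ''acc''} s0 s1 \<and> _\<close> 6 sameD[of ?M s1 s2 "''b''"] by auto
    moreover have "s2 ''aid'' a < m \<and> edge_at es (s2 ''aid'' a) = {s2 ''src'' a, s2 ''dst'' a}"
      if "a < 2 * m" for a
    proof (cases "a < m")
      case True
      then show ?thesis using s2(1) by (simp add: edge_at_def)
    next
      case False
      then have a: "a - m < m" "m + (a - m) = a" using that by auto
      from s2(2)[OF a(1)] show ?thesis unfolding a(2) using a(1) by (auto simp: edge_at_def)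
    qed
    moreover have "\<exists>a<2 * m. ?arc s2 a e u v" if e: "e < m" and uv: "edge_at es e = {u, v}" for e u v
    proof -
      have "fst (es ! e) = u \<and> snd (es ! e) = v \<or> fst (es ! e) = v \<and> snd (es ! e) = u"
        using uv by (auto simp: edge_at_def doubleton_eq_iff)
      then show ?thesis
      proof
        assume "fst (es ! e) = u \<and> snd (es ! e) = v"
        then show ?thesis using s2(1)[OF e] e by (intro exI[of _ e]) auto
      next
        assume "fst (es ! e) = v \<and> snd (es ! e) = u"
        then show ?thesis using s2(2)[OF e] e by (intro exI[of _ "m + e"]) auto
      qed
    qed
    ultimately show ?case
      using s0 m_le_nn W_gt 6(3) \<open>t1 \<le> _\<close>
      by (auto simp: arcs_def bases_def)
  qed (use W_gt m_le_nn in auto)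
qed (use W_gt in auto)

end

section \<open>Clique sizes by breadth-first search from the central vertex\<close>

definition level_round :: com where
  "level_round =
     For ''a'' (V ''m2'')
       (''v'' ::= Read ''dst'' (V ''a'') ;;
        If (And (Equal (Read ''lev'' (Read ''src'' (V ''a''))) (V ''r''))
                (Equal (Read ''lev'' (V ''v'')) (Const 0)))
          (Write ''lev'' (V ''v'') (Plus (V ''r'') (Const 1)) ;;
           Write ''ord'' (V ''cnt'') (V ''v'') ;;
           ''cnt'' ::= Plus (V ''cnt'') (Const 1))
          Skip)"

text \<open>Levels are shifted by one, as 0 marks an unseen vertex in the zeroed memory.
  \<open>ord\<close> receives the vertices in order of discovery, hence sorted by clique size.
  \<open>prev\<close> starts at 0, and the loop ends after a round without a discovery.\<close>

definition level_prog :: com where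
  "level_prog =
     Write ''lev'' (V ''v0'') (Const 1) ;;
     ''ord'' ::= V ''v0'' ;;
     ''cnt'' ::= Const 1 ;;
     ''r'' ::= Const 1 ;;
     While (Less (V ''prev'') (V ''cnt''))
       (''prev'' ::= V ''cnt'' ;; level_round ;; ''r'' ::= Plus (V ''r'') (Const 1))"

context wopp
begin

abbreviation lv :: "nat \<Rightarrow> nat" where "lv v \<equiv> card (el v)"

definition below :: "nat \<Rightarrow> nat set" where "below r = {v. v < n \<and> lv v < r}"

lemma finite_below [simp]: "finite (below r)"
  by (simp add: below_def)

lemma edge_levels:
  assumes "{u, v} \<in> E"
  shows "u < n \<and> v < n \<and> (lv v = lv u + 1 \<or> lv u = lv v + 1)"
proof -
  have l: "u < n" "v < n" and "\<exists>x. sym_diff (el u) (el v) = {x}" using assms edges by auto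
  then show ?thesis using finite_el unfolding sym_diff_singleton by auto
qed

lemma lv_0: "v < n \<Longrightarrow> lv v = 0 \<longleftrightarrow> v = v0"
  using v0 finite_el el_inj by (metis card_eq_0_iff)

lemma arcs_E: "arcs s \<Longrightarrow> a < 2 * m \<Longrightarrow> {s ''src'' a, s ''dst'' a} \<in> E"
  unfolding arcs_def using edge_at_E by metis

lemma arcs_ex: "arcs s \<Longrightarrow> {u, v} \<in> E \<Longrightarrow> \<exists>a<2 * m. s ''src'' a = u \<and> s ''dst'' a = v"
  using es unfolding arcs_def encodes_edges_def bij_betw_def by (metis imageE lessThan_iff)

lemma below_Suc_nonempty: "v < n \<Longrightarrow> k \<le> lv v \<Longrightarrow> \<exists>u<n. lv u = k"
proof -
  assume "v < n" "k \<le> lv v"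
  then obtain S where "S \<subseteq> el v" "card S = k" by (meson obtain_subset_with_card_n)
  then show ?thesis using K_down[OF el_K[OF \<open>v < n\<close>]] ver_in el_ver by metis
qed

text \<open>The set \<open>A\<close> is explicit because in the middle of a round it lies between
  \<open>below r\<close> and \<open>below (r + 1)\<close>.\<close>

definition discovered :: "memory \<Rightarrow> nat set \<Rightarrow> bool" where
  "discovered s A \<longleftrightarrow> A \<subseteq> {..<n} \<and> s ''cnt'' 0 = card A \<and>
     (\<forall>v<n. s ''lev'' v = (if v \<in> A then lv v + 1 else 0)) \<and>
     bij_betw (s ''ord'') {..<card A} A \<and>
     (\<forall>i j. i < j \<longrightarrow> j < card A \<longrightarrow> lv (s ''ord'' i) \<le> lv (s ''ord'' j))"

lemma discovered_insert:
  assumes d: "discovered s A" and v: "v < n" "v \<notin> A" and le: "\<And>u. u \<in> A \<Longrightarrow> lv u \<le> lv v"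
    and upd: "s' ''lev'' = (s ''lev'')(v := lv v + 1)" "s' ''ord'' = (s ''ord'')(card A := v)"
      "s' ''cnt'' 0 = card A + 1"
  shows "discovered s' (insert v A)"
proof -
  have fin: "finite A" using d finite_subset unfolding discovered_def by blast
  have c: "card (insert v A) = Suc (card A)" using fin v by simp
  have b: "bij_betw (s ''ord'') {..<card A} A" using d by (simp add: discovered_def)
  have "bij_betw ((s ''ord'')(card A := v)) (insert (card A) {..<card A}) (insert v A)"
    using notIn_Un_bij_betw[of "card A" "{..<card A}" "(s ''ord'')(card A := v)" A] v b
    by (auto simp: bij_betw_def inj_on_def)
  then have "bij_betw (s' ''ord'') {..<card (insert v A)} (insert v A)"
    unfolding upd c lessThan_Suc .
  moreover have "lv (s' ''ord'' i) \<le> lv (s' ''ord'' j)" if "i < j" "j < card (insert v A)" for i j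
    using that d le bij_betwE[OF b] unfolding upd c discovered_def by (auto simp: less_Suc_eq)
  ultimately show ?thesis
    using d v unfolding discovered_def upd c by auto
qed

text \<open>A clique of size \<open>r\<close> loses an element along an edge to one of size
  \<open>r - 1\<close>, which is already discovered. Nothing larger is reached from there, as an
  edge changes the size by one.\<close>

lemma wp_level_round:
  assumes "arcs s1" "discovered s1 (below r)" "s1 ''r'' 0 = r" "1 \<le> r" "r \<le> n + 2"
  shows "wp W level_round (\<lambda>t s. t \<le> 120 * m + 30 \<and>
    same {''a'', ''v'', ''lev'', ''ord'', ''cnt''} s1 s \<and> discovered s (below (r + 1))) s1"
  unfolding level_round_def
proof (rule wp_For[where h = "2 * m" and B = 40 and
      I = "\<lambda>k s. same {''a'', ''v'', ''lev'', ''ord'', ''cnt''} s1 s \<and>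
        (\<exists>A. discovered s A \<and> below r \<subseteq> A \<and> A \<subseteq> below (r + 1) \<and>
          (\<forall>a<k. lv (s1 ''src'' a) + 1 = r \<longrightarrow> lv (s1 ''dst'' a) = r \<longrightarrow> s1 ''dst'' a \<in> A))"],
    goal_cases)
  case 1
  have "discovered (s1(''a'' := (s1 ''a'')(0 := 0))) (below r)"
    using assms(2) by (simp add: discovered_def)
  then show ?case by (auto simp: below_def)
next
  case (2 k s)
  then show ?case using assms(1) W_gt by (simp add: same_def arcs_def)
next
  case (5 k s)
  let ?u = "s1 ''src'' k" and ?v = "s1 ''dst'' k"
  from 5 obtain A where k: "s ''a'' 0 = k" "k < 2 * m" and
    A: "discovered s A" "below r \<subseteq> A" "A \<subseteq> below (r + 1)"
    "\<And>a. a < k \<Longrightarrow> lv (s1 ''src'' a) + 1 = r \<Longrightarrow> lv (s1 ''dst'' a) = r \<Longrightarrow> s1 ''dst'' a \<in> A" 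
    and same: "same {''a'', ''v'', ''lev'', ''ord'', ''cnt''} s1 s" by blast
  have eq: "s ''src'' = s1 ''src''" "s ''dst'' = s1 ''dst''" "s ''r'' 0 = r"
    using same assms(3) by (simp_all add: same_def)
  have uv: "?u < n" "?v < n" "lv ?v = lv ?u + 1 \<or> lv ?u = lv ?v + 1"
    using edge_levels[OF arcs_E[OF assms(1) k(2)]] by blast+
  have lev: "s ''lev'' v = (if v \<in> A then lv v + 1 else 0)" if "v < n" for v
    using A(1) that by (simp add: discovered_def)
  have cnt: "s ''cnt'' 0 = card A" "card A \<le> n"
    using A(1) card_mono[of "{..<n}" A] by (auto simp: discovered_def)
  have below: "v \<in> below k \<longleftrightarrow> lv v < k" if "v < n" for v k using that by (simp add: below_def)
  show ?case
  proof (cases "s ''lev'' ?u = r \<and> s ''lev'' ?v = 0")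
    case True
    then have u: "lv ?u + 1 = r" and v: "?v \<notin> A"
      using lev[OF uv(1)] lev[OF uv(2)] assms(4) by (auto split: if_splits)
    have "?v \<in> A" if "lv ?v < r" using A(2) below[OF uv(2)] that by blast
    then have lv: "lv ?v = r" using uv(3) u v by auto
    let ?s' = "s(''v'' := (s ''v'')(0 := ?v), ''lev'' := (s ''lev'')(?v := Suc r),
           ''ord'' := (s ''ord'')(card A := ?v), ''cnt'' := (s ''cnt'')(0 := Suc (card A)),
           ''a'' := (s ''a'')(0 := Suc k))"
    have "discovered ?s' (insert ?v A)"
    proof (rule discovered_insert[OF A(1) uv(2) v])
      show "lv x \<le> lv ?v" if "x \<in> A" for x using A(3) that lv by (auto simp: below_def)
    qed (simp_all add: lv)
    moreover have "insert ?v A \<subseteq> below (r + 1)" using A(3) lv uv(2) by (auto simp: below_def)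
    moreover have "below r \<subseteq> insert ?v A" using A(2) by blast
    moreover have "s1 ''dst'' a \<in> insert ?v A"
      if "a < Suc k" "lv (s1 ''src'' a) + 1 = r" "lv (s1 ''dst'' a) = r" for a
      using A(4) that by (auto simp: less_Suc_eq)
    ultimately have "\<exists>A. discovered ?s' A \<and> below r \<subseteq> A \<and> A \<subseteq> below (r + 1) \<and>
      (\<forall>a<Suc k. lv (s1 ''src'' a) + 1 = r \<longrightarrow> lv (s1 ''dst'' a) = r \<longrightarrow> s1 ''dst'' a \<in> A)"
      by blast
    then show ?thesis using True W_gt W cnt assms(5) by (simp add: k eq same)
  next
    case False
    have "s1 ''dst'' k \<in> A" if "lv (s1 ''src'' k) + 1 = r" "lv (s1 ''dst'' k) = r"
    proof -
      have "?u \<in> A" using A(2) uv(1) that below by auto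
      then show ?thesis using False lev[OF uv(1)] lev[OF uv(2)] that by (auto split: if_splits)
    qed
    then have *: "\<And>a. a < Suc k \<Longrightarrow> lv (s1 ''src'' a) + 1 = r \<Longrightarrow> lv (s1 ''dst'' a) = r \<Longrightarrow> s1 ''dst'' a \<in> A"
      using A(4) less_Suc_eq by auto
    have "discovered (s(''v'' := (s ''v'')(0 := ?v), ''a'' := (s ''a'')(0 := Suc k))) A"
      using A(1) by (simp add: discovered_def)
    then show ?thesis using False W_gt * A(2,3) by (auto simp: k eq same)
  qed
next
  case (6 t s)
  then obtain A where
    A: "discovered s A" "below r \<subseteq> A" "A \<subseteq> below (r + 1)"
    "\<And>a. a < 2 * m \<Longrightarrow> lv (s1 ''src'' a) + 1 = r \<Longrightarrow> lv (s1 ''dst'' a) = r \<Longrightarrow> s1 ''dst'' a \<in> A"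
    by blast
  have "below (r + 1) \<subseteq> A"
  proof
    fix v assume "v \<in> below (r + 1)"
    then have v: "v < n" "lv v \<le> r" by (auto simp: below_def)
    show "v \<in> A"
    proof (cases "lv v = r")
      case True
      then obtain x where x: "x \<in> el v" using assms(4) by fastforce
      let ?u = "ver (el v - {x})"
      have "{?u, v} \<in> E" "lv ?u + 1 = r"
        using down_edge[OF v(1) x] True x finite_el[OF v(1)] assms(4) by simp_all
      then show ?thesis using arcs_ex[OF assms(1)] A(4) True by metis
    next
      case False
      then show ?thesis using v A(2) by (auto simp: below_def)
    qed
  qed
  then have "A = below (r + 1)" using A(3) by blast
  then show ?case using 6 A(1) by simp
qed (use W_gt m_le_nn in auto)

definition levels :: "memory \<Rightarrow> bool" where
  "levels s \<longleftrightarrow> (\<forall>v<n. s ''lev'' v = lv v + 1) \<and> bij_betw (s ''ord'') {..<n} {..<n} \<and>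
     (\<forall>i j. i < j \<longrightarrow> j < n \<longrightarrow> lv (s ''ord'' i) \<le> lv (s ''ord'' j)) \<and>
     s ''r'' 0 \<le> D + 2 \<and> (\<forall>v<n. lv v < s ''r'' 0)"

text \<open>Subsets of cliques are cliques, so no level below an occupied one is empty. A round
  without a discovery therefore means that all vertices have been seen.\<close>

lemma below_strict: "v < n \<Longrightarrow> r \<le> lv v \<Longrightarrow> card (below r) < card (below (r + 1))"
proof -
  assume "v < n" "r \<le> lv v"
  then obtain u where "u < n" "lv u = r" using below_Suc_nonempty by blast
  then have "below r \<subset> below (r + 1)" by (auto simp: below_def)
  then show ?thesis by (intro psubset_card_mono) auto
qed

lemma wp_level_prog:
  assumes "arcs s0" "s0 ''v0'' 0 = v0" "s0 ''prev'' 0 = 0" "\<And>v. s0 ''lev'' v = 0"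
  shows "wp W level_prog (\<lambda>t s. t \<le> (D + 2) * (120 * m + 60) + 30 \<and>
    same {''a'', ''v'', ''lev'', ''ord'', ''cnt'', ''r'', ''prev''} s0 s \<and> levels s) s0"
proof -
  let ?M = "{''a'', ''v'', ''lev'', ''ord'', ''cnt'', ''r'', ''prev''}"
  let ?c = "''prev'' ::= V ''cnt'' ;; level_round ;; ''r'' ::= Plus (V ''r'') (Const 1)"
  let ?I = "\<lambda>s. same ?M s0 s \<and> 1 \<le> s ''r'' 0 \<and> s ''r'' 0 \<le> D + 2 \<and>
    discovered s (below (s ''r'' 0)) \<and> s ''prev'' 0 = card (below (s ''r'' 0 - 1))"
  let ?s1 = "s0(''lev'' := (s0 ''lev'')(v0 := 1), ''ord'' := (s0 ''ord'')(0 := v0),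
      ''cnt'' := (s0 ''cnt'')(0 := 1), ''r'' := (s0 ''r'')(0 := 1))"
  have "wp W (While (Less (V ''prev'') (V ''cnt'')) ?c)
    (\<lambda>t s. t \<le> (D + 2) * (120 * m + 60) + 10 \<and> same ?M s0 s \<and> levels s) ?s1"
  proof (rule wp_While[where I = ?I and p = "\<lambda>s. (D + 2 - s ''r'' 0) * (120 * m + 60)"], goal_cases)
    case 1
    have "below 1 = {v0}" using lv_0 v0(1) by (auto simp: below_def)
    moreover have "discovered ?s1 {v0}"
      using assms(4) v0 by (auto simp: discovered_def bij_betw_def inj_on_def)
    moreover have "below 0 = {}" by (simp add: below_def)
    ultimately show ?case using assms(3) by simp
  next
    case (2 s)
    then show ?case using W_gt by simp
  next
    case (3 s)
    define r where "r = s ''r'' 0"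
    let ?s1 = "s(''prev'' := (s ''prev'')(0 := card (below r)))"
    have cnt: "s ''cnt'' 0 = card (below r)" and r: "1 \<le> r" "r \<le> D + 2"
      and d: "discovered s (below r)" and sm: "same ?M s0 s"
      using 3 by (auto simp: r_def discovered_def)
    \<comment> \<open>Otherwise the last two counts both equal \<open>n\<close>, against the loop
      condition \<open>prev < cnt\<close>.\<close>
    have "r < D + 2"
    proof (rule ccontr)
      assume "\<not> r < D + 2"
      then have "below (r - 1) = {..<n}" "below r = {..<n}"
        using card_le_D by (force simp: below_def)+
      then show False using 3 r_def cnt by simp
    qed
    have e: "(D + 2 - r) * (120 * m + 60) = (D + 2 - Suc r) * (120 * m + 60) + (120 * m + 60)"
      using \<open>r < D + 2\<close> by (metis Suc_diff_Suc add.commute mult_Suc)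
    have "arcs ?s1" using assms(1) sm by (simp add: arcs_def same_def)
    moreover have "discovered ?s1 (below r)" using d by (simp add: discovered_def)
    ultimately have "wp W level_round (\<lambda>t s. t \<le> 120 * m + 30 \<and>
      same {''a'', ''v'', ''lev'', ''ord'', ''cnt''} ?s1 s \<and> discovered s (below (r + 1))) ?s1"
      by (intro wp_level_round) (use r D_le_n r_def in auto)
    then have "wp W (level_round ;; ''r'' ::= Plus (V ''r'') (Const 1))
      (\<lambda>t s'. ?I s' \<and> (D + 2 - s' ''r'' 0) * (120 * m + 60) + (t + 10) \<le> (D + 2 - r) * (120 * m + 60)) ?s1"
      unfolding wp_Seq
    proof (rule wp_conseq, goal_cases)
      case (1 t s')
      then have s': "t \<le> 120 * m + 30" "same {''a'', ''v'', ''lev'', ''ord'', ''cnt''} ?s1 s'"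
        "discovered s' (below (Suc r))" by auto
      have eq: "s' ''r'' 0 = r" "s' ''prev'' 0 = card (below r)"
        using s'(2) by (simp_all add: same_def r_def)
      have "same ?M ?s1 s'" using s'(2) by (auto simp: same_def)
      then have "same ?M s0 s'" using sm by (simp add: same_def)
      moreover have "discovered (s'(''r'' := (s' ''r'')(0 := Suc r))) (below (Suc r))"
        using s'(3) by (simp add: discovered_def)
      ultimately show ?case using eq s'(1) e W W_gt D_le_n \<open>r < D + 2\<close> by simp
    qed
    note H = this
    show ?case
      by (rule wp_Write_Seq[OF _ _ _ wp_conseq[OF H]]) (use W_gt cnt r_def in auto)
  next
    case (4 t s)
    define r where "r = s ''r'' 0"
    have r: "1 \<le> r" "r \<le> D + 2" and d: "discovered s (below r)"
      and prev: "s ''prev'' 0 = card (below (r - 1))" using 4 by (auto simp: r_def)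
    have lt: "lv v < r" if "v < n" for v
    proof (rule ccontr)
      assume "\<not> lv v < r"
      then have "card (below (r - 1)) < card (below r)" using below_strict[of v "r - 1"] that r by simp
      then show False using 4(2) d prev by (simp add: discovered_def)
    qed
    then have b: "below r = {..<n}" by (auto simp: below_def)
    have "levels s" using d[unfolded b] r lt by (simp add: levels_def discovered_def r_def[symmetric])
    moreover have "t \<le> (D + 2) * (120 * m + 60) + 10"
    proof -
      have "(D + 2 - ?s1 ''r'' 0) * (120 * m + 60) \<le> (D + 2) * (120 * m + 60)"
        by (intro mult_le_mono1) simp
      then show ?thesis using 4(3) by simp
    qed
    ultimately show ?case using 4 by blast
  qed
  then have "wp W (While (Less (V ''prev'') (V ''cnt'')) ?c)
    (\<lambda>t s. t + 20 \<le> (D + 2) * (120 * m + 60) + 30 \<and> same ?M s0 s \<and> levels s) ?s1"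
    by (rule wp_conseq) auto
  then show ?thesis unfolding level_prog_def using assms(2) W_gt
    by (simp del: fun_upd_apply add: fun_upd_same fun_upd_other) (erule wp_conseq, auto)
qed

end

section \<open>Element lists and the membership table\<close>

definition elem_arc :: com where
  "elem_arc =
     For ''q'' (Read ''ec'' (V ''u''))
       (''x'' ::= Read ''el'' (Plus (Read ''b'' (V ''u'')) (V ''q'')) ;;
        ''j'' ::= Plus (Read ''b'' (V ''v'')) (V ''x'') ;;
        If (Equal (Read ''mem'' (V ''j'')) (Const 0))
          (Write ''mem'' (V ''j'') (Const 1) ;;
           Write ''el'' (Plus (Read ''b'' (V ''v'')) (Read ''ec'' (V ''v''))) (V ''x'') ;;
           Write ''ec'' (V ''v'') (Plus (Read ''ec'' (V ''v'')) (Const 1)))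
          Skip)"

definition elem_round :: com where
  "elem_round =
     For ''a'' (V ''m2'')
       (''u'' ::= Read ''src'' (V ''a'') ;;
        ''v'' ::= Read ''dst'' (V ''a'') ;;
        If (And (Equal (Read ''lev'' (V ''u'')) (V ''r''))
                (Equal (Read ''lev'' (V ''v'')) (Plus (V ''r'') (Const 1))))
          elem_arc Skip)"

text \<open>Elements are named by singleton vertices, so a vertex with level mark 2 is its own only
  element. A larger clique is the union of its lower neighbours, whose lists were completed one
  round earlier. \<open>R\<close> saves the number of rounds because \<open>r\<close> becomes the
  counter.\<close>

definition elem_prog :: com where
  "elem_prog =
     For ''i'' (V ''n'')
       (If (Equal (Read ''lev'' (V ''i'')) (Const 2))
         (Write ''mem'' (Plus (Read ''b'' (V ''i'')) (V ''i'')) (Const 1) ;;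
          Write ''el'' (Read ''b'' (V ''i'')) (V ''i'') ;;
          Write ''ec'' (V ''i'') (Const 1))
         Skip) ;;
     ''R'' ::= V ''r'' ;;
     For ''r'' (V ''R'') elem_round"

context wopp
begin

text \<open>\<open>S v\<close> is the part of \<open>el v\<close> collected so far;
  \<open>S = el\<close> means that the tables are complete. The list serves enumeration in time
  \<open>card (S v)\<close>, the 0-1 table \<open>mem\<close> serves lookup in constant
  time.\<close>

definition elrep :: "memory \<Rightarrow> (nat \<Rightarrow> nat set) \<Rightarrow> bool" where
  "elrep s S \<longleftrightarrow> (\<forall>v<n. S v \<subseteq> el v \<and> s ''ec'' v = card (S v) \<and>
     bij_betw (\<lambda>q. s ''el'' (v * n + q)) {..<card (S v)} (S v) \<and>
     (\<forall>x<n. s ''mem'' (v * n + x) = (if x \<in> S v then 1 else 0)))"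

lemma elrep_cong:
  "elrep s S \<Longrightarrow> s' ''ec'' = s ''ec'' \<Longrightarrow> s' ''el'' = s ''el'' \<Longrightarrow> s' ''mem'' = s ''mem'' \<Longrightarrow> elrep s' S"
  by (simp add: elrep_def)

lemma lv_le_n: "v < n \<Longrightarrow> lv v \<le> n"
  using card_le_D D_le_n le_trans by blast

text \<open>The list of \<open>v\<close> stays inside its row because
  \<open>card (S v) < lv v \<le> n\<close>, and then \<open>idx_eq\<close> shows that no other row
  changes.\<close>

lemma elrep_insert:
  assumes r: "elrep s S" and v: "v < n" "x \<in> el v" "x \<notin> S v"
    and upd: "s' ''mem'' = (s ''mem'')(v * n + x := 1)"
      "s' ''el'' = (s ''el'')(v * n + card (S v) := x)" "s' ''ec'' = (s ''ec'')(v := card (S v) + 1)"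
  shows "elrep s' (S(v := insert x (S v)))"
  unfolding elrep_def
proof (intro allI impI)
  have S: "S u \<subseteq> el u" "finite (S u)" "card (S u) \<le> n" if "u < n" for u
    using r that finite_el[OF that] card_mono[of "el u" "S u"] lv_le_n[OF that]
    by (auto simp: elrep_def dest: finite_subset)
  have x: "x < n" using el_subset v by blast
  have "card (S v) < lv v"
    using S[OF v(1)] finite_el[OF v(1)] v by (intro psubset_card_mono) auto
  then have c: "card (S v) < n" using lv_le_n[OF v(1)] by simp
  fix u assume u: "u < n"
  have b: "bij_betw (\<lambda>q. s ''el'' (u * n + q)) {..<card (S u)} (S u)"
    using r u by (simp add: elrep_def)
  have old: "s' ''el'' (u * n + q) = s ''el'' (u * n + q)" if "q < card (S u)" for q
    using that S(3)[OF u] c idx_eq[of q "card (S v)" u v] unfolding upd by auto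
  show "(S(v := insert x (S v))) u \<subseteq> el u \<and> s' ''ec'' u = card ((S(v := insert x (S v))) u) \<and>
     bij_betw (\<lambda>q. s' ''el'' (u * n + q)) {..<card ((S(v := insert x (S v))) u)} ((S(v := insert x (S v))) u) \<and>
     (\<forall>y<n. s' ''mem'' (u * n + y) = (if y \<in> (S(v := insert x (S v))) u then 1 else 0))"
  proof (cases "u = v")
    case True
    have "bij_betw (\<lambda>q. s' ''el'' (u * n + q)) {..<card (S u)} (S u)"
      using b by (rule bij_betw_cong[THEN iffD2, rotated]) (use old in auto)
    then have "bij_betw (\<lambda>q. s' ''el'' (u * n + q)) (insert (card (S u)) {..<card (S u)})
      (insert (s' ''el'' (u * n + card (S u))) (S u))"
      using notIn_Un_bij_betw[of "card (S u)" "{..<card (S u)}" "\<lambda>q. s' ''el'' (u * n + q)" "S u"]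
        v True by (simp add: upd)
    then have "bij_betw (\<lambda>q. s' ''el'' (u * n + q)) {..<Suc (card (S u))} (insert x (S u))"
      unfolding lessThan_Suc using True by (simp add: upd)
    moreover have "s' ''mem'' (u * n + y) = (if y \<in> insert x (S u) then 1 else 0)" if "y < n" for y
      using r u that True by (simp add: upd elrep_def)
    moreover have "card (insert x (S u)) = Suc (card (S u))" using S[OF u] v True by simp
    ultimately show ?thesis using True S[OF u] v upd by simp
  next
    case False
    have "bij_betw (\<lambda>q. s' ''el'' (u * n + q)) {..<card (S u)} (S u)"
      using b by (rule bij_betw_cong[THEN iffD2, rotated]) (use old in auto)
    moreover have "s' ''mem'' (u * n + y) = s ''mem'' (u * n + y)" if "y < n" for y
      using that x idx_eq[of y x u v] False by (simp add: upd)
    ultimately show ?thesis using False r u by (simp add: elrep_def upd)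
  qed
qed

lemma wp_elem_arc:
  assumes "bases s1" "elrep s1 S" "s1 ''u'' 0 = u" "s1 ''v'' 0 = v" "u < n" "v < n" "u \<noteq> v"
    "S u = el u" "el u \<subseteq> el v"
  shows "wp W elem_arc (\<lambda>t s. t \<le> D * 70 + 30 \<and>
    same {''q'', ''x'', ''j'', ''mem'', ''el'', ''ec''} s1 s \<and> elrep s (S(v := S v \<union> el u))) s1"
  unfolding elem_arc_def
proof (rule wp_For[where h = "lv u" and B = 50 and
    I = "\<lambda>k s. same {''q'', ''x'', ''j'', ''mem'', ''el'', ''ec''} s1 s \<and>
      elrep s (S(v := S v \<union> (\<lambda>q. s1 ''el'' (u * n + q)) ` {..<k})) \<and>
      (\<forall>q<n. s ''el'' (u * n + q) = s1 ''el'' (u * n + q))"], goal_cases)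
  case 1
  then show ?case using assms(2) by (simp add: elrep_def)
next
  case (2 k s)
  then show ?case using assms W_gt by (simp add: same_def elrep_def)
next
  case (5 k s)
  let ?S = "S(v := S v \<union> (\<lambda>q. s1 ''el'' (u * n + q)) ` {..<k})"
  let ?x = "s1 ''el'' (u * n + k)"
  have b: "bij_betw (\<lambda>q. s1 ''el'' (u * n + q)) {..<lv u} (el u)"
    using assms by (auto simp: elrep_def)
  then have "?x \<in> el u" using 5 by (auto dest: bij_betwE)
  then have x: "?x \<in> el v" "?x < n" using assms el_subset by auto
  have k: "k < lv u" "k < n" using 5 lv_le_n[OF assms(5)] by auto
  have same: "same {''q'', ''x'', ''j'', ''mem'', ''el'', ''ec''} s1 s" using 5 by simp
  have eq: "s ''u'' 0 = u" "s ''v'' 0 = v" "s ''b'' u = u * n" "s ''b'' v = v * n" "s ''q'' 0 = k"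
    "s ''el'' (u * n + k) = ?x"
    using same assms 5 k by (simp_all add: same_def bases_def)
  have rep: "elrep s ?S" using 5 by simp
  have img: "(\<lambda>q. s1 ''el'' (u * n + q)) ` {..<Suc k} = insert ?x ((\<lambda>q. s1 ''el'' (u * n + q)) ` {..<k})"
    by (simp add: lessThan_Suc)
  have mem: "s ''mem'' (v * n + ?x) = (if ?x \<in> ?S v then 1 else 0)"
    and ec: "s ''ec'' v = card (?S v)" and Sv: "?S v \<subseteq> el v"
    using rep assms x unfolding elrep_def by blast+
  note idx = idx_less[OF assms(5) k(2)] idx_less[OF assms(6) x(2)]
  show ?case
  proof (cases "?x \<in> ?S v")
    case True
    have "S(v := S v \<union> (\<lambda>q. s1 ''el'' (u * n + q)) ` {..<Suc k}) = ?S"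
      using True unfolding img by (auto simp: fun_eq_iff)
    then show ?thesis using True rep same idx W_gt 5 by (auto simp: eq mem elrep_def)
  next
    case False
    let ?s' = "s(''x'' := (s ''x'')(0 := ?x), ''j'' := (s ''j'')(0 := v * n + ?x),
      ''mem'' := (s ''mem'')(v * n + ?x := 1), ''el'' := (s ''el'')(v * n + card (?S v) := ?x),
      ''ec'' := (s ''ec'')(v := card (?S v) + 1), ''q'' := (s ''q'')(0 := Suc k))"
    have "elrep ?s' (?S(v := insert ?x (?S v)))"
      by (rule elrep_insert[OF rep assms(6) x(1) False]) simp_all
    moreover have "?S(v := insert ?x (?S v)) = S(v := S v \<union> (\<lambda>q. s1 ''el'' (u * n + q)) ` {..<Suc k})"
      unfolding img by auto
    ultimately have rep': "elrep ?s' (S(v := S v \<union> (\<lambda>q. s1 ''el'' (u * n + q)) ` {..<Suc k}))"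
      by simp
    have "card (?S v) < lv v"
      using Sv finite_el[OF assms(6)] x False by (intro psubset_card_mono) auto
    then have c: "card (?S v) < n" using lv_le_n[OF assms(6)] by simp
    \<comment> \<open>The row of \<open>u\<close> is read while the row of \<open>v\<close> grows;
      they do not overlap because \<open>u \<noteq> v\<close>.\<close>
    have "\<forall>q<n. ?s' ''el'' (u * n + q) = s1 ''el'' (u * n + q)"
      using 5 c idx_eq[of _ "card (?S v)" u v] assms(7) by auto
    then show ?thesis
      using False rep' same idx idx_less[OF assms(6) c] c W_gt ec mem by (simp add: eq)
  qed
next
  case (6 t s)
  have b: "bij_betw (\<lambda>q. s1 ''el'' (u * n + q)) {..<lv u} (el u)"
    using assms by (auto simp: elrep_def)
  \<comment> \<open>63 is the body bound 50 plus \<open>acost hi + 10\<close> from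
    \<open>wp_For\<close>, where \<open>acost hi\<close> is 3 for
    \<open>Read ''ec'' (V ''u'')\<close>.\<close>
  have "t \<le> lv u * 63 + 13" using 6 by simp
  also have "\<dots> \<le> D * 63 + 13" using card_le_D[OF assms(5)] by simp
  finally show ?case using 6 b by (auto simp: bij_betw_def)
qed (use W_gt lv_le_n[OF assms(5)] in auto)

lemma edge_up_subset: "{u, v} \<in> E \<Longrightarrow> lv v = lv u + 1 \<Longrightarrow> el u \<subseteq> el v"
  using edge_cl arc_up(4) by blast

lemma wp_elem_round:
  assumes "bases s1" "arcs s1" "\<And>v. v < n \<Longrightarrow> s1 ''lev'' v = lv v + 1" "s1 ''r'' 0 \<le> n + 2" "elrep s1 S"
    "\<And>v. v < n \<Longrightarrow> lv v < s1 ''r'' 0 \<or> lv v \<le> 1 \<Longrightarrow> S v = el v"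
  shows "wp W elem_round (\<lambda>t s. t \<le> m * (D * 140 + 180) + 30 \<and>
    same {''a'', ''u'', ''v'', ''q'', ''x'', ''j'', ''mem'', ''el'', ''ec''} s1 s \<and>
    (\<exists>S. elrep s S \<and> (\<forall>v<n. lv v \<le> s1 ''r'' 0 \<or> lv v \<le> 1 \<longrightarrow> S v = el v))) s1"
  unfolding elem_round_def
proof (rule wp_For[where h = "2 * m" and B = "D * 70 + 70" and
    I = "\<lambda>k s. same {''a'', ''u'', ''v'', ''q'', ''x'', ''j'', ''mem'', ''el'', ''ec''} s1 s \<and>
    (\<exists>S. elrep s S \<and> (\<forall>v<n. lv v < s1 ''r'' 0 \<or> lv v \<le> 1 \<longrightarrow> S v = el v) \<and>
      (\<forall>a<k. lv (s1 ''src'' a) + 1 = s1 ''r'' 0 \<longrightarrow> lv (s1 ''dst'' a) = s1 ''r'' 0 \<longrightarrow>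
        el (s1 ''src'' a) \<subseteq> S (s1 ''dst'' a)))"], goal_cases)
  case 1
  have "elrep (s1(''a'' := (s1 ''a'')(0 := 0))) S" using assms(5) by (simp add: elrep_def)
  then show ?case using assms(6) by auto
next
  case (2 k s)
  then show ?case using assms W_gt by (simp add: same_def arcs_def)
next
  case (5 k s)
  define r where "r = s1 ''r'' 0"
  let ?M = "{''a'', ''u'', ''v'', ''q'', ''x'', ''j'', ''mem'', ''el'', ''ec''}"
  let ?u = "s1 ''src'' k" and ?v = "s1 ''dst'' k"
  from 5 obtain S where k: "s ''a'' 0 = k" "k < 2 * m" and same: "same ?M s1 s" and rep: "elrep s S"
    and S: "\<And>v. v < n \<Longrightarrow> lv v < r \<or> lv v \<le> 1 \<Longrightarrow> S v = el v"
      "\<And>a. a < k \<Longrightarrow> lv (s1 ''src'' a) + 1 = r \<Longrightarrow> lv (s1 ''dst'' a) = r \<Longrightarrow>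
        el (s1 ''src'' a) \<subseteq> S (s1 ''dst'' a)"
    unfolding r_def by blast
  have E: "{?u, ?v} \<in> E" using arcs_E[OF assms(2) k(2)] .
  then have uv: "?u < n" "?v < n" "?u \<noteq> ?v" using edge_levels[OF E] by auto
  have eq: "s ''src'' = s1 ''src''" "s ''dst'' = s1 ''dst''" "s ''r'' 0 = r" "s ''b'' = s1 ''b''"
    "s ''lev'' ?u = lv ?u + 1" "s ''lev'' ?v = lv ?v + 1"
    using same assms(3) uv by (simp_all add: same_def r_def levels_def)
  let ?s1 = "s(''u'' := (s ''u'')(0 := ?u), ''v'' := (s ''v'')(0 := ?v))"
  show ?case
  proof (cases "lv ?u + 1 = r \<and> lv ?v = r")
    case True
    have sub: "el ?u \<subseteq> el ?v" using edge_up_subset[OF E] True by simp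
    let ?S = "S(?v := S ?v \<union> el ?u)"
    have "wp W elem_arc (\<lambda>t s. t \<le> D * 70 + 30 \<and>
        same {''q'', ''x'', ''j'', ''mem'', ''el'', ''ec''} ?s1 s \<and> elrep s ?S) ?s1"
    proof (rule wp_elem_arc)
      show "bases ?s1" using assms(1) eq by (simp add: bases_def)
      show "elrep ?s1 S" using rep by (rule elrep_cong) simp_all
      show "S ?u = el ?u" using S(1)[OF uv(1)] True by simp
    qed (use uv sub in auto)
    then have H: "wp W elem_arc (\<lambda>t s'. t + 30 \<le> D * 70 + 70 \<and> s' ''a'' 0 = k \<and>
      same ?M s1 (s'(''a'' := (s' ''a'')(0 := Suc k))) \<and>
      (\<exists>S. elrep (s'(''a'' := (s' ''a'')(0 := Suc k))) S \<and> (\<forall>v<n. lv v < r \<or> lv v \<le> 1 \<longrightarrow> S v = el v) \<and>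
        (\<forall>a<Suc k. lv (s1 ''src'' a) + 1 = r \<longrightarrow> lv (s1 ''dst'' a) = r \<longrightarrow>
        el (s1 ''src'' a) \<subseteq> S (s1 ''dst'' a)))) ?s1"
    proof (rule wp_conseq, goal_cases)
      case (1 t s')
      then have s': "t \<le> D * 70 + 30" "same {''q'', ''x'', ''j'', ''mem'', ''el'', ''ec''} ?s1 s'"
        "elrep s' ?S" by auto
      have "s' ''a'' 0 = k" using s'(2) k by (simp add: same_def)
      moreover have "same ?M ?s1 s'" using s'(2) by (auto simp: same_def)
      then have "same ?M s1 (s'(''a'' := (s' ''a'')(0 := Suc k)))"
        using same by (simp add: same_def)
      moreover have "elrep (s'(''a'' := (s' ''a'')(0 := Suc k))) ?S"
        using s'(3) by (rule elrep_cong) simp_all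
      moreover have "\<forall>v<n. lv v < r \<or> lv v \<le> 1 \<longrightarrow> ?S v = el v"
        using S(1) sub by auto
      moreover have "\<forall>a<Suc k. lv (s1 ''src'' a) + 1 = r \<longrightarrow> lv (s1 ''dst'' a) = r \<longrightarrow>
        el (s1 ''src'' a) \<subseteq> ?S (s1 ''dst'' a)"
      proof (intro allI impI)
        fix a assume a: "a < Suc k" "lv (s1 ''src'' a) + 1 = r" "lv (s1 ''dst'' a) = r"
        show "el (s1 ''src'' a) \<subseteq> ?S (s1 ''dst'' a)"
          using S(2)[of a] a by (cases "a = k") (auto simp: less_Suc_eq)
      qed
      ultimately show ?case using s'(1) by (intro conjI exI[of _ ?S]) auto
    qed
    show ?thesis unfolding r_def[symmetric]
      by (rule wp_Write_Seq[where s' = "s(''u'' := (s ''u'')(0 := ?u))"], simp_all add: k eq del: wp_Seq)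
        (use W W_gt H True assms(4) r_def in \<open>auto elim!: wp_conseq simp: k eq\<close>)
  next
    case False
    have "elrep (?s1(''a'' := (s ''a'')(0 := Suc k))) S" using rep by (rule elrep_cong) simp_all
    moreover have "\<forall>a<Suc k. lv (s1 ''src'' a) + 1 = r \<longrightarrow> lv (s1 ''dst'' a) = r \<longrightarrow>
        el (s1 ''src'' a) \<subseteq> S (s1 ''dst'' a)"
      using S(2) False by (auto simp: less_Suc_eq)
    moreover have "r + 1 < W" using assms(4) W r_def by simp
    ultimately show ?thesis unfolding r_def[symmetric]
      using S(1) False W_gt same by (auto simp: k eq)
  qed
next
  case (6 t s)
  define r where "r = s1 ''r'' 0"
  from 6 obtain S where rep: "elrep s S"
    and S: "\<And>v. v < n \<Longrightarrow> lv v < r \<or> lv v \<le> 1 \<Longrightarrow> S v = el v"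
      "\<And>a. a < 2 * m \<Longrightarrow> lv (s1 ''src'' a) + 1 = r \<Longrightarrow> lv (s1 ''dst'' a) = r \<Longrightarrow>
        el (s1 ''src'' a) \<subseteq> S (s1 ''dst'' a)"
    unfolding r_def by blast
  have "S v = el v" if v: "v < n" "lv v \<le> r \<or> lv v \<le> 1" for v
  proof (cases "lv v < r \<or> lv v \<le> 1")
    case True
    then show ?thesis using S(1) v by blast
  next
    case False
    then have r: "lv v = r" "2 \<le> lv v" using v by auto
    have "el v \<subseteq> S v"
    proof
      fix x assume x: "x \<in> el v"
      \<comment> \<open>Only a second element \<open>y\<close> makes \<open>x\<close> survive in a
        lower neighbour. Singletons have none, which is why they are seeded separately.\<close>
      have "el v \<noteq> {x}" using r by auto
      then obtain y where y: "y \<in> el v" "y \<noteq> x" using x by blast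
      let ?u = "ver (el v - {y})"
      have "{?u, v} \<in> E" "lv ?u + 1 = r" "x \<in> el ?u"
        using down_edge[OF v(1) y(1)] x y r finite_el[OF v(1)] by simp_all
      moreover from arcs_ex[OF assms(2) \<open>{?u, v} \<in> E\<close>]
      obtain a where "a < 2 * m" "s1 ''src'' a = ?u" "s1 ''dst'' a = v" by blast
      ultimately show "x \<in> S v" using S(2)[of a] r by auto
    qed
    then show ?thesis using rep v by (auto simp: elrep_def)
  qed
  moreover have "t \<le> m * (D * 140 + 180) + 30" using 6 by (simp add: algebra_simps)
  ultimately show ?case using 6 rep unfolding r_def[symmetric] by blast
qed (use W_gt m_le_nn in auto)

end

section \<open>Edge labels, up and down tables, and the vertices of the POFs\<close>

definition table_arc :: com where
  "table_arc =
     For ''q'' (Read ''ec'' (V ''v''))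
       (''x'' ::= Read ''el'' (Plus (Read ''b'' (V ''v'')) (V ''q'')) ;;
        ''j'' ::= Plus (Read ''b'' (V ''u'')) (V ''x'') ;;
        If (Equal (Read ''mem'' (V ''j'')) (Const 0))
          (Write ''cls'' (Read ''aid'' (V ''a'')) (V ''x'') ;;
           Write ''up'' (V ''j'') (V ''v'') ;;
           Write ''dn'' (Plus (Read ''b'' (V ''v'')) (V ''x'')) (V ''u''))
          Skip)"

definition table_prog :: com where
  "table_prog =
     For ''a'' (V ''m2'')
       (''u'' ::= Read ''src'' (V ''a'') ;;
        ''v'' ::= Read ''dst'' (V ''a'') ;;
        If (Equal (Plus (Read ''lev'' (V ''u'')) (Const 1)) (Read ''lev'' (V ''v'')))
          table_arc Skip)"

text \<open>Climbs from \<open>v0\<close> one label at a time to the vertex of the POF; prefixes of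
  the list are cliques too, so the entry of \<open>up\<close> always exists. From then on POFs are
  addressed by vertices, with \<open>vp\<close> as the way back to positions.\<close>

definition pof_prog :: com where
  "pof_prog =
     For ''i'' (V ''num_pofs'')
       (''u'' ::= V ''v0'' ;;
        For ''q'' (Minus (Read ''pof_start'' (Plus (V ''i'') (Const 1))) (Read ''pof_start'' (V ''i'')))
          (''u'' ::= Read ''up'' (Plus (Read ''b'' (V ''u''))
             (Read ''cls'' (Read ''pof_elem'' (Plus (Read ''pof_start'' (V ''i'')) (V ''q'')))))) ;;
        Write ''vp'' (V ''u'') (V ''i'') ;;
        Write ''wt'' (V ''u'') (Read ''weight'' (V ''i'')))"

context wopp
begin

lemma lv_1: "v < n \<Longrightarrow> lv v = 1 \<Longrightarrow> el v = {v}"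
proof -
  assume v: "v < n" "lv v = 1"
  then obtain x where x: "el v = {x}" by (auto simp: card_1_singleton_iff)
  then have "x < n" "el x = el v" using sing[OF v(1), of x] by simp_all
  then have "x = v" using v(1) el_inj by blast
  then show ?thesis using x by simp
qed

lemma wp_elem_prog:
  assumes "bases s0" "arcs s0" "levels s0" "s0 ''n'' 0 = n" "s0 ''el'' = (\<lambda>_. 0)"
    "s0 ''mem'' = (\<lambda>_. 0)" "s0 ''ec'' = (\<lambda>_. 0)"
  shows "wp W elem_prog (\<lambda>t s. t \<le> n * 60 + (D + 2) * (m * (D * 140 + 180) + 60) + 50 \<and>
    same {''i'', ''R'', ''r'', ''a'', ''u'', ''v'', ''q'', ''x'', ''j'', ''mem'', ''el'', ''ec''} s0 s \<and>
    elrep s el) s0"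
  unfolding elem_prog_def
proof (subst wp_Seq, rule wp_For[where h = n and B = 40 and
      I = "\<lambda>k s. same {''i'', ''mem'', ''el'', ''ec''} s0 s \<and>
        elrep s (\<lambda>v. if v < k \<and> lv v = 1 then el v else {})"], goal_cases)
  case 1
  then show ?case using assms(5-7) by (simp add: elrep_def bij_betw_def)
next
  case (2 k s)
  then show ?case using assms(4) W_gt by (simp add: same_def)
next
  case (5 k s)
  let ?S = "\<lambda>k v. if v < k \<and> lv v = 1 then el v else {}"
  have eq: "s ''i'' 0 = k" "k < n" "s ''lev'' k = lv k + 1" "s ''b'' k = k * n"
    using assms 5 by (simp_all add: same_def levels_def bases_def)
  have same: "same {''i'', ''mem'', ''el'', ''ec''} s0 s" and rep: "elrep s (?S k)"
    using 5 by simp_all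
  show ?case
  proof (cases "lv k = 1")
    case True
    let ?s' = "s(''mem'' := (s ''mem'')(k * n + k := 1), ''el'' := (s ''el'')(k * n := k),
      ''ec'' := (s ''ec'')(k := 1), ''i'' := (s ''i'')(0 := Suc k))"
    have k: "el k = {k}" using lv_1 eq True by simp
    have "elrep ?s' ((?S k)(k := insert k (?S k k)))"
      by (rule elrep_insert[OF rep eq(2)]) (simp_all add: k)
    moreover have "(?S k)(k := insert k (?S k k)) = ?S (Suc k)"
      using k True by (auto simp: fun_eq_iff less_Suc_eq)
    ultimately have "elrep ?s' (?S (Suc k))" by simp
    then show ?thesis using True same W W_gt idx_less[OF eq(2) eq(2)] by (simp add: eq)
  next
    case False
    have "?S (Suc k) = ?S k" using False by (auto simp: fun_eq_iff less_Suc_eq)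
    moreover have "elrep (s(''i'' := (s ''i'')(0 := Suc k))) (?S k)"
      using rep by (rule elrep_cong) simp_all
    ultimately show ?thesis using False same W W_gt by (simp add: eq)
  qed
next
  case (6 t1 s1)
  let ?M = "{''i'', ''R'', ''r'', ''a'', ''u'', ''v'', ''q'', ''x'', ''j'', ''mem'', ''el'', ''ec''}"
  define R where "R = s1 ''r'' 0"
  have s1: "same {''i'', ''mem'', ''el'', ''ec''} s0 s1" "t1 \<le> n * 60 + 20"
    "elrep s1 (\<lambda>v. if v < n \<and> lv v = 1 then el v else {})"
    using 6 by (simp_all add: mult.commute)
  have R: "R \<le> D + 2" "\<And>v. v < n \<Longrightarrow> lv v < R"
    using assms(3) s1(1) by (auto simp: R_def same_def levels_def)
  let ?s1 = "s1(''R'' := (s1 ''R'')(0 := R))"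
  have "wp W (For ''r'' (V ''R'') elem_round) (\<lambda>t s.
     t \<le> (D + 2) * (m * (D * 140 + 180) + 60) + 20 \<and> same ?M s0 s \<and> elrep s el) ?s1"
  proof (rule wp_For[where h = R and B = "m * (D * 140 + 180) + 40" and
      I = "\<lambda>r s. same ?M s0 s \<and> s ''R'' 0 = R \<and>
        (\<exists>S. elrep s S \<and> (\<forall>v<n. lv v < r \<or> lv v \<le> 1 \<longrightarrow> S v = el v))"], goal_cases)
    case 1
    have "el v = {}" if "v < n" "lv v \<le> 1" "lv v \<noteq> 1" for v
      using that finite_el[OF that(1)] by (simp add: le_Suc_eq)
    moreover have "elrep (?s1(''r'' := (s1 ''r'')(0 := 0))) (\<lambda>v. if v < n \<and> lv v = 1 then el v else {})"
      using s1(3) by (rule elrep_cong) simp_all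
    moreover have "same ?M s0 s1" using s1(1) by (auto simp: same_def)
    ultimately show ?case
      by (intro conjI exI[of _ "\<lambda>v. if v < n \<and> lv v = 1 then el v else {}"]) auto
  next
    case (2 k s)
    then show ?case using W_gt by simp
  next
    case (5 k s)
    then obtain S where S: "elrep s S" "\<And>v. v < n \<Longrightarrow> lv v < k \<or> lv v \<le> 1 \<Longrightarrow> S v = el v" by blast
    have sm: "same ?M s0 s" and k: "s ''r'' 0 = k" "k < R" "s ''R'' 0 = R" using 5 by simp_all
    have lev: "s ''lev'' = s0 ''lev''" "s ''ord'' = s0 ''ord''" using sm by (simp_all add: same_def)
    have pre: "bases s" "arcs s"
      using assms(1-3) sm by (simp_all add: bases_def arcs_def same_def)
    show ?case
    proof (rule wp_conseq[OF wp_elem_round[OF pre _ _ S(1)]], goal_cases)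
      case (1 v)
      then show ?case using assms(3) by (simp add: levels_def lev)
    next
      case 2
      then show ?case using k R D_le_n by simp
    next
      case (3 v)
      then show ?case using S(2) k by simp
    next
      case (4 t s')
      then obtain S' where S': "elrep s' S'" "\<And>v. v < n \<Longrightarrow> lv v \<le> k \<or> lv v \<le> 1 \<Longrightarrow> S' v = el v"
        and sm': "same {''a'', ''u'', ''v'', ''q'', ''x'', ''j'', ''mem'', ''el'', ''ec''} s s'"
        unfolding k by blast
      have "elrep (s'(''r'' := (s' ''r'')(0 := Suc k))) S'" using S'(1) by (rule elrep_cong) simp_all
      moreover have "same ?M s s'" using sm' by (auto simp: same_def)
      then have "same ?M s0 s'" using sm by (simp add: same_def)
      moreover have "s' ''r'' 0 = k" "s' ''R'' 0 = R" using sm' k by (simp_all add: same_def)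
      ultimately show ?case using S'(2) 4 by (auto simp: less_Suc_eq_le)
    qed
  next
    case (6 t s)
    then obtain S where S: "elrep s S" "\<And>v. v < n \<Longrightarrow> S v = el v" using R by blast
    then have "elrep s el" unfolding elrep_def by simp
    moreover have "t \<le> (D + 2) * (m * (D * 140 + 180) + 60) + 20"
    proof -
      have "t \<le> R * (m * (D * 140 + 180) + 60) + 20" using 6 by (simp add: algebra_simps)
      also have "\<dots> \<le> (D + 2) * (m * (D * 140 + 180) + 60) + 20"
        using R by (intro add_mono mult_le_mono1) auto
      finally show ?thesis .
    qed
    ultimately show ?case using 6 by simp
  qed (use R D_le_n W in auto)
  then show ?case
    by (intro wp_Write_Seq[where s' = ?s1]) (use W_gt s1(2) R_def in \<open>auto elim!: wp_conseq\<close>)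
qed (use W_gt in auto)

definition arc_done :: "memory \<Rightarrow> memory \<Rightarrow> nat \<Rightarrow> bool" where
  "arc_done s1 s a \<longleftrightarrow> (let u = s1 ''src'' a; v = s1 ''dst'' a; x = lab (s1 ''aid'' a) in
     lv v = lv u + 1 \<longrightarrow> s ''cls'' (s1 ''aid'' a) = x \<and>
     s ''up'' (u * n + x) = ver (insert x (el u)) \<and> s ''dn'' (v * n + x) = ver (el v - {x}))"

lemma arc_label:
  assumes "arcs s" "a < 2 * m" "lv (s ''dst'' a) = lv (s ''src'' a) + 1"
  shows "lab (s ''aid'' a) \<notin> el (s ''src'' a)"
    "el (s ''dst'' a) = insert (lab (s ''aid'' a)) (el (s ''src'' a))"
    "s ''src'' a < n" "s ''dst'' a < n" "lab (s ''aid'' a) < n" "s ''aid'' a < m"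
proof -
  have e: "s ''aid'' a < m" "edge_at es (s ''aid'' a) = {s ''src'' a, s ''dst'' a}"
    using assms(1,2) by (auto simp: arcs_def)
  then have "{s ''src'' a, s ''dst'' a} \<in> cl (lab (s ''aid'' a))" using edge_at_lab by metis
  from arc_up[OF this assms(3)] e lab_lt
  show "lab (s ''aid'' a) \<notin> el (s ''src'' a)"
    "el (s ''dst'' a) = insert (lab (s ''aid'' a)) (el (s ''src'' a))"
    "s ''src'' a < n" "s ''dst'' a < n" "lab (s ''aid'' a) < n" "s ''aid'' a < m" by auto
qed

text \<open>A later write cannot spoil a finished arc: equal cells mean the same edge, or the same
  vertex and label, and these determine the value stored.\<close>

lemma arc_done_upd:
  assumes "arcs s1" "a < 2 * m" "lv (s1 ''dst'' a) = lv (s1 ''src'' a) + 1"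
    and x: "x = lab (s1 ''aid'' a)"
    and upd: "s' ''cls'' = (s ''cls'')(s1 ''aid'' a := x)"
      "s' ''up'' = (s ''up'')(s1 ''src'' a * n + x := s1 ''dst'' a)"
      "s' ''dn'' = (s ''dn'')(s1 ''dst'' a * n + x := s1 ''src'' a)"
    and b: "b < 2 * m" "b = a \<or> arc_done s1 s b"
  shows "arc_done s1 s' b"
  unfolding arc_done_def Let_def
proof (intro impI)
  assume l: "lv (s1 ''dst'' b) = lv (s1 ''src'' b) + 1"
  note A = arc_label[OF assms(1-3), folded x]
  note B = arc_label[OF assms(1) b(1) l]
  have vals: "ver (insert x (el (s1 ''src'' a))) = s1 ''dst'' a"
    "ver (el (s1 ''dst'' a) - {x}) = s1 ''src'' a"
    using A ver_el by (metis, metis Diff_insert_absorb)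
  show "s' ''cls'' (s1 ''aid'' b) = lab (s1 ''aid'' b) \<and>
    s' ''up'' (s1 ''src'' b * n + lab (s1 ''aid'' b)) = ver (insert (lab (s1 ''aid'' b)) (el (s1 ''src'' b))) \<and>
    s' ''dn'' (s1 ''dst'' b * n + lab (s1 ''aid'' b)) = ver (el (s1 ''dst'' b) - {lab (s1 ''aid'' b)})"
  proof (cases "b = a")
    case True
    then show ?thesis using vals by (simp add: upd x)
  next
    case False
    then have old: "s ''cls'' (s1 ''aid'' b) = lab (s1 ''aid'' b)"
      "s ''up'' (s1 ''src'' b * n + lab (s1 ''aid'' b)) = ver (insert (lab (s1 ''aid'' b)) (el (s1 ''src'' b)))"
      "s ''dn'' (s1 ''dst'' b * n + lab (s1 ''aid'' b)) = ver (el (s1 ''dst'' b) - {lab (s1 ''aid'' b)})"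
      using b(2) l by (auto simp: arc_done_def Let_def)
    show ?thesis
    proof (intro conjI)
      show "s' ''cls'' (s1 ''aid'' b) = lab (s1 ''aid'' b)"
        using old(1) x by (simp add: upd)
      show "s' ''up'' (s1 ''src'' b * n + lab (s1 ''aid'' b)) = ver (insert (lab (s1 ''aid'' b)) (el (s1 ''src'' b)))"
        unfolding upd fun_upd_apply idx_eq[OF B(5) A(5)] using old(2) vals(1) by auto
      show "s' ''dn'' (s1 ''dst'' b * n + lab (s1 ''aid'' b)) = ver (el (s1 ''dst'' b) - {lab (s1 ''aid'' b)})"
        unfolding upd fun_upd_apply idx_eq[OF B(5) A(5)] using old(3) vals(2) by auto
    qed
  qed
qed

definition tables :: "memory \<Rightarrow> bool" where
  "tables s \<longleftrightarrow> (\<forall>e<m. s ''cls'' e = lab e) \<and>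
     (\<forall>v<n. \<forall>x\<in>el v. s ''up'' (ver (el v - {x}) * n + x) = v \<and> s ''dn'' (v * n + x) = ver (el v - {x}))"

text \<open>The label is found by search: it is the one element of the upper end that
  \<open>mem\<close> denies to the lower end. The scan passes it exactly once, and all other
  elements leave the tables alone.\<close>

lemma wp_table_arc:
  assumes "bases s1" "arcs s1" "elrep s1 el" "a < 2 * m" "s1 ''a'' 0 = a"
    "s1 ''u'' 0 = s1 ''src'' a" "s1 ''v'' 0 = s1 ''dst'' a"
    "lv (s1 ''dst'' a) = lv (s1 ''src'' a) + 1" "\<And>b. b < a \<Longrightarrow> arc_done s1 s1 b"
  shows "wp W table_arc (\<lambda>t s. t \<le> D * 70 + 30 \<and>
    same {''q'', ''x'', ''j'', ''cls'', ''up'', ''dn''} s1 s \<and> (\<forall>b\<le>a. arc_done s1 s b)) s1"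
proof -
  let ?u = "s1 ''src'' a" and ?v = "s1 ''dst'' a" and ?y = "lab (s1 ''aid'' a)"
  let ?M = "{''q'', ''x'', ''j'', ''cls'', ''up'', ''dn''}"
  note A = arc_label[OF assms(2,4,8)]
  have b: "bij_betw (\<lambda>q. s1 ''el'' (?v * n + q)) {..<lv ?v} (el ?v)"
    using assms(3) A(4) by (simp add: elrep_def)
  show ?thesis unfolding table_arc_def
  proof (rule wp_For[where h = "lv ?v" and B = 50 and
      I = "\<lambda>k s. same ?M s1 s \<and> (\<forall>b<a. arc_done s1 s b) \<and>
        (?y \<in> (\<lambda>q. s1 ''el'' (?v * n + q)) ` {..<k} \<longrightarrow> arc_done s1 s a)"], goal_cases)
    case 1
    then show ?case using assms(9) by (simp add: arc_done_def)
  next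
    case (2 k s)
    then show ?case using assms(3,7) A W_gt by (simp add: same_def elrep_def)
  next
    case (5 k s)
    let ?x = "s1 ''el'' (?v * n + k)"
    have k: "k < lv ?v" "k < n" "s ''q'' 0 = k" using 5 lv_le_n[OF A(4)] by auto
    have x: "?x \<in> el ?v" "?x < n" using k b bij_betwE[OF b] el_subset[OF A(4)] by auto
    have same: "same ?M s1 s" using 5 by simp
    have eq: "s ''u'' 0 = ?u" "s ''v'' 0 = ?v" "s ''b'' ?u = ?u * n" "s ''b'' ?v = ?v * n" "s ''a'' 0 = a"
      "s ''el'' (?v * n + k) = ?x" "s ''mem'' (?u * n + ?x) = (if ?x \<in> el ?u then 1 else 0)"
      "s ''aid'' = s1 ''aid''"
      using same assms(1,3,5-7) A x by (simp_all add: same_def bases_def elrep_def)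
    note idx = idx_less[OF A(3) x(2)] idx_less[OF A(4) k(2)] idx_less[OF A(4) x(2)]
    show ?case
    proof (cases "?x \<in> el ?u")
      case True
      then have "?x \<noteq> ?y" using A by auto
      then have "?y \<in> (\<lambda>q. s1 ''el'' (?v * n + q)) ` {..<Suc k} \<longrightarrow> arc_done s1 s a"
        using 5 by (auto simp: lessThan_Suc)
      then show ?thesis using True 5 same idx W_gt by (auto simp: eq k arc_done_def)
    next
      case False
      then have xy: "?x = ?y" using x A by auto
      let ?s' = "s(''x'' := (s ''x'')(0 := ?x), ''j'' := (s ''j'')(0 := ?u * n + ?x),
        ''cls'' := (s ''cls'')(s1 ''aid'' a := ?x), ''up'' := (s ''up'')(?u * n + ?x := ?v),
        ''dn'' := (s ''dn'')(?v * n + ?x := ?u), ''q'' := (s ''q'')(0 := Suc k))"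
      have "arc_done s1 ?s' b" if "b \<le> a" for b
        by (rule arc_done_upd[OF assms(2,4,8) xy]) (use that 5 assms(4) in \<open>auto simp: le_less\<close>)
      then show ?thesis using False same idx W_gt by (simp add: eq k)
    qed
  next
    case (6 t s)
    have "?y \<in> (\<lambda>q. s1 ''el'' (?v * n + q)) ` {..<lv ?v}" using b A by (auto simp: bij_betw_def)
    then have "\<forall>b\<le>a. arc_done s1 s b" using 6 by (auto simp: le_less)
    moreover have "t \<le> lv ?v * 63 + 13" using 6 by simp
    moreover have "lv ?v * 63 + 13 \<le> D * 70 + 30" using card_le_D[OF A(4)] by simp
    ultimately show ?case using 6 by simp
  qed (use W_gt lv_le_n[OF A(4)] in auto)
qed

lemma wp_table_prog:
  assumes "bases s0" "arcs s0" "\<And>v. v < n \<Longrightarrow> s0 ''lev'' v = lv v + 1" "elrep s0 el"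
  shows "wp W table_prog (\<lambda>t s. t \<le> m * (D * 140 + 180) + 30 \<and>
    same {''a'', ''u'', ''v'', ''q'', ''x'', ''j'', ''cls'', ''up'', ''dn''} s0 s \<and> tables s) s0"
  unfolding table_prog_def
proof (rule wp_For[where h = "2 * m" and B = "D * 70 + 70" and
    I = "\<lambda>k s. same {''a'', ''u'', ''v'', ''q'', ''x'', ''j'', ''cls'', ''up'', ''dn''} s0 s \<and>
      (\<forall>b<k. arc_done s0 s b)"], goal_cases)
  case 1
  then show ?case by simp
next
  case (2 k s)
  then show ?case using assms(2) W_gt by (simp add: same_def arcs_def)
next
  case (5 k s)
  let ?M = "{''a'', ''u'', ''v'', ''q'', ''x'', ''j'', ''cls'', ''up'', ''dn''}"
  let ?u = "s0 ''src'' k" and ?v = "s0 ''dst'' k"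
  have k: "s ''a'' 0 = k" "k < 2 * m" and same: "same ?M s0 s"
    and dn: "\<And>b. b < k \<Longrightarrow> arc_done s0 s b" using 5 by simp_all
  have uv: "?u < n" "?v < n" "?u \<noteq> ?v"
    using edge_levels[OF arcs_E[OF assms(2) k(2)]] by auto
  have eq: "s ''src'' = s0 ''src''" "s ''dst'' = s0 ''dst''" "s ''aid'' = s0 ''aid''"
    "s ''lev'' ?u = lv ?u + 1" "s ''lev'' ?v = lv ?v + 1"
    "s ''b'' = s0 ''b''" "s ''m2'' = s0 ''m2''" "s ''el'' = s0 ''el''" "s ''ec'' = s0 ''ec''" "s ''mem'' = s0 ''mem''"
    using same assms(3) uv by (simp_all add: same_def levels_def)
  let ?s1 = "s(''u'' := (s ''u'')(0 := ?u), ''v'' := (s ''v'')(0 := ?v))"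
  have lW: "lv ?u + 2 < W" using lv_le_n[OF uv(1)] W by simp
  show ?case
  proof (cases "lv ?v = lv ?u + 1")
    case True
    have dn_eq: "arc_done ?s1 s' b \<longleftrightarrow> arc_done s0 s' b" for s' b by (simp add: arc_done_def eq)
    have "wp W table_arc (\<lambda>t s'. t \<le> D * 70 + 30 \<and>
      same {''q'', ''x'', ''j'', ''cls'', ''up'', ''dn''} ?s1 s' \<and> (\<forall>b\<le>k. arc_done ?s1 s' b)) ?s1"
    proof (rule wp_table_arc)
      show "bases ?s1" "arcs ?s1" using assms(1,2) by (simp_all add: bases_def arcs_def eq)
      show "elrep ?s1 el" using assms(4) by (rule elrep_cong) (simp_all add: eq)
      show "arc_done ?s1 ?s1 b" if "b < k" for b using dn[OF that] by (simp add: arc_done_def eq)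
    qed (use k True eq in auto)
    then have H: "wp W table_arc (\<lambda>t s'. t + 30 \<le> D * 70 + 70 \<and> s' ''a'' 0 = k \<and>
      same ?M s0 (s'(''a'' := (s' ''a'')(0 := Suc k))) \<and>
      (\<forall>b<Suc k. arc_done s0 (s'(''a'' := (s' ''a'')(0 := Suc k))) b)) ?s1"
    proof (rule wp_conseq, goal_cases)
      case (1 t s')
      then have s': "t \<le> D * 70 + 30" "same {''q'', ''x'', ''j'', ''cls'', ''up'', ''dn''} ?s1 s'"
        "\<And>b. b \<le> k \<Longrightarrow> arc_done s0 s' b" by (auto simp: dn_eq)
      have "s' ''a'' 0 = k" using s'(2) k by (simp add: same_def)
      moreover have "same ?M ?s1 s'" using s'(2) by (auto simp: same_def)
      then have "same ?M s0 (s'(''a'' := (s' ''a'')(0 := Suc k)))"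
        using same by (simp add: same_def)
      ultimately show ?case using s'(1,3) by (auto simp: arc_done_def less_Suc_eq_le)
    qed
    show ?thesis
      by (rule wp_Write_Seq[where s' = "s(''u'' := (s ''u'')(0 := ?u))"], simp_all add: k eq del: wp_Seq)
        (use lW W_gt H True in \<open>auto elim!: wp_conseq simp: k eq\<close>)
  next
    case False
    then have "arc_done s0 s k" by (simp add: arc_done_def)
    then have "\<And>b. b < Suc k \<Longrightarrow> arc_done s0 s b" using dn by (auto simp: less_Suc_eq)
    then show ?thesis using False lW W_gt same by (auto simp: k eq arc_done_def)
  qed
next
  case (6 t s)
  have dn: "\<And>b. b < 2 * m \<Longrightarrow> arc_done s0 s b" using 6 by simp
  have "tables s"
    unfolding tables_def
  proof (intro conjI allI impI ballI)
    fix e assume e: "e < m"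
    then have c: "edge_at es e \<in> cl (lab e)" using edge_at_lab by blast
    then obtain u v where uv: "edge_at es e = {u, v}" "{u, v} \<in> E"
      using edge_pair edge_at_E[OF e] by metis
    \<comment> \<open>Every edge goes up in one of its two orientations, and \<open>arcs\<close>
      supplies that arc.\<close>
    have "\<exists>u v. edge_at es e = {u, v} \<and> lv v = lv u + 1"
      using uv edge_levels[OF uv(2)] insert_commute by metis
    then obtain u v where "edge_at es e = {u, v}" "lv v = lv u + 1" by blast
    then obtain a where "a < 2 * m" "s0 ''aid'' a = e" "s0 ''src'' a = u" "s0 ''dst'' a = v"
      using assms(2) e unfolding arcs_def by blast
    then show "s ''cls'' e = lab e" using dn \<open>lv v = lv u + 1\<close> by (auto simp: arc_done_def Let_def)
  next
    fix v x assume vx: "v < n" "x \<in> el v"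
    let ?u = "ver (el v - {x})"
    note de = down_edge[OF vx]
    have l: "lv v = lv ?u + 1"
      using de(3) card_Suc_Diff1[OF finite_el[OF vx(1)] vx(2)] by simp
    obtain a where a: "a < 2 * m" "s0 ''src'' a = ?u" "s0 ''dst'' a = v"
      using arcs_ex[OF assms(2) de(1)] by blast
    have "el v = insert (lab (s0 ''aid'' a)) (el v - {x})" "lab (s0 ''aid'' a) \<notin> el v - {x}"
      using arc_label[OF assms(2) a(1)] a l de(3) by auto
    then have "lab (s0 ''aid'' a) = x" using vx by blast
    then have "s ''up'' (?u * n + x) = ver (insert x (el ?u))" "s ''dn'' (v * n + x) = ?u"
      using dn[OF a(1)] a l by (auto simp: arc_done_def Let_def)
    then show "s ''up'' (?u * n + x) = v" "s ''dn'' (v * n + x) = ?u"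
      using de(3) vx by (simp_all add: insert_absorb)
  qed
  then show ?case using 6 by (simp add: algebra_simps)
qed (use W_gt m_le_nn in auto)

lemma pof_start_le: "i \<le> n \<Longrightarrow> length (concat (take i ps)) \<le> i * D"
proof (induction i)
  case (Suc i)
  have "take (Suc i) ps = take i ps @ [ps ! i]"
    using Suc.prems length_ps by (simp add: take_Suc_conv_app_nth)
  then show ?case
    using Suc length_ps_nth[of i] card_le_D[OF pv_lt[of i]] by simp
qed simp

lemma wp_pof_prog:
  assumes "bases s0" "tables s0" "s0 ''v0'' 0 = v0" "s0 ''num_pofs'' 0 = n"
    "\<And>i. i \<le> n \<Longrightarrow> s0 ''pof_start'' i = length (concat (take i ps))"
    "\<And>i. i < n * D \<Longrightarrow> s0 ''pof_elem'' i = (if i < length (concat ps) then concat ps ! i else 0)"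
    "\<And>i. i < n \<Longrightarrow> s0 ''weight'' i = w (pv i)"
  shows "wp W pof_prog (\<lambda>t s. t \<le> n * (D * 60 + 100) + 30 \<and>
    same {''i'', ''u'', ''q'', ''vp'', ''wt''} s0 s \<and>
    (\<forall>i<n. s ''vp'' (pv i) = i \<and> s ''wt'' (pv i) = w (pv i))) s0"
proof -
  let ?M = "{''i'', ''u'', ''q'', ''vp'', ''wt''}"
  have start: "length (concat (take (Suc i) ps)) = length (concat (take i ps)) + lv (pv i)" if "i < n" for i
    using that length_ps length_ps_nth[of i] by (simp add: take_Suc_conv_app_nth)
  have elem: "concat ps ! (length (concat (take i ps)) + q) = ps ! i ! q"
      "length (concat (take i ps)) + q < length (concat ps)"
    if "i < n" "q < lv (pv i)" for i q
  proof -
    have "concat ps = concat (take i ps) @ ps ! i @ concat (drop (Suc i) ps)"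
      using that(1) length_ps by (metis concat.simps(2) concat_append id_take_nth_drop)
    then show "concat ps ! (length (concat (take i ps)) + q) = ps ! i ! q"
      "length (concat (take i ps)) + q < length (concat ps)"
      using that length_ps_nth[of i] by (simp_all add: nth_append)
  qed
  have nD: "n * D \<le> n * n" using D_le_n by simp
  show ?thesis
    unfolding pof_prog_def
  proof (rule wp_For[where h = n and B = "D * 60 + 80" and
      I = "\<lambda>k s. same ?M s0 s \<and> (\<forall>i<k. s ''vp'' (pv i) = i \<and> s ''wt'' (pv i) = w (pv i))"], goal_cases)
    case 1
    then show ?case by simp
  next
    case (2 k s)
    then show ?case using assms(4) W_gt by (simp add: same_def)
  next
    case (5 k s)
    let ?p = "ps ! k" and ?st = "length (concat (take k ps))"
    have k: "k < n" "s ''i'' 0 = k" and same: "same ?M s0 s" using 5 by simp_all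
    have lk: "length ?p = lv (pv k)" "lv (pv k) \<le> D" using length_ps_nth card_le_D pv_lt k by simp_all
    have st: "?st + lv (pv k) \<le> n * D"
    proof -
      have "?st + lv (pv k) \<le> Suc k * D" using pof_start_le[of k] k lk by simp
      also have "\<dots> \<le> n * D" using k by (intro mult_le_mono1) simp
      finally show ?thesis .
    qed
    let ?s1 = "s(''u'' := (s ''u'')(0 := v0))"
    have H: "wp W (For ''q'' (Minus (Read ''pof_start'' (Plus (V ''i'') (Const 1))) (Read ''pof_start'' (V ''i'')))
          (''u'' ::= Read ''up'' (Plus (Read ''b'' (V ''u''))
             (Read ''cls'' (Read ''pof_elem'' (Plus (Read ''pof_start'' (V ''i'')) (V ''q'')))))))
        (\<lambda>t s'. t \<le> D * 60 + 30 \<and> same {''u'', ''q''} s s' \<and> s' ''u'' 0 = pv k) ?s1"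
    proof (rule wp_For[where h = "lv (pv k)" and B = 30 and
        I = "\<lambda>q s'. same {''u'', ''q''} s s' \<and> s' ''u'' 0 < n \<and>
          el (s' ''u'' 0) = lab ` set (take q ?p)"], goal_cases)
      case 1
      then show ?case using v0 by simp
    next
      case (2 q s')
      then have "same ?M s0 s'" "s' ''i'' 0 = k" using same k by (auto simp: same_def)
      then show ?case using assms(5)[of k] assms(5)[of "Suc k"] k start[OF k(1)] W W_gt
        by (simp add: same_def)
    next
      case (5 q s')
      have sm: "same ?M s0 s'" "s' ''i'' 0 = k" and q: "s' ''q'' 0 = q" "q < lv (pv k)"
        using 5 same k by (auto simp: same_def)
      let ?x = "lab (?p ! q)" and ?v = "s' ''u'' 0"
      have v: "?v < n" "el ?v = lab ` set (take q ?p)" using 5 by simp_all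
      have pq: "?p ! q < m" using ps_set[OF k(1)] nth_mem[of q ?p] q(2) lk by (metis lessThan_iff subsetD)
      have st_q: "?st + q < n * D" using st q by simp
      have eq: "s' ''b'' ?v = ?v * n" "s' ''pof_start'' k = ?st" "s' ''pof_elem'' (?st + q) = ?p ! q"
        "s' ''cls'' (?p ! q) = ?x"
        using sm(1) assms(1,2) assms(5)[of k] assms(6)[OF st_q] elem[OF k(1) q(2)] v(1) k(1) pq
        by (simp_all add: same_def bases_def tables_def)
      have tk: "set (take (Suc q) ?p) = insert (?p ! q) (set (take q ?p))"
        using q lk by (simp add: take_Suc_conv_app_nth)
      let ?C = "lab ` set (take (Suc q) ?p)"
      have C: "?C \<in> K"
        by (rule K_down[OF lab_ps_K[OF k(1)]]) (auto dest: in_set_takeD)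
      \<comment> \<open>The names in the list stand for different classes, so this step really adds
        an element.\<close>
      have "?x \<notin> lab ` set (take q ?p)"
      proof -
        have "distinct (take (Suc q) (map lab ?p))" using distinct_lab_ps[OF k(1)] by simp
        then show ?thesis using q lk by (simp add: take_Suc_conv_app_nth take_map)
      qed
      then have rem: "el (ver ?C) - {?x} = el ?v" "?x \<in> el (ver ?C)" using C tk v by auto
      have "ver (el ?v) = ?v" using v(1) by simp
      \<comment> \<open>\<open>tables\<close> describes \<open>up\<close> from the upper end, which
        here is \<open>ver ?C\<close>.\<close>
      then have up: "s' ''up'' (?v * n + ?x) = ver ?C"
        using assms(2) ver_in[OF C] rem sm(1) unfolding tables_def same_def by force
      have stW: "?st + q < W" using st_q nD W_gt(2) by linarith
      have "?v * n + ?x < n * n" using idx_less v(1) lab_lt[OF pq] by blast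
      then show ?case
        using 5 W_gt stW sm q C ver_in[OF C] by (simp add: eq up)
    next
      case (6 t s')
      have "el (s' ''u'' 0) = el (pv k)" using 6 lk el_pv[OF k(1)] by simp
      then have "s' ''u'' 0 = pv k" using 6 el_inj pv_lt[OF k(1)] by blast
      moreover have "t \<le> lv (pv k) * 50 + 20" using 6 by (simp add: mult.commute)
      moreover have "lv (pv k) * 50 + 20 \<le> D * 60 + 30" using lk by simp
      ultimately show ?case using 6 by simp
    qed (use W_gt lk D_le_n in auto)
    have "wp W (For ''q'' (Minus (Read ''pof_start'' (Plus (V ''i'') (Const 1))) (Read ''pof_start'' (V ''i'')))
          (''u'' ::= Read ''up'' (Plus (Read ''b'' (V ''u''))
             (Read ''cls'' (Read ''pof_elem'' (Plus (Read ''pof_start'' (V ''i'')) (V ''q'')))))) ;;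
        Write ''vp'' (V ''u'') (V ''i'') ;; Write ''wt'' (V ''u'') (Read ''weight'' (V ''i'')))
      (\<lambda>t s'. t + 10 \<le> D * 60 + 80 \<and> s' ''i'' 0 = k \<and> same ?M s0 (s'(''i'' := (s' ''i'')(0 := Suc k))) \<and>
        (\<forall>i<Suc k. s' ''vp'' (pv i) = i \<and> s' ''wt'' (pv i) = w (pv i))) ?s1"
      unfolding wp_Seq
    proof (rule wp_conseq[OF H], goal_cases)
      case (1 t s')
      have sm: "same ?M s0 s'" "s' ''i'' 0 = k" "s' ''vp'' = s ''vp''" "s' ''wt'' = s ''wt''"
        "s' ''weight'' k = w (pv k)"
        using 1 same k assms(7) by (auto simp: same_def)
      have "pv i \<noteq> pv k" if "i < k" for i
        using pv_bij that k unfolding bij_betw_def inj_on_def by auto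
      then show ?case using 1 5 sm W_gt by (auto simp: less_Suc_eq)
    qed
    moreover have "s ''v0'' 0 = v0" using same assms(3) by (simp add: same_def)
    ultimately show ?case
      by (intro wp_Write_Seq[where s' = ?s1]) (use W_gt in \<open>auto elim!: wp_conseq\<close>)
  next
    case (6 t s)
    then show ?case by (simp add: algebra_simps)
  qed (use W_gt in auto)
qed

end

section \<open>The queue of subproblems\<close>

definition best_loop :: com where
  "best_loop =
     For ''j'' (V ''len'')
       (''p'' ::= Plus (V ''h'') (V ''j'') ;;
        If (Less (Read ''qw'' (V ''bj'')) (Read ''qw'' (V ''p''))) (''bj'' ::= V ''p'') Skip)"

text \<open>The answer is tentative: subproblems are processed later and overwrite it for the cliques that
  meet the branching clique.\<close>

definition answer_loop :: com where
  "answer_loop =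
     For ''j'' (V ''len'')
       (Write ''opp'' (Read ''vp'' (Read ''qo'' (Plus (V ''h'') (V ''j'')))) (V ''y''))"

text \<open>\<open>tk\<close> marks entries claimed by an earlier element of the branching clique,
  so an entry joins at most one child. Stamping with the problem number \<open>np\<close> outdates
  all older stamps without any clearing; \<open>sl\<close> leads from a clique of the child to its
  slot.\<close>

definition group_loop :: com where
  "group_loop =
     For ''j'' (V ''len'')
       (''p'' ::= Plus (V ''h'') (V ''j'') ;;
        ''c'' ::= Read ''qc'' (V ''p'') ;;
        ''g'' ::= Plus (Read ''b'' (V ''c'')) (V ''x'') ;;
        If (And (Equal (Read ''mem'' (V ''g'')) (Const 1)) (Equal (Read ''tk'' (V ''p'')) (Const 0)))
          (Write ''tk'' (V ''p'') (Const 1) ;;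
           ''d'' ::= Read ''dn'' (V ''g'') ;;
           Write ''qo'' (V ''tl'') (Read ''qo'' (V ''p'')) ;;
           Write ''qc'' (V ''tl'') (V ''d'') ;;
           Write ''st'' (V ''d'') (V ''np'') ;;
           Write ''sl'' (V ''d'') (V ''tl'') ;;
           ''tl'' ::= Plus (V ''tl'') (Const 1))
          Skip)"

text \<open>Sets \<open>pr\<close> of the clique \<open>c\<close> to its intersection with the set of the child: a clique that is not
  stamped loses an unstamped element and inherits the value of the smaller clique, which stands
  earlier in the queue.\<close>

definition project_one :: com where
  "project_one =
     If (Equal (Read ''st'' (V ''c'')) (V ''np''))
       (Write ''pr'' (V ''c'') (V ''c''))
       (For ''q'' (Read ''ec'' (V ''c''))
         (''d'' ::= Read ''el'' (Plus (Read ''b'' (V ''c'')) (V ''q'')) ;;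
          If (Equal (Read ''st'' (V ''d'')) (V ''np''))
            Skip
            (Write ''pr'' (V ''c'') (Read ''pr'' (Read ''dn'' (Plus (Read ''b'' (V ''c'')) (V ''d'')))))))"

text \<open>Entries that avoid \<open>x\<close> compete in the child through their traces. New slots
  hold weight 0 and genuine weights are positive, so the strict comparison also admits the first
  competitor of a slot.\<close>

definition project_loop :: com where
  "project_loop =
     For ''j'' (V ''len'')
       (''p'' ::= Plus (V ''h'') (V ''j'') ;;
        ''c'' ::= Read ''qc'' (V ''p'') ;;
        project_one ;;
        If (Equal (Read ''mem'' (Plus (Read ''b'' (V ''c'')) (V ''x''))) (Const 0))
          (''d'' ::= Read ''sl'' (Read ''pr'' (V ''c'')) ;;
           If (Less (Read ''qw'' (V ''d'')) (Read ''qw'' (V ''p'')))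
             (Write ''qw'' (V ''d'') (Read ''qw'' (V ''p'')) ;;
              Write ''qr'' (V ''d'') (Read ''qr'' (V ''p'')))
             Skip)
          Skip)"

definition child_loop :: com where
  "child_loop =
     For ''t'' (Read ''ec'' (V ''z''))
       (''x'' ::= Read ''el'' (Plus (Read ''b'' (V ''z'')) (V ''t'')) ;;
        group_loop ;;
        project_loop ;;
        ''np'' ::= Plus (V ''np'') (Const 1) ;;
        Write ''qs'' (V ''np'') (V ''tl''))"

definition problem_step :: com where
  "problem_step =
     ''h'' ::= Read ''qs'' (V ''k'') ;;
     ''len'' ::= Minus (Read ''qs'' (Plus (V ''k'') (Const 1))) (V ''h'') ;;
     ''bj'' ::= V ''h'' ;;
     best_loop ;;
     ''z'' ::= Read ''qc'' (V ''bj'') ;;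
     ''y'' ::= Read ''vp'' (Read ''qr'' (V ''bj'')) ;;
     answer_loop ;;
     child_loop ;;
     ''k'' ::= Plus (V ''k'') (Const 1)"

text \<open>That \<open>k\<close> and \<open>qs\<close> start with 0 is due to the zeroed memory.
  The order \<open>ord\<close> puts subcliques first, as every segment must.\<close>

definition solve_prog :: com where
  "solve_prog =
     For ''i'' (V ''n'')
       (''v'' ::= Read ''ord'' (V ''i'') ;;
        Write ''qo'' (V ''i'') (V ''v'') ;;
        Write ''qc'' (V ''i'') (V ''v'') ;;
        Write ''qr'' (V ''i'') (V ''v'') ;;
        Write ''qw'' (V ''i'') (Read ''wt'' (V ''v''))) ;;
     Write ''qs'' (Const 1) (V ''n'') ;;
     ''np'' ::= Const 1 ;;
     ''tl'' ::= V ''n'' ;;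
     While (Less (V ''k'') (V ''np'')) problem_step"

section \<open>Subproblems as queue segments\<close>

context wopp
begin

text \<open>The tables that the queue phase reads and never writes.\<close>

definition static :: "memory \<Rightarrow> bool" where
  "static s \<longleftrightarrow> bases s \<and> elrep s el \<and>
     (\<forall>v<n. \<forall>x\<in>el v. s ''dn'' (v * n + x) = ver (el v - {x})) \<and> (\<forall>i<n. s ''vp'' (pv i) = i)"

lemma static_cong:
  "static s \<Longrightarrow> s' ''b'' = s ''b'' \<Longrightarrow> s' ''ec'' = s ''ec'' \<Longrightarrow> s' ''el'' = s ''el'' \<Longrightarrow>
    s' ''mem'' = s ''mem'' \<Longrightarrow> s' ''dn'' = s ''dn'' \<Longrightarrow> s' ''vp'' = s ''vp'' \<Longrightarrow> static s'"
  by (simp add: static_def bases_def elrep_def)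

lemma staticD:
  assumes "static s" "v < n"
  shows "s ''b'' v = v * n" "s ''ec'' v = lv v"
    "bij_betw (\<lambda>q. s ''el'' (v * n + q)) {..<lv v} (el v)"
    "x < n \<Longrightarrow> s ''mem'' (v * n + x) = (if x \<in> el v then 1 else 0)"
    "x \<in> el v \<Longrightarrow> s ''dn'' (v * n + x) = ver (el v - {x})"
  using assms by (simp_all add: static_def bases_def elrep_def)

text \<open>A queue segment \<open>{a..<b}\<close> represents the subproblem in which the elements of \<open>R\<close> have been
  removed and only the elements of \<open>U\<close> matter: \<open>qc\<close> enumerates the cliques inside \<open>U\<close>, \<open>qo\<close> is the
  clique \<open>qc \<union> R\<close> whose answer is wanted, and \<open>qr\<close> is a heaviest clique that avoids \<open>R\<close> and meets
  \<open>U\<close> exactly in \<open>qc\<close>.\<close>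

definition problem :: "memory \<Rightarrow> nat set \<Rightarrow> nat set \<Rightarrow> nat \<Rightarrow> nat \<Rightarrow> bool" where
  "problem s U R a b \<longleftrightarrow>
     bij_betw (s ''qc'') {a..<b} {v. v < n \<and> el v \<subseteq> U} \<and> R \<inter> U = {} \<and>
     (\<forall>i\<in>{a..<b}. \<forall>j\<in>{a..<b}. el (s ''qc'' i) \<subset> el (s ''qc'' j) \<longrightarrow> i < j) \<and>
     (\<forall>i\<in>{a..<b}. s ''qo'' i < n \<and> el (s ''qo'' i) = el (s ''qc'' i) \<union> R \<and>
        s ''qr'' i < n \<and> el (s ''qr'' i) \<inter> R = {} \<and> el (s ''qr'' i) \<inter> U = el (s ''qc'' i) \<and>
        s ''qw'' i = w (s ''qr'' i) \<and>
        (\<forall>y<n. el y \<inter> R = {} \<longrightarrow> el y \<inter> U = el (s ''qc'' i) \<longrightarrow> w y \<le> s ''qw'' i))"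

lemma problem_cong:
  assumes "problem s U R a b"
    and "\<And>i. a \<le> i \<Longrightarrow> i < b \<Longrightarrow> s' ''qc'' i = s ''qc'' i \<and> s' ''qo'' i = s ''qo'' i \<and>
      s' ''qr'' i = s ''qr'' i \<and> s' ''qw'' i = s ''qw'' i"
  shows "problem s' U R a b"
proof -
  have "bij_betw (s' ''qc'') {a..<b} {v. v < n \<and> el v \<subseteq> U} =
      bij_betw (s ''qc'') {a..<b} {v. v < n \<and> el v \<subseteq> U}"
    by (rule bij_betw_cong) (use assms(2) in auto)
  moreover have "s' ''qc'' i = s ''qc'' i" "s' ''qo'' i = s ''qo'' i" "s' ''qr'' i = s ''qr'' i"
    "s' ''qw'' i = s ''qw'' i" if "i \<in> {a..<b}" for i
    using assms(2)[of i] that by auto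
  ultimately show ?thesis using assms(1) unfolding problem_def by (auto simp: Ball_def simp del: atLeastLessThan_iff)
qed

lemma problemD:
  assumes "problem s U R a b"
  shows "bij_betw (s ''qc'') {a..<b} {v. v < n \<and> el v \<subseteq> U}" "R \<inter> U = {}"
    "a \<le> i \<Longrightarrow> i < b \<Longrightarrow> a \<le> j \<Longrightarrow> j < b \<Longrightarrow> el (s ''qc'' i) \<subset> el (s ''qc'' j) \<Longrightarrow> i < j"
    "a \<le> i \<Longrightarrow> i < b \<Longrightarrow> s ''qc'' i < n \<and> el (s ''qc'' i) \<subseteq> U"
    "a \<le> i \<Longrightarrow> i < b \<Longrightarrow> s ''qo'' i < n \<and> el (s ''qo'' i) = el (s ''qc'' i) \<union> R"
    "a \<le> i \<Longrightarrow> i < b \<Longrightarrow> s ''qr'' i < n \<and> el (s ''qr'' i) \<inter> R = {} \<and>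
       el (s ''qr'' i) \<inter> U = el (s ''qc'' i) \<and> s ''qw'' i = w (s ''qr'' i)"
    "a \<le> i \<Longrightarrow> i < b \<Longrightarrow> y < n \<Longrightarrow> el y \<inter> R = {} \<Longrightarrow> el y \<inter> U = el (s ''qc'' i) \<Longrightarrow> w y \<le> s ''qw'' i"
    "C \<in> K \<Longrightarrow> C \<subseteq> U \<Longrightarrow> \<exists>i. a \<le> i \<and> i < b \<and> s ''qc'' i = ver C"
    "a \<le> i \<Longrightarrow> i < b \<Longrightarrow> a \<le> j \<Longrightarrow> j < b \<Longrightarrow> s ''qc'' i = s ''qc'' j \<Longrightarrow> i = j"
proof -
  have b: "bij_betw (s ''qc'') {a..<b} {v. v < n \<and> el v \<subseteq> U}" using assms by (simp add: problem_def)
  then show "bij_betw (s ''qc'') {a..<b} {v. v < n \<and> el v \<subseteq> U}" .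
  show "a \<le> i \<Longrightarrow> i < b \<Longrightarrow> s ''qc'' i < n \<and> el (s ''qc'' i) \<subseteq> U"
    using bij_betwE[OF b] by simp
  show "a \<le> i \<Longrightarrow> i < b \<Longrightarrow> a \<le> j \<Longrightarrow> j < b \<Longrightarrow> s ''qc'' i = s ''qc'' j \<Longrightarrow> i = j"
    using b by (auto simp: bij_betw_def inj_on_def)
  have "\<forall>i\<in>{a..<b}. \<forall>y<n. el y \<inter> R = {} \<longrightarrow> el y \<inter> U = el (s ''qc'' i) \<longrightarrow> w y \<le> s ''qw'' i"
    using assms unfolding problem_def by blast
  then show "a \<le> i \<Longrightarrow> i < b \<Longrightarrow> y < n \<Longrightarrow> el y \<inter> R = {} \<Longrightarrow> el y \<inter> U = el (s ''qc'' i) \<Longrightarrow> w y \<le> s ''qw'' i"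
    by simp
  show "\<exists>i. a \<le> i \<and> i < b \<and> s ''qc'' i = ver C" if "C \<in> K" "C \<subseteq> U"
  proof -
    have "ver C \<in> s ''qc'' ` {a..<b}" using b that ver_in by (simp add: bij_betw_def)
    then show ?thesis by auto
  qed
qed (use assms in \<open>auto simp: problem_def\<close>)

text \<open>Every segment holds the empty clique. So there is always an entry that can pay for the
  constant overhead of its problem.\<close>

lemma problem_nonempty: "problem s U R a b \<Longrightarrow> a < b"
  using problemD(8)[of s U R a b "{}"] empty_K by fastforce

text \<open>In the child for \<open>x\<close>, an element stays relevant iff it is adjacent to \<open>x\<close> and \<open>x\<close> is the first
  element of the branching clique in the wanted clique; \<open>e\<close> holds the elements before \<open>x\<close>.\<close>

definition child_set :: "nat set \<Rightarrow> nat set \<Rightarrow> nat \<Rightarrow> nat set" where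
  "child_set U e x = {i \<in> U. i \<noteq> x \<and> {i, x} \<in> K \<and> i \<notin> e}"

definition members :: "memory \<Rightarrow> nat \<Rightarrow> nat \<Rightarrow> nat set \<Rightarrow> nat \<Rightarrow> nat set" where
  "members s a b e x = {i \<in> {a..<b}. x \<in> el (s ''qc'' i) \<and> el (s ''qc'' i) \<inter> e = {}}"

text \<open>\<open>\<iota>\<close> sends a slot of the child to the entry of the parent it comes
  from. Its monotonicity passes on the order in which subcliques come first.\<close>

definition grouped :: "memory \<Rightarrow> memory \<Rightarrow> nat \<Rightarrow> nat \<Rightarrow> nat \<Rightarrow> (nat \<Rightarrow> nat) \<Rightarrow> nat set \<Rightarrow> bool" where
  "grouped s1 s x T T' \<iota> N \<longleftrightarrow> T \<le> T' \<and> bij_betw \<iota> {T..<T'} N \<and>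
     (\<forall>i\<in>{T..<T'}. \<forall>j\<in>{T..<T'}. i < j \<longrightarrow> \<iota> i < \<iota> j) \<and>
     (\<forall>i\<in>{T..<T'}. s ''qo'' i = s1 ''qo'' (\<iota> i) \<and>
        s ''qc'' i = ver (el (s1 ''qc'' (\<iota> i)) - {x}) \<and> s ''sl'' (s ''qc'' i) = i) \<and>
     (\<forall>i<T. s ''qo'' i = s1 ''qo'' i \<and> s ''qc'' i = s1 ''qc'' i) \<and>
     (\<forall>v. s ''st'' v = (if v \<in> s ''qc'' ` {T..<T'} then s1 ''np'' 0 else s1 ''st'' v)) \<and>
     (\<forall>i. s ''tk'' i = (if i \<in> N then 1 else s1 ''tk'' i))"

lemma grouped_cong:
  assumes "grouped s1 s x T T' \<iota> N" and eqs: "s' ''qo'' = s ''qo''" "s' ''qc'' = s ''qc''" "s' ''sl'' = s ''sl''"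
    "s' ''st'' = s ''st''" "s' ''tk'' = s ''tk''"
  shows "grouped s1 s' x T T' \<iota> N"
  using assms(1) unfolding grouped_def eqs .

lemma groupedD:
  assumes "grouped s1 s x T T' \<iota> N" "T \<le> i" "i < T'"
  shows "s ''qo'' i = s1 ''qo'' (\<iota> i)" "s ''qc'' i = ver (el (s1 ''qc'' (\<iota> i)) - {x})"
    "s ''sl'' (s ''qc'' i) = i" "\<iota> i \<in> N"
proof -
  have i: "i \<in> {T..<T'}" using assms by simp
  show "\<iota> i \<in> N" using assms(1) i unfolding grouped_def by (blast dest: bij_betwE)
  show "s ''qo'' i = s1 ''qo'' (\<iota> i)" "s ''qc'' i = ver (el (s1 ''qc'' (\<iota> i)) - {x})"
    "s ''sl'' (s ''qc'' i) = i" using assms(1) i unfolding grouped_def by blast+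
qed

lemma grouped_insert:
  assumes g: "grouped s1 s x T T' \<iota> N"
    and pr: "problem s1 U R a b" and N: "N \<subseteq> {a..<b}" "\<And>i. i \<in> N \<Longrightarrow> i < p \<and> x \<in> el (s1 ''qc'' i)"
    and p: "a \<le> p" "p < b" "b \<le> T" "x \<in> el (s1 ''qc'' p)" and d: "d = ver (el (s1 ''qc'' p) - {x})"
    and upd: "s' ''tk'' = (s ''tk'')(p := 1)" "s' ''qo'' = (s ''qo'')(T' := s1 ''qo'' p)"
      "s' ''qc'' = (s ''qc'')(T' := d)" "s' ''st'' = (s ''st'')(d := s1 ''np'' 0)"
      "s' ''sl'' = (s ''sl'')(d := T')"
  shows "grouped s1 s' x T (Suc T') (\<iota>(T' := p)) (insert p N)"
proof -
  have T: "T \<le> T'" and bij: "bij_betw \<iota> {T..<T'} N" using g by (simp_all add: grouped_def)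
  have iv: "{T..<Suc T'} = insert T' {T..<T'}" using T by auto
  have pN: "p \<notin> N" using N(2) by blast
  have \<iota>: "\<iota> i \<in> N" if "T \<le> i" "i < T'" for i using bij_betwE[OF bij] that by simp
  have "bij_betw (\<iota>(T' := p)) {T..<T'} N"
    using bij by (rule bij_betw_cong[THEN iffD2, rotated]) auto
  then have B: "bij_betw (\<iota>(T' := p)) {T..<Suc T'} (insert p N)"
    unfolding iv using notIn_Un_bij_betw[of T' "{T..<T'}" "\<iota>(T' := p)" N] pN by simp
  \<comment> \<open>Two entries that contain \<open>x\<close> and agree without it are equal, so no
    earlier slot loses its \<open>sl\<close> value.\<close>
  have dq: "d \<noteq> s ''qc'' i" if i: "T \<le> i" "i < T'" for i
  proof
    assume eq: "d = s ''qc'' i"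
    have l: "a \<le> \<iota> i" "\<iota> i < b" "\<iota> i < p" "x \<in> el (s1 ''qc'' (\<iota> i))"
      using \<iota>[OF i] N by force+
    have v: "s1 ''qc'' p < n" "s1 ''qc'' (\<iota> i) < n" using problemD(4)[OF pr] p l by auto
    have "s ''qc'' i = ver (el (s1 ''qc'' (\<iota> i)) - {x})" using g i by (simp add: grouped_def)
    then have "ver (el (s1 ''qc'' p) - {x}) = ver (el (s1 ''qc'' (\<iota> i)) - {x})" using d eq by simp
    then have "el (s1 ''qc'' p) - {x} = el (s1 ''qc'' (\<iota> i)) - {x}"
      using down_edge(3)[OF v(1) p(4)] down_edge(3)[OF v(2) l(4)] by metis
    then have "el (s1 ''qc'' p) = el (s1 ''qc'' (\<iota> i))" using p(4) l(4) by blast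
    then have "s1 ''qc'' p = s1 ''qc'' (\<iota> i)" using v el_inj by blast
    then show False using problemD(9)[OF pr] p l by blast
  qed
  have im: "s' ''qc'' ` {T..<Suc T'} = insert d (s ''qc'' ` {T..<T'})"
    unfolding iv upd by auto
  have M: "\<forall>i\<in>{T..<Suc T'}. \<forall>j\<in>{T..<Suc T'}. i < j \<longrightarrow> (\<iota>(T' := p)) i < (\<iota>(T' := p)) j"
  proof (intro ballI impI)
    fix i j assume ij: "i \<in> {T..<Suc T'}" "j \<in> {T..<Suc T'}" "i < j"
    show "(\<iota>(T' := p)) i < (\<iota>(T' := p)) j"
    proof (cases "j = T'")
      case True
      then show ?thesis using ij N(2) \<iota>[of i] by simp
    next
      case False
      then show ?thesis using ij g by (simp add: grouped_def)
    qed
  qed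
  have Q: "\<forall>i\<in>{T..<Suc T'}. s' ''qo'' i = s1 ''qo'' ((\<iota>(T' := p)) i) \<and>
      s' ''qc'' i = ver (el (s1 ''qc'' ((\<iota>(T' := p)) i)) - {x}) \<and> s' ''sl'' (s' ''qc'' i) = i"
  proof
    fix i assume "i \<in> {T..<Suc T'}"
    then consider "i = T'" | "T \<le> i" "i < T'" by (auto simp: less_Suc_eq)
    then show "s' ''qo'' i = s1 ''qo'' ((\<iota>(T' := p)) i) \<and>
      s' ''qc'' i = ver (el (s1 ''qc'' ((\<iota>(T' := p)) i)) - {x}) \<and> s' ''sl'' (s' ''qc'' i) = i"
    proof cases
      case 1
      then show ?thesis by (simp add: upd d)
    next
      case 2
      have "i \<noteq> T'" "d \<noteq> s ''qc'' i" using 2 dq[OF 2] by auto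
      then show ?thesis using groupedD[OF g 2] by (simp add: upd)
    qed
  qed
  have L: "\<forall>i<T. s' ''qo'' i = s1 ''qo'' i \<and> s' ''qc'' i = s1 ''qc'' i"
    using g T by (simp add: grouped_def upd)
  have S: "\<forall>v. s' ''st'' v = (if v \<in> s' ''qc'' ` {T..<Suc T'} then s1 ''np'' 0 else s1 ''st'' v)"
    unfolding im using g by (simp add: grouped_def upd)
  have K: "\<forall>i. s' ''tk'' i = (if i \<in> insert p N then 1 else s1 ''tk'' i)"
    using g by (simp add: grouped_def upd)
  show ?thesis
    unfolding grouped_def using T by (intro conjI B M Q L S K) simp
qed

text \<open>An entry is claimed exactly if its clique meets \<open>e\<close>, so the test on
  \<open>tk\<close> selects those whose first element of the branching clique, in list order, is
  \<open>x\<close>.\<close>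

lemma wp_group_loop:
  assumes st: "static s1" and pr: "problem s1 U R a b" and v: "s1 ''h'' 0 = a" "s1 ''len'' 0 = b - a"
      "s1 ''x'' 0 = x" "s1 ''tl'' 0 = T" and x: "x < n" "x \<notin> e" and T: "b \<le> T"
    and bound: "T + card (members s1 a b e x) \<le> n * n + 2 * n"
    and tk: "\<And>i. i \<in> {a..<b} \<Longrightarrow> s1 ''tk'' i = (if el (s1 ''qc'' i) \<inter> e = {} then 0 else 1)"
  shows "wp W group_loop (\<lambda>t s. t \<le> (b - a) * 110 + 30 \<and>
    same {''j'', ''p'', ''c'', ''g'', ''tk'', ''d'', ''qo'', ''qc'', ''st'', ''sl'', ''tl''} s1 s \<and>
    (\<exists>\<iota>. grouped s1 s x T (s ''tl'' 0) \<iota> (members s1 a b e x))) s1"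
proof -
  let ?M = "{''j'', ''p'', ''c'', ''g'', ''tk'', ''d'', ''qo'', ''qc'', ''st'', ''sl'', ''tl''}"
  let ?N = "\<lambda>k. {i \<in> members s1 a b e x. i < a + k}"
  have ab: "a < b" using pr by (rule problem_nonempty)
  have bW: "b \<le> n * n + 2 * n" using T bound by simp
  show ?thesis
    unfolding group_loop_def
  proof (rule wp_For[where h = "b - a" and B = 90 and
      I = "\<lambda>k s. same ?M s1 s \<and> (\<exists>\<iota>. grouped s1 s x T (s ''tl'' 0) \<iota> (?N k))"], goal_cases)
    case 1
    have N0: "?N 0 = {}" by (auto simp: members_def)
    show ?case unfolding N0 using v(4) by (simp add: grouped_def bij_betw_def)
  next
    case (2 k s)
    then show ?case using v W_gt by (simp add: same_def)
  next
    case (5 k s)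
    then obtain \<iota> where g: "grouped s1 s x T (s ''tl'' 0) \<iota> (?N k)" by blast
    have k: "s ''j'' 0 = k" "k < b - a" and same: "same ?M s1 s" using 5 by simp_all
    let ?p = "a + k" and ?T = "s ''tl'' 0"
    let ?c = "s1 ''qc'' ?p"
    have p: "a \<le> ?p" "?p < b" "?p < T" using k T by auto
    have c: "?c < n" using problemD(4)[OF pr p(1,2)] by simp
    have "card (?N k) \<le> card (members s1 a b e x)"
      by (rule card_mono) (auto simp: members_def)
    moreover have "card (?N k) = ?T - T"
      using g bij_betw_same_card unfolding grouped_def by fastforce
    moreover have TT: "T \<le> ?T" using g by (simp add: grouped_def)
    ultimately have Tb: "?T \<le> n * n + 2 * n" using bound by simp
    have pN: "?p \<notin> ?N k" by simp
    have eq: "s ''h'' 0 = a" "s ''qc'' ?p = ?c" "s ''qo'' ?p = s1 ''qo'' ?p" "s ''b'' ?c = ?c * n"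
      "s ''x'' 0 = x" "s ''mem'' (?c * n + x) = (if x \<in> el ?c then 1 else 0)"
      "s ''tk'' ?p = (if el ?c \<inter> e = {} then 0 else 1)" "s ''np'' 0 = s1 ''np'' 0" "s ''dn'' = s1 ''dn''"
      using same v g p staticD[OF st c] x tk[of ?p] pN by (simp_all add: same_def grouped_def)
    note idx = idx_less[OF c x(1)]
    have pW: "?p < W" using p bW W by simp
    show ?case
    proof (cases "x \<in> el ?c \<and> el ?c \<inter> e = {}")
      case True
      let ?d = "ver (el ?c - {x})"
      let ?s' = "s(''p'' := (s ''p'')(0 := ?p), ''c'' := (s ''c'')(0 := ?c), ''g'' := (s ''g'')(0 := ?c * n + x),
        ''tk'' := (s ''tk'')(?p := 1), ''d'' := (s ''d'')(0 := ?d), ''qo'' := (s ''qo'')(?T := s1 ''qo'' ?p),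
        ''qc'' := (s ''qc'')(?T := ?d), ''st'' := (s ''st'')(?d := s1 ''np'' 0), ''sl'' := (s ''sl'')(?d := ?T),
        ''tl'' := (s ''tl'')(0 := Suc ?T), ''j'' := (s ''j'')(0 := Suc k))"
      have dn: "s1 ''dn'' (?c * n + x) = ?d" using staticD(5)[OF st c] True by simp
      have "grouped s1 ?s' x T (Suc ?T) (\<iota>(?T := ?p)) (insert ?p (?N k))"
        by (rule grouped_insert[OF g pr _ _ p(1,2) T])
          (use True in \<open>auto simp: members_def\<close>)
      moreover have "insert ?p (?N k) = ?N (Suc k)"
        using True p by (auto simp: members_def less_Suc_eq)
      ultimately have "\<exists>\<iota>. grouped s1 ?s' x T (Suc ?T) \<iota> (?N (Suc k))" by auto
      then show ?thesis using True same idx W_gt pW Tb W by (simp add: eq k dn)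
    next
      case False
      then have "?N (Suc k) = ?N k" by (auto simp: members_def less_Suc_eq)
      moreover have "grouped s1 (s(''p'' := (s ''p'')(0 := ?p), ''c'' := (s ''c'')(0 := ?c),
        ''g'' := (s ''g'')(0 := ?c * n + x), ''j'' := (s ''j'')(0 := Suc k))) x T ?T \<iota> (?N k)"
        using g by (rule grouped_cong) simp_all
      ultimately show ?thesis using False same idx W_gt pW by (auto simp: eq k)
    qed
  next
    case (6 t s)
    have "?N (b - a) = members s1 a b e x" using ab by (auto simp: members_def)
    then show ?case using 6 by (simp add: algebra_simps)
  qed (use bW W in auto)
qed

end

section \<open>Projecting the competitors into a child\<close>

context wopp
begin

definition child_ready :: "memory \<Rightarrow> nat set \<Rightarrow> nat \<Rightarrow> nat \<Rightarrow> bool" where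
  "child_ready s U' T T' \<longleftrightarrow> bij_betw (s ''qc'') {T..<T'} {v. v < n \<and> el v \<subseteq> U'} \<and>
     (\<forall>i\<in>{T..<T'}. s ''sl'' (s ''qc'' i) = i) \<and>
     (\<forall>v<n. s ''st'' v = s ''np'' 0 \<longleftrightarrow> el v \<subseteq> U') \<and> (\<forall>i\<ge>T. s ''qw'' i = 0)"

text \<open>\<open>child_set\<close> admits only neighbours of \<open>x\<close>. This is what makes
  the removal of \<open>x\<close> surjective onto the cliques of the child.\<close>

lemma child_set_insert_K:
  assumes "v < n" "el v \<subseteq> child_set U e x" "{x} \<in> K"
  shows "insert x (el v) \<in> K"
proof (rule K_flag)
  show "finite (insert x (el v))" using finite_el[OF assms(1)] by simp
  fix i j assume "i \<in> insert x (el v)" "j \<in> insert x (el v)"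
  then consider "i = x" "j = x" | "i = x" "j \<in> el v" | "j = x" "i \<in> el v" | "i \<in> el v" "j \<in> el v" by blast
  then show "{i, j} \<in> K"
  proof cases
    case 1
    then show ?thesis using assms(3) by simp
  next
    case 2
    then show ?thesis using assms(2) by (auto simp: child_set_def insert_commute)
  next
    case 3
    then show ?thesis using assms(2) by (auto simp: child_set_def)
  next
    case 4
    then show ?thesis using K_down[OF el_K[OF assms(1)]] by simp
  qed
qed

lemma members_child:
  assumes pr: "problem s1 U R a b" and i: "i \<in> members s1 a b e x"
  shows "a \<le> i" "i < b" "x \<in> el (s1 ''qc'' i)" "s1 ''qc'' i < n" "el (s1 ''qc'' i) - {x} \<subseteq> child_set U e x"
proof -
  show ab: "a \<le> i" "i < b" and x: "x \<in> el (s1 ''qc'' i)" using i by (auto simp: members_def)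
  show v: "s1 ''qc'' i < n" using problemD(4)[OF pr ab] by simp
  have U: "el (s1 ''qc'' i) \<subseteq> U" using problemD(4)[OF pr ab] by simp
  show "el (s1 ''qc'' i) - {x} \<subseteq> child_set U e x"
  proof
    fix y assume y: "y \<in> el (s1 ''qc'' i) - {x}"
    then have "{y, x} \<in> K" using x by (intro K_down[OF el_K[OF v]]) auto
    then show "y \<in> child_set U e x" using y U i by (auto simp: child_set_def members_def)
  qed
qed

text \<open>Removing \<open>x\<close> is inverted by inserting it: by
  \<open>child_set_insert_K\<close> the result is a clique, and it lies in \<open>U\<close> and
  avoids \<open>e\<close>, so it is a member. Both operations respect proper inclusion, hence the
  order of the parent and the monotone \<open>\<iota>\<close> give the order of the child.\<close>

lemma grouped_child:
  assumes g: "grouped s1 s x T T' \<iota> (members s1 a b e x)" and pr: "problem s1 U R a b"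
    and x: "x \<in> U" "x \<notin> e" "{x} \<in> K"
  shows "bij_betw (s ''qc'') {T..<T'} {v. v < n \<and> el v \<subseteq> child_set U e x}"
    "T \<le> i \<Longrightarrow> i < T' \<Longrightarrow> el (s ''qc'' i) = el (s1 ''qc'' (\<iota> i)) - {x}"
    "T \<le> i \<Longrightarrow> i < T' \<Longrightarrow> T \<le> j \<Longrightarrow> j < T' \<Longrightarrow> el (s ''qc'' i) \<subset> el (s ''qc'' j) \<Longrightarrow> i < j"
proof -
  let ?N = "members s1 a b e x"
  have \<iota>: "bij_betw \<iota> {T..<T'} ?N" using g by (simp add: grouped_def)
  note N = members_child[OF pr groupedD(4)[OF g]]
  show e: "el (s ''qc'' i) = el (s1 ''qc'' (\<iota> i)) - {x}" if "T \<le> i" "i < T'" for i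
    using groupedD(2)[OF g that] down_edge(3)[OF N(4)[OF that] N(3)[OF that]] by simp
  have lt: "s ''qc'' i < n" if "T \<le> i" "i < T'" for i
    using groupedD(2)[OF g that] down_edge(2)[OF N(4)[OF that] N(3)[OF that]] by simp
  have inj\<iota>: "i = j" if "T \<le> i" "i < T'" "T \<le> j" "j < T'" "\<iota> i = \<iota> j" for i j
    using \<iota> that by (auto simp: bij_betw_def inj_on_def)
  have "inj_on (s ''qc'') {T..<T'}"
  proof (rule inj_onI)
    fix i j assume ij: "i \<in> {T..<T'}" "j \<in> {T..<T'}" "s ''qc'' i = s ''qc'' j"
    then have "el (s1 ''qc'' (\<iota> i)) - {x} = el (s1 ''qc'' (\<iota> j)) - {x}" using e[of i] e[of j] by simp
    then have "el (s1 ''qc'' (\<iota> i)) = el (s1 ''qc'' (\<iota> j))" using N(3)[of i] N(3)[of j] ij by auto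
    then have "s1 ''qc'' (\<iota> i) = s1 ''qc'' (\<iota> j)" using N(4)[of i] N(4)[of j] ij el_inj by simp
    then have "\<iota> i = \<iota> j" using problemD(9)[OF pr] N(1,2)[of i] N(1,2)[of j] ij by simp
    then show "i = j" using inj\<iota> ij by simp
  qed
  moreover have "s ''qc'' ` {T..<T'} \<subseteq> {v. v < n \<and> el v \<subseteq> child_set U e x}"
  proof
    fix v assume "v \<in> s ''qc'' ` {T..<T'}"
    then obtain i where i: "T \<le> i" "i < T'" "v = s ''qc'' i" by auto
    then show "v \<in> {v. v < n \<and> el v \<subseteq> child_set U e x}"
      using lt[OF i(1,2)] N(5)[OF i(1,2)] by (simp add: e[OF i(1,2)])
  qed
  moreover have "{v. v < n \<and> el v \<subseteq> child_set U e x} \<subseteq> s ''qc'' ` {T..<T'}"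
  proof
    fix v assume "v \<in> {v. v < n \<and> el v \<subseteq> child_set U e x}"
    then have v: "v < n" "el v \<subseteq> child_set U e x" by auto
    have xv: "x \<notin> el v" "el v \<subseteq> U" "el v \<inter> e = {}" using v(2) by (auto simp: child_set_def)
    have k: "insert x (el v) \<in> K" by (rule child_set_insert_K[OF v x(3)])
    then obtain i where i: "a \<le> i" "i < b" "s1 ''qc'' i = ver (insert x (el v))"
      using problemD(8)[OF pr k] x xv by auto
    then have "i \<in> ?N" using k x xv by (simp add: members_def)
    then have "i \<in> \<iota> ` {T..<T'}" using bij_betw_imp_surj_on[OF \<iota>] by simp
    then obtain j where j: "T \<le> j" "j < T'" "\<iota> j = i" by auto
    then have "el (s ''qc'' j) = el v" using e[OF j(1,2)] i k xv by simp
    then have "s ''qc'' j = v" using lt[OF j(1,2)] v(1) el_inj by blast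
    then show "v \<in> s ''qc'' ` {T..<T'}" using j by auto
  qed
  ultimately show "bij_betw (s ''qc'') {T..<T'} {v. v < n \<and> el v \<subseteq> child_set U e x}"
    by (auto simp: bij_betw_def)
  show "i < j" if ij: "T \<le> i" "i < T'" "T \<le> j" "j < T'" and s: "el (s ''qc'' i) \<subset> el (s ''qc'' j)"
  proof (rule ccontr)
    assume "\<not> i < j"
    then have "j < i \<or> i = j" by auto
    moreover have "i \<noteq> j" using s by auto
    moreover have "\<iota> j < \<iota> i" if "j < i" using g ij that by (simp add: grouped_def)
    moreover have "el (s1 ''qc'' (\<iota> i)) \<subset> el (s1 ''qc'' (\<iota> j))"
      using s N(3)[of i] N(3)[of j] ij unfolding e[OF ij(1,2)] e[OF ij(3,4)] by blast
    then have "\<iota> i < \<iota> j" using problemD(3)[OF pr] N(1,2)[of i] N(1,2)[of j] ij by blast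
    ultimately show False by simp
  qed
qed

lemma wp_project_one:
  assumes st: "static s" and pr: "problem s U R a b" and p: "a \<le> p" "p < b"
    and c: "s ''c'' 0 = c" "c = s ''qc'' p"
    and stamp: "\<And>v. v < n \<Longrightarrow> s ''st'' v = s ''np'' 0 \<longleftrightarrow> el v \<subseteq> U'"
    and prev: "\<And>i. a \<le> i \<Longrightarrow> i < p \<Longrightarrow> s ''pr'' (s ''qc'' i) = ver (el (s ''qc'' i) \<inter> U')"
  shows "wp W project_one (\<lambda>t s'. t \<le> D * 60 + 40 \<and> same {''q'', ''d'', ''pr''} s s' \<and>
    s' ''pr'' = (s ''pr'')(c := ver (el c \<inter> U'))) s"
proof -
  have cn: "c < n" "el c \<subseteq> U" using problemD(4)[OF pr p] c by simp_all
  show ?thesis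
  proof (cases "el c \<subseteq> U'")
    case True
    then have "el c \<inter> U' = el c" by blast
    then have "ver (el c \<inter> U') = c" using cn by simp
    then show ?thesis unfolding project_one_def using True stamp[OF cn(1)] c W_gt by simp
  next
    case False
    \<comment> \<open>The loop runs through all elements, and every unstamped one writes this same
      value, so it does not matter which of them comes last.\<close>
    let ?V = "ver (el c \<inter> U')"
    let ?e = "\<lambda>q. s ''el'' (c * n + q)"
    have bij: "bij_betw ?e {..<lv c} (el c)" using staticD(3)[OF st cn(1)] .
    have "wp W (For ''q'' (Read ''ec'' (V ''c''))
         (''d'' ::= Read ''el'' (Plus (Read ''b'' (V ''c'')) (V ''q'')) ;;
          If (Equal (Read ''st'' (V ''d'')) (V ''np''))
            Skip
            (Write ''pr'' (V ''c'') (Read ''pr'' (Read ''dn'' (Plus (Read ''b'' (V ''c'')) (V ''d'')))))))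
      (\<lambda>t s'. t + 30 \<le> D * 60 + 60 \<and> same {''q'', ''d'', ''pr''} s s' \<and>
        s' ''pr'' = (s ''pr'')(c := ?V)) s"
    proof (rule wp_For[where h = "lv c" and B = 45 and
        I = "\<lambda>k s'. same {''q'', ''d'', ''pr''} s s' \<and>
          s' ''pr'' = (if ?e ` {..<k} \<subseteq> U' then s ''pr'' else (s ''pr'')(c := ?V))"], goal_cases)
      case 1
      then show ?case by simp
    next
      case (2 k s')
      then show ?case using c staticD(2)[OF st cn(1)] W_gt by (simp add: same_def)
    next
      case (5 k s')
      have k: "s' ''q'' 0 = k" "k < lv c" "k < n" using 5 lv_le_n[OF cn(1)] by simp_all
      have sm: "same {''q'', ''d'', ''pr''} s s'" using 5 by simp
      let ?d = "?e k"
      have d: "?d \<in> el c" using bij_betwE[OF bij] k by simp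
      \<comment> \<open>The vertex that names the element carries its singleton clique, so its stamp
        decides \<open>?d \<in> U'\<close>.\<close>
      then have dn: "?d < n" "el ?d = {?d}" using sing[OF cn(1) d] by simp_all
      have eq: "s' ''c'' 0 = c" "s' ''b'' c = c * n" "s' ''el'' (c * n + k) = ?d"
        "s' ''st'' ?d = s' ''np'' 0 \<longleftrightarrow> ?d \<in> U'" "s' ''dn'' (c * n + ?d) = ver (el c - {?d})"
        using sm c(1) staticD(1,5)[OF st cn(1)] d stamp[OF dn(1)] dn(2) by (simp_all add: same_def)
      note idx = idx_less[OF cn(1) k(3)] idx_less[OF cn(1) dn(1)]
      have im: "?e ` {..<Suc k} \<subseteq> U' \<longleftrightarrow> ?d \<in> U' \<and> ?e ` {..<k} \<subseteq> U'"
        by (auto simp: lessThan_Suc)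
      show ?case
      proof (cases "?d \<in> U'")
        case True
        then show ?thesis using 5 idx W_gt by (simp add: eq im k)
      next
        case False
        let ?v = "ver (el c - {?d})"
        note v = down_edge(2,3)[OF cn(1) d]
        obtain i where i: "a \<le> i" "i < b" "s ''qc'' i = ?v"
          using problemD(8)[OF pr, of "el c - {?d}"] K_down[OF el_K[OF cn(1)]] cn(2) by blast
        \<comment> \<open>The smaller clique stands earlier in the segment, so its trace is already
          known.\<close>
        have "el (s ''qc'' i) \<subset> el (s ''qc'' p)" unfolding i(3) v(2) c(2)[symmetric] using d by blast
        then have "i < p" using problemD(3)[OF pr i(1,2) p] by simp
        then have "s ''pr'' ?v = ver (el ?v \<inter> U')" using prev[OF i(1)] i(3) by simp
        also have "el ?v \<inter> U' = el c \<inter> U'" unfolding v(2) using False by blast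
        finally have prv: "s ''pr'' ?v = ?V" .
        have "?v \<noteq> c" using v(2) d by (metis Diff_iff singletonI)
        then have "s' ''pr'' ?v = ?V" using 5 prv by simp
        moreover have "s' ''pr'' = (if ?e ` {..<k} \<subseteq> U' then s ''pr'' else (s ''pr'')(c := ?V))"
          using 5 by blast
        ultimately have H: "(s' ''pr'')(c := s' ''pr'' ?v) = (s ''pr'')(c := ?V)" by simp
        have "s' ''st'' ?d \<noteq> s' ''np'' 0" using False eq(4) by simp
        then show ?thesis using sm False idx W_gt by (simp add: eq im k H)
      qed
    next
      case (6 t s')
      have "?e ` {..<lv c} = el c" using bij by (simp add: bij_betw_def)
      then show ?case using 6 False card_le_D[OF cn(1)] by simp
    qed (use W_gt lv_le_n[OF cn(1)] in auto)
    note H = this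
    show ?thesis unfolding project_one_def wp_If
      using False stamp[OF cn(1)] c(1) W_gt wp_conseq[OF H] by simp
  qed
qed

definition candidates :: "memory \<Rightarrow> nat \<Rightarrow> nat \<Rightarrow> nat \<Rightarrow> nat set \<Rightarrow> nat set \<Rightarrow> nat set" where
  "candidates s a b x U' Z = {i \<in> {a..<b}. x \<notin> el (s ''qc'' i) \<and> el (s ''qc'' i) \<inter> U' = Z}"

text \<open>Weight 0 encodes that no candidate has arrived yet; \<open>qr\<close> then carries no
  information.\<close>

definition best_among :: "memory \<Rightarrow> memory \<Rightarrow> nat \<Rightarrow> nat set \<Rightarrow> bool" where
  "best_among s1 s i I \<longleftrightarrow> (\<forall>i1\<in>I. s1 ''qw'' i1 \<le> s ''qw'' i) \<and>
     (s ''qw'' i = 0 \<or> (\<exists>i0\<in>I. s ''qr'' i = s1 ''qr'' i0 \<and> s ''qw'' i = s1 ''qw'' i0))"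

lemma wp_project_loop:
  assumes st: "static s1" and pr: "problem s1 U R a b" and v: "s1 ''h'' 0 = a" "s1 ''len'' 0 = b - a"
      "s1 ''x'' 0 = x" and x: "x < n" and T: "b \<le> T" "b \<le> n * n + 2 * n"
    and ready: "child_ready s1 U' T T'"
  shows "wp W project_loop (\<lambda>t s. t \<le> (b - a) * (D * 60 + 140) + 30 \<and>
    same {''j'', ''p'', ''c'', ''q'', ''d'', ''pr'', ''qw'', ''qr''} s1 s \<and>
    (\<forall>i. i < T \<or> T' \<le> i \<longrightarrow> s ''qw'' i = s1 ''qw'' i \<and> s ''qr'' i = s1 ''qr'' i) \<and>
    (\<forall>i\<in>{T..<T'}. best_among s1 s i (candidates s1 a b x U' (el (s1 ''qc'' i))))) s1"
  unfolding project_loop_def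
proof (rule wp_For[where h = "b - a" and B = "D * 60 + 120" and
    I = "\<lambda>k s. same {''j'', ''p'', ''c'', ''q'', ''d'', ''pr'', ''qw'', ''qr''} s1 s \<and>
    (\<forall>i. i < T \<or> T' \<le> i \<longrightarrow> s ''qw'' i = s1 ''qw'' i \<and> s ''qr'' i = s1 ''qr'' i) \<and>
    (\<forall>i\<in>{a..<a + k}. s ''pr'' (s1 ''qc'' i) = ver (el (s1 ''qc'' i) \<inter> U')) \<and>
    (\<forall>i\<in>{T..<T'}. best_among s1 s i (candidates s1 a (a + k) x U' (el (s1 ''qc'' i))))"], goal_cases)
  case 1
  then show ?case using ready by (auto simp: best_among_def candidates_def child_ready_def)
next
  case (2 k s)
  then show ?case using v W_gt by (simp add: same_def)
next
  case (5 k s)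
  let ?M = "{''j'', ''p'', ''c'', ''q'', ''d'', ''pr'', ''qw'', ''qr''}"
  let ?p = "a + k"
  let ?c = "s1 ''qc'' ?p"
  have k: "s ''j'' 0 = k" "k < b - a" and sm: "same ?M s1 s"
    and old: "\<And>i. i < T \<or> T' \<le> i \<Longrightarrow> s ''qw'' i = s1 ''qw'' i \<and> s ''qr'' i = s1 ''qr'' i"
    and prs: "\<And>i. a \<le> i \<Longrightarrow> i < ?p \<Longrightarrow> s ''pr'' (s1 ''qc'' i) = ver (el (s1 ''qc'' i) \<inter> U')"
    and best: "\<And>i. T \<le> i \<Longrightarrow> i < T' \<Longrightarrow>
      best_among s1 s i (candidates s1 a ?p x U' (el (s1 ''qc'' i)))"
    using 5 by (simp, simp, simp, blast, simp, simp)
  have p: "a \<le> ?p" "?p < b" "?p < T" using k T by auto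
  have c: "?c < n" using problemD(4)[OF pr p(1,2)] by simp
  have eqs: "s ''b'' = s1 ''b''" "s ''ec'' = s1 ''ec''" "s ''el'' = s1 ''el''" "s ''mem'' = s1 ''mem''"
    "s ''dn'' = s1 ''dn''" "s ''vp'' = s1 ''vp''" "s ''qc'' = s1 ''qc''" "s ''qo'' = s1 ''qo''"
    "s ''st'' = s1 ''st''" "s ''np'' = s1 ''np''" "s ''sl'' = s1 ''sl''" "s ''h'' 0 = a" "s ''x'' 0 = x"
    using sm v by (simp_all add: same_def)
  let ?s1 = "s(''p'' := (s ''p'')(0 := ?p), ''c'' := (s ''c'')(0 := ?c))"
  have H: "wp W project_one (\<lambda>t s'. t \<le> D * 60 + 40 \<and> same {''q'', ''d'', ''pr''} ?s1 s' \<and>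
    s' ''pr'' = (?s1 ''pr'')(?c := ver (el ?c \<inter> U'))) ?s1"
  proof (rule wp_project_one[where U = U and R = R and a = a and b = b and p = ?p])
    show "static ?s1" by (rule static_cong[OF st]) (simp_all add: eqs)
    show "problem ?s1 U R a b" by (rule problem_cong[OF pr]) (use old T in \<open>simp_all add: eqs\<close>)
    show "?s1 ''st'' v = ?s1 ''np'' 0 \<longleftrightarrow> el v \<subseteq> U'" if "v < n" for v
      using ready that by (simp add: eqs child_ready_def)
    show "?s1 ''pr'' (?s1 ''qc'' i) = ver (el (?s1 ''qc'' i) \<inter> U')" if "a \<le> i" "i < ?p" for i
      using prs[OF that] by (simp add: eqs)
  qed (use p eqs in simp_all)
  have H2: "wp W (project_one ;;
        If (Equal (Read ''mem'' (Plus (Read ''b'' (V ''c'')) (V ''x''))) (Const 0))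
          (''d'' ::= Read ''sl'' (Read ''pr'' (V ''c'')) ;;
           If (Less (Read ''qw'' (V ''d'')) (Read ''qw'' (V ''p'')))
             (Write ''qw'' (V ''d'') (Read ''qw'' (V ''p'')) ;;
              Write ''qr'' (V ''d'') (Read ''qr'' (V ''p'')))
             Skip)
          Skip)
      (\<lambda>t s'. t + 20 \<le> D * 60 + 120 \<and> s' ''j'' 0 = k \<and> same ?M s1 (s'(''j'' := (s' ''j'')(0 := Suc k))) \<and>
        (\<forall>i. i < T \<or> T' \<le> i \<longrightarrow> s' ''qw'' i = s1 ''qw'' i \<and> s' ''qr'' i = s1 ''qr'' i) \<and>
        (\<forall>i\<in>{a..<a + Suc k}. s' ''pr'' (s1 ''qc'' i) = ver (el (s1 ''qc'' i) \<inter> U')) \<and>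
        (\<forall>i\<in>{T..<T'}. best_among s1 s' i (candidates s1 a (Suc (a + k)) x U' (el (s1 ''qc'' i))))) ?s1"
    unfolding wp_Seq
  proof (rule wp_conseq[OF H], goal_cases)
    case (1 t s')
    then have t: "t \<le> D * 60 + 40" and sm': "same {''q'', ''d'', ''pr''} ?s1 s'"
      and pr': "s' ''pr'' = (s ''pr'')(?c := ver (el ?c \<inter> U'))" by simp_all
    have eq: "s' ''b'' ?c = ?c * n" "s' ''x'' 0 = x" "s' ''c'' 0 = ?c" "s' ''p'' 0 = ?p" "s' ''j'' 0 = k"
      "s' ''mem'' (?c * n + x) = (if x \<in> el ?c then 1 else 0)" "s' ''sl'' = s1 ''sl''"
      "s' ''qw'' = s ''qw''" "s' ''qr'' = s ''qr''"
      using sm' staticD[OF st c] x k by (simp_all add: same_def eqs)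
    have sm2: "same ?M s1 s'" using sm' sm by (simp add: same_def)
    have prs': "\<forall>i\<in>{a..<a + Suc k}. s' ''pr'' (s1 ''qc'' i) = ver (el (s1 ''qc'' i) \<inter> U')"
    proof
      fix i assume i: "i \<in> {a..<a + Suc k}"
      show "s' ''pr'' (s1 ''qc'' i) = ver (el (s1 ''qc'' i) \<inter> U')"
      proof (cases "i = ?p")
        case True
        then show ?thesis by (simp add: pr')
      next
        case False
        then have "a \<le> i" "i < ?p" using i by auto
        moreover then have "s1 ''qc'' i \<noteq> ?c" using problemD(9)[OF pr _ _ p(1,2)] p by force
        ultimately show ?thesis using prs by (simp add: pr')
      qed
    qed
    note idx = idx_less[OF c x]
    have cand: "candidates s1 a (Suc (a + k)) x U' Z =
        (if x \<notin> el ?c \<and> el ?c \<inter> U' = Z then insert ?p (candidates s1 a ?p x U' Z)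
         else candidates s1 a ?p x U' Z)" for Z
      by (auto simp: candidates_def less_Suc_eq)
    show ?case
    proof (cases "x \<in> el ?c")
      case True
      have "best_among s1 s' i (candidates s1 a (Suc (a + k)) x U' (el (s1 ''qc'' i)))"
        if "T \<le> i" "i < T'" for i
        using best[OF that] True by (simp add: cand best_among_def eq)
      then show ?thesis using True t sm2 prs' idx W_gt old by (simp add: eq)
    next
      case False
      \<comment> \<open>The trace is a clique inside \<open>U'\<close>, and the child has a slot for
        each of these, so every competitor finds a place.\<close>
      let ?Z = "el ?c \<inter> U'"
      have ZK: "?Z \<in> K" by (rule K_down[OF el_K[OF c]]) blast
      then have "ver ?Z \<in> s1 ''qc'' ` {T..<T'}"
        using ready ver_in[OF ZK] by (simp add: child_ready_def bij_betw_def)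
      then obtain i where i: "T \<le> i" "i < T'" "s1 ''qc'' i = ver ?Z" by auto
      have "s1 ''sl'' (s1 ''qc'' i) = i" using ready i(1,2) unfolding child_ready_def by simp
      then have sl: "s1 ''sl'' (ver ?Z) = i" unfolding i(3) .
      have elZ: "el (s1 ''qc'' i) = ?Z" using i ZK by simp
      \<comment> \<open>Different slots hold different cliques, so the new candidate concerns slot
        \<open>i\<close> only.\<close>
      have other: "el (s1 ''qc'' i') \<noteq> ?Z" if "T \<le> i'" "i' < T'" "i' \<noteq> i" for i'
      proof
        assume "el (s1 ''qc'' i') = ?Z"
        moreover have "s1 ''qc'' j < n" if "T \<le> j" "j < T'" for j
        proof -
          have "s1 ''qc'' ` {T..<T'} = {v. v < n \<and> el v \<subseteq> U'}"
            using ready by (simp add: child_ready_def bij_betw_def)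
          moreover have "s1 ''qc'' j \<in> s1 ''qc'' ` {T..<T'}" using that by simp
          ultimately show ?thesis by simp
        qed
        ultimately have "s1 ''qc'' i' = s1 ''qc'' i" using elZ el_inj that(1,2) i(1,2) by metis
        then show False using ready i that unfolding child_ready_def by (auto simp: bij_betw_def inj_on_def)
      qed
      have qp: "s ''qw'' ?p = s1 ''qw'' ?p" "s ''qr'' ?p = s1 ''qr'' ?p" using old p by simp_all
      note b = best[OF i(1,2), unfolded elZ]
      have upd: "best_among s1 s'' i' (candidates s1 a (Suc (a + k)) x U' (el (s1 ''qc'' i')))"
        if i': "T \<le> i'" "i' < T'"
          and q: "s'' ''qw'' = (if s ''qw'' i < s ''qw'' ?p then (s ''qw'')(i := s ''qw'' ?p) else s ''qw'')"
            "s'' ''qr'' = (if s ''qw'' i < s ''qw'' ?p then (s ''qr'')(i := s ''qr'' ?p) else s ''qr'')" for s'' i'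
      proof (cases "i' = i")
        case True
        have "candidates s1 a (Suc (a + k)) x U' ?Z = insert ?p (candidates s1 a ?p x U' ?Z)"
          using False by (simp add: cand)
        then show ?thesis using b unfolding True elZ best_among_def q qp by auto
      next
        case neq: False
        have "candidates s1 a (Suc (a + k)) x U' (el (s1 ''qc'' i')) = candidates s1 a ?p x U' (el (s1 ''qc'' i'))"
          using other[OF i' neq] by (auto simp: cand)
        then show ?thesis using best[OF i'] neq by (simp add: best_among_def q)
      qed
      show ?thesis
      proof (cases "s ''qw'' i < s ''qw'' ?p")
        case True
        then show ?thesis using False t sm2 prs' idx W_gt old i(1,2) upd by (simp add: eq pr' sl)
      next
        case ge: False
        then show ?thesis using False t sm2 prs' idx W_gt old i(1,2) upd by (simp add: eq pr' sl)
      qed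
    qed
  qed
  have pW: "?p < W" using p T W by simp
  show ?case
    by (rule wp_Write_Seq[where s' = "s(''p'' := (s ''p'')(0 := ?p))"],
        use pW W_gt in \<open>simp_all add: eqs k del: wp_Seq\<close>,
        rule wp_Write_Seq[where s' = ?s1, OF _ _ _ wp_conseq[OF H2]])
      (use pW W_gt in \<open>auto simp: eqs k best_among_def\<close>)
next
  case (6 t s)
  have "a < b" using pr by (rule problem_nonempty)
  then show ?case using 6 by (simp add: algebra_simps)
qed (use T W in auto)

end

section \<open>Correctness of the children and of the branching answer\<close>

context wopp
begin

text \<open>A clique \<open>y\<close> that avoids \<open>R\<close> and \<open>x\<close> has a trace
  on \<open>U\<close>, which is an entry of the parent; this entry is a candidate for the slot of
  the trace of \<open>y\<close> on the child, and its weight is at least that of \<open>y\<close>.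
  Conversely the representative of a winning candidate avoids \<open>x\<close>: as
  \<open>x \<in> U\<close>, it could contain \<open>x\<close> only inside its trace on
  \<open>U\<close>.\<close>

lemma child_problem:
  assumes pr: "problem s1 U R a b" and g: "grouped s1 s x T T' \<iota> (members s1 a b e x)"
    and x: "x \<in> U" "x \<notin> e" "{x} \<in> K" and bT: "b \<le> T"
    and s': "s' ''qc'' = s ''qc''" "s' ''qo'' = s ''qo''"
    and q: "s ''qw'' = s1 ''qw''" "s ''qr'' = s1 ''qr''"
    and best: "\<And>i. T \<le> i \<Longrightarrow> i < T' \<Longrightarrow>
      best_among s s' i (candidates s a b x (child_set U e x) (el (s ''qc'' i)))"
  shows "problem s' (child_set U e x) (insert x R) T T'"
proof -
  let ?U = "child_set U e x"
  note gc = grouped_child[OF g pr x]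
  note N = members_child[OF pr groupedD(4)[OF g]]
  have UU: "?U \<subseteq> U" "x \<notin> ?U" by (auto simp: child_set_def)
  have qc: "s ''qc'' i = s1 ''qc'' i" if "i < b" for i
    using g that bT by (simp add: grouped_def)
  have lt: "s ''qc'' i < n" "el (s ''qc'' i) \<subseteq> ?U" if "T \<le> i" "i < T'" for i
    using bij_betwE[OF gc(1)] that by auto
  have entry: "s' ''qo'' i < n \<and> el (s' ''qo'' i) = el (s' ''qc'' i) \<union> insert x R \<and>
        s' ''qr'' i < n \<and> el (s' ''qr'' i) \<inter> insert x R = {} \<and> el (s' ''qr'' i) \<inter> ?U = el (s' ''qc'' i) \<and>
        s' ''qw'' i = w (s' ''qr'' i) \<and>
        (\<forall>y<n. el y \<inter> insert x R = {} \<longrightarrow> el y \<inter> ?U = el (s' ''qc'' i) \<longrightarrow> w y \<le> s' ''qw'' i)"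
    if i: "T \<le> i" "i < T'" for i
  proof -
    let ?C = "candidates s a b x ?U (el (s ''qc'' i))"
    have qo: "s' ''qo'' i = s1 ''qo'' (\<iota> i)" unfolding s' by (rule groupedD(1)[OF g i])
    note o = problemD(5)[OF pr N(1,2)[OF i]]
    have "el (s ''qc'' i) \<union> insert x R = el (s1 ''qc'' (\<iota> i)) \<union> R"
      unfolding gc(2)[OF i] using N(3)[OF i] by blast
    then have 1: "s' ''qo'' i < n" "el (s' ''qo'' i) = el (s' ''qc'' i) \<union> insert x R"
      unfolding qo s'(1) using o by simp_all
    have max: "w y \<le> s' ''qw'' i" and cand: "?C \<noteq> {}"
      if y: "y < n" "el y \<inter> insert x R = {}" "el y \<inter> ?U = el (s ''qc'' i)" for y
    proof -
      have k: "el y \<inter> U \<in> K" by (rule K_down[OF el_K[OF y(1)]]) blast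
      then obtain j where j: "a \<le> j" "j < b" "s1 ''qc'' j = ver (el y \<inter> U)"
        using problemD(8)[OF pr k] by auto
      then have elj: "el (s1 ''qc'' j) = el y \<inter> U" using k by simp
      have "x \<notin> el y" using y(2) by blast
      moreover have "el y \<inter> U \<inter> ?U = el y \<inter> ?U" using UU by blast
      ultimately have jc: "j \<in> ?C" using j elj y(3) qc[OF j(2)] by (simp add: candidates_def)
      then show "?C \<noteq> {}" by blast
      have "w y \<le> s1 ''qw'' j" using problemD(7)[OF pr j(1,2) y(1)] y(2) elj by auto
      also have "\<dots> \<le> s' ''qw'' i" using best[OF i] jc unfolding best_among_def q by blast
      finally show "w y \<le> s' ''qw'' i" .
    qed
    have "el (s ''qc'' i) \<inter> insert x R = {}" "el (s ''qc'' i) \<inter> ?U = el (s ''qc'' i)"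
      using lt(2)[OF i] UU problemD(2)[OF pr] by blast+
    \<comment> \<open>The clique in the slot competes for itself, so the slot cannot have kept the
      default weight 0.\<close>
    then have "0 < s' ''qw'' i" using max[OF lt(1)[OF i]] w_pos[OF lt(1)[OF i]] by simp
    then obtain j where j: "j \<in> ?C" "s' ''qr'' i = s1 ''qr'' j" "s' ''qw'' i = s1 ''qw'' j"
      using best[OF i] unfolding best_among_def q by auto
    then have jb: "a \<le> j" "j < b" "x \<notin> el (s1 ''qc'' j)" "el (s1 ''qc'' j) \<inter> ?U = el (s ''qc'' i)"
      using qc[of j] by (auto simp: candidates_def)
    note r = problemD(6)[OF pr jb(1,2)]
    have "x \<notin> el (s1 ''qr'' j)" using r jb(3) x(1) by blast
    moreover have "el (s1 ''qr'' j) \<inter> ?U = el (s ''qc'' i)" using r jb(4) UU by blast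
    ultimately show ?thesis using 1 r max unfolding j(2,3) s' by blast
  qed
  have A: "insert x R \<inter> ?U = {}" using UU problemD(2)[OF pr] by blast
  have B: "bij_betw (s' ''qc'') {T..<T'} {v. v < n \<and> el v \<subseteq> ?U}" unfolding s' by (rule gc(1))
  have C: "\<forall>i\<in>{T..<T'}. \<forall>j\<in>{T..<T'}. el (s' ''qc'' i) \<subset> el (s' ''qc'' j) \<longrightarrow> i < j"
    unfolding s' using gc(3) by simp
  show ?thesis
    unfolding problem_def by (intro conjI A B C) (rule ballI, rule entry, simp_all)
qed

text \<open>A wanted clique is its entry together with \<open>R\<close>, and \<open>qr\<close>
  avoids \<open>R\<close>, so they can only meet inside \<open>U\<close>, that is, within the two
  entries. Any \<open>y\<close> disjoint from the wanted clique avoids \<open>R\<close> too; its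
  trace on \<open>U\<close> is an entry at least as heavy as \<open>y\<close>, and entry
  \<open>j\<close> beats all entries.\<close>

lemma optimal_opposite:
  assumes pr: "problem s U R a b" and j: "a \<le> j" "j < b" and i: "a \<le> i" "i < b"
    and best: "\<And>i. a \<le> i \<Longrightarrow> i < b \<Longrightarrow> s ''qw'' i \<le> s ''qw'' j"
    and disj: "el (s ''qc'' i) \<inter> el (s ''qc'' j) = {}"
  shows "el (s ''qo'' i) \<inter> el (s ''qr'' j) = {}"
    "y < n \<Longrightarrow> el (s ''qo'' i) \<inter> el y = {} \<Longrightarrow> w y \<le> w (s ''qr'' j)"
proof -
  note J = problemD(6)[OF pr j] and I = problemD(5)[OF pr i] and U = problemD(4)[OF pr i]
  show "el (s ''qo'' i) \<inter> el (s ''qr'' j) = {}" using I J U disj by blast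
  show "w y \<le> w (s ''qr'' j)" if y: "y < n" "el (s ''qo'' i) \<inter> el y = {}"
  proof -
    have k: "el y \<inter> U \<in> K" by (rule K_down[OF el_K[OF y(1)]]) blast
    then obtain l where l: "a \<le> l" "l < b" "s ''qc'' l = ver (el y \<inter> U)"
      using problemD(8)[OF pr k] by auto
    have "w y \<le> s ''qw'' l"
      using problemD(7)[OF pr l(1,2) y(1)] I y(2) l(3) k by auto
    then show ?thesis using best[OF l(1,2)] J by simp
  qed
qed

definition hit :: "memory \<Rightarrow> nat \<Rightarrow> nat \<Rightarrow> nat set \<Rightarrow> nat set" where
  "hit s a b e = {i \<in> {a..<b}. el (s ''qc'' i) \<inter> e \<noteq> {}}"

text \<open>The state after the children for the elements in \<open>e\<close> have been appended to the queue.\<close>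

definition children :: "memory \<Rightarrow> nat \<Rightarrow> nat \<Rightarrow> nat set \<Rightarrow> memory \<Rightarrow> bool" where
  "children s0 a b e s \<longleftrightarrow> (let T0 = s0 ''tl'' 0; N0 = s0 ''np'' 0; T = s ''tl'' 0; N = s ''np'' 0 in
     N0 \<le> N \<and> N \<le> T \<and> T = T0 + card (hit s0 a b e) \<and> s ''qs'' N = T \<and>
     (\<forall>i\<le>N0. s ''qs'' i = s0 ''qs'' i) \<and>
     (\<forall>i. N0 \<le> i \<longrightarrow> i < N \<longrightarrow> s ''qs'' i < s ''qs'' (i + 1) \<and> s ''qs'' (i + 1) \<le> T \<and>
        (\<exists>U R. problem s U R (s ''qs'' i) (s ''qs'' (i + 1)))) \<and>
     (\<forall>i<T0. s ''qo'' i = s0 ''qo'' i \<and> s ''qc'' i = s0 ''qc'' i \<and>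
        s ''qr'' i = s0 ''qr'' i \<and> s ''qw'' i = s0 ''qw'' i) \<and>
     (\<forall>i\<ge>T. s ''qw'' i = 0) \<and> (\<forall>v<n. s ''st'' v < N) \<and>
     (\<forall>i. s ''tk'' i = (if i \<in> hit s0 a b e then 1 else s0 ''tk'' i)) \<and>
     (\<Sum>i\<in>{T0..<T}. lv (s ''qc'' i) + 1) = (\<Sum>i\<in>hit s0 a b e. lv (s0 ''qc'' i)) \<and>
     (\<forall>i\<in>hit s0 a b e. \<exists>i'. T0 \<le> i' \<and> i' < T \<and> s ''qo'' i' = s0 ''qo'' i))"

definition child_vars :: "string set" where
  "child_vars = {''t'', ''x'', ''j'', ''p'', ''c'', ''g'', ''tk'', ''d'', ''qo'', ''qc'', ''st'', ''sl'',
     ''tl'', ''q'', ''pr'', ''qw'', ''qr'', ''np'', ''qs''}"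

lemma hit_insert:
  "x \<notin> e \<Longrightarrow> hit s a b (insert x e) = hit s a b e \<union> members s a b e x"
  "hit s a b e \<inter> members s a b e x = {}"
  "finite (hit s a b e)" "finite (members s a b e x)"
  by (auto simp: hit_def members_def)

lemma card_hit_le: "card (hit s a b e) \<le> b - a"
proof -
  have "hit s a b e \<subseteq> {a..<b}" by (auto simp: hit_def)
  from card_mono[OF _ this] show ?thesis by simp
qed

text \<open>Entries claimed for different elements are disjoint, so all children together have at
  most \<open>b - a\<close> slots, which keeps the queue within its bound. Each new slot has one
  element less than its parent; this gives the equation of sums in \<open>children\<close>, from
  which the drop of the potential is derived.\<close>

lemma child_step:
  assumes st: "static s0" and pr: "problem s0 U R a b" and bT: "b \<le> s0 ''tl'' 0"
    and tk0: "\<And>i. a \<le> i \<Longrightarrow> s0 ''tk'' i = 0" and bound: "s0 ''tl'' 0 + (b - a) \<le> n * n + 2 * n"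
    and v: "s0 ''h'' 0 = a" "s0 ''len'' 0 = b - a"
    and sm: "same child_vars s0 s" and ch: "children s0 a b e s"
    and x: "x \<in> U" "x \<notin> e" "{x} \<in> K" "s ''x'' 0 = x"
  shows "wp W (group_loop ;; project_loop ;; ''np'' ::= Plus (V ''np'') (Const 1) ;;
        Write ''qs'' (V ''np'') (V ''tl''))
    (\<lambda>t s'. t \<le> (b - a) * (D * 60 + 250) + 80 \<and> s' ''t'' 0 = s ''t'' 0 \<and>
      same child_vars s0 s' \<and> children s0 a b (insert x e) s') s"
proof -
  define T0 N0 T N where defs: "T0 = s0 ''tl'' 0" "N0 = s0 ''np'' 0" "T = s ''tl'' 0" "N = s ''np'' 0"
  let ?U = "child_set U e x"
  have c: "N0 \<le> N" "N \<le> T" "T = T0 + card (hit s0 a b e)" "s ''qs'' N = T"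
     "\<And>i. i \<le> N0 \<Longrightarrow> s ''qs'' i = s0 ''qs'' i"
     "\<And>i. N0 \<le> i \<Longrightarrow> i < N \<Longrightarrow> s ''qs'' i < s ''qs'' (i + 1) \<and> s ''qs'' (i + 1) \<le> T \<and>
        (\<exists>U R. problem s U R (s ''qs'' i) (s ''qs'' (i + 1)))"
     "\<And>i. i < T0 \<Longrightarrow> s ''qo'' i = s0 ''qo'' i \<and> s ''qc'' i = s0 ''qc'' i \<and>
        s ''qr'' i = s0 ''qr'' i \<and> s ''qw'' i = s0 ''qw'' i"
     "\<And>i. T \<le> i \<Longrightarrow> s ''qw'' i = 0" "\<And>v. v < n \<Longrightarrow> s ''st'' v < N"
     "\<And>i. s ''tk'' i = (if i \<in> hit s0 a b e then 1 else s0 ''tk'' i)"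
     "(\<Sum>i\<in>{T0..<T}. lv (s ''qc'' i) + 1) = (\<Sum>i\<in>hit s0 a b e. lv (s0 ''qc'' i))"
     "\<And>i. i \<in> hit s0 a b e \<Longrightarrow> \<exists>i'. T0 \<le> i' \<and> i' < T \<and> s ''qo'' i' = s0 ''qo'' i"
    using ch unfolding children_def Let_def defs[symmetric] by blast+
  have TT: "T0 \<le> T" "b \<le> T" using c(3) bT defs by simp_all
  have xn: "x < n" using sing ver_in[OF x(3)] el_ver[OF x(3)] by (metis singletonI)
  have st1: "static s" by (rule static_cong[OF st]) (use sm in \<open>simp_all add: same_def child_vars_def\<close>)
  have pr1: "problem s U R a b" by (rule problem_cong[OF pr]) (use c(7) bT defs in auto)
  have qc0: "s ''qc'' i = s0 ''qc'' i" if "i < b" for i using c(7) that bT defs by simp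
  have mem: "members s a b e x = members s0 a b e x" using qc0 by (auto simp: members_def)
  let ?N = "members s0 a b e x"
  have card: "card (hit s0 a b (insert x e)) = card (hit s0 a b e) + card ?N"
    using hit_insert(2-4) unfolding hit_insert(1)[OF x(2)] by (intro card_Un_disjoint) auto
  have bnd: "T + card (members s a b e x) \<le> n * n + 2 * n"
    using card card_hit_le[of s0 a b "insert x e"] c(3) bound mem defs by simp
  have h: "s ''h'' 0 = a" "s ''len'' 0 = b - a" using sm v by (simp_all add: same_def child_vars_def)
  have tk: "s ''tk'' i = (if el (s ''qc'' i) \<inter> e = {} then 0 else 1)" if "i \<in> {a..<b}" for i
    using that tk0 qc0 by (auto simp: c(10) hit_def)
  note gl = wp_group_loop[OF st1 pr1 h x(4) defs(3)[symmetric] xn x(2) TT(2) bnd tk]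
  show ?thesis
    unfolding wp_Seq
  proof (rule wp_conseq[OF gl], assumption, goal_cases)
    case (1 t2 s2)
    then obtain \<iota> where t2: "t2 \<le> (b - a) * 110 + 30"
      and sm2: "same {''j'', ''p'', ''c'', ''g'', ''tk'', ''d'', ''qo'', ''qc'', ''st'', ''sl'', ''tl''} s s2"
      and g0: "grouped s s2 x T (s2 ''tl'' 0) \<iota> (members s a b e x)" by blast
    define T' where "T' = s2 ''tl'' 0"
    note g = g0[folded T'_def]
    have T': "T \<le> T'" "T' = T + card ?N"
      using g bij_betw_same_card[of \<iota> "{T..<T'}"] unfolding grouped_def mem by force+
    note gc = grouped_child[OF g pr1 x(1-3)]
    have eq2: "s2 ''np'' 0 = N" "s2 ''qw'' = s ''qw''" "s2 ''qr'' = s ''qr''" "s2 ''qs'' = s ''qs''"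
      "s2 ''h'' 0 = a" "s2 ''len'' 0 = b - a" "s2 ''x'' 0 = x"
      using sm2 h x(4) defs by (simp_all add: same_def)
    have st2: "static s2" by (rule static_cong[OF st1]) (use sm2 in \<open>simp_all add: same_def\<close>)
    have old2: "s2 ''qo'' i = s ''qo'' i" "s2 ''qc'' i = s ''qc'' i" if "i < T" for i
      using g that by (simp_all add: grouped_def)
    have pr2: "problem s2 U R a b" by (rule problem_cong[OF pr1]) (use TT old2 eq2 in auto)
    have img: "s2 ''qc'' ` {T..<T'} = {v. v < n \<and> el v \<subseteq> ?U}" using gc(1) by (simp add: bij_betw_def)
    have st2v: "s2 ''st'' v = (if el v \<subseteq> ?U then N else s ''st'' v)" if "v < n" for v
    proof -
      have "s2 ''st'' v = (if v \<in> s2 ''qc'' ` {T..<T'} then N else s ''st'' v)"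
        using g unfolding grouped_def defs by blast
      then show ?thesis unfolding img using that by simp
    qed
    have ready: "child_ready s2 ?U T T'"
      unfolding child_ready_def
    proof (intro conjI)
      show "bij_betw (s2 ''qc'') {T..<T'} {v. v < n \<and> el v \<subseteq> ?U}" by (rule gc(1))
      show "\<forall>i\<in>{T..<T'}. s2 ''sl'' (s2 ''qc'' i) = i" using groupedD(3)[OF g] by simp
      \<comment> \<open>All older stamps are below \<open>N\<close>, so equality with
        \<open>N\<close> singles out the cliques just stamped.\<close>
      show "\<forall>v<n. s2 ''st'' v = s2 ''np'' 0 \<longleftrightarrow> el v \<subseteq> ?U"
      proof (intro allI impI)
        fix v assume v: "v < n"
        show "s2 ''st'' v = s2 ''np'' 0 \<longleftrightarrow> el v \<subseteq> ?U"
          using c(9)[OF v] st2v[OF v] eq2(1) by (cases "el v \<subseteq> ?U") auto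
      qed
      show "\<forall>i\<ge>T. s2 ''qw'' i = 0" using c(8) eq2 by simp
    qed
    have bb: "b \<le> n * n + 2 * n" using TT(2) bnd by simp
    note pl = wp_project_loop[OF st2 pr2 eq2(5-7) xn TT(2) bb ready]
    show ?case
    proof (rule wp_conseq[OF pl], goal_cases)
      case (1 t3 s3)
      then have t3: "t3 \<le> (b - a) * (D * 60 + 140) + 30"
        and sm3: "same {''j'', ''p'', ''c'', ''q'', ''d'', ''pr'', ''qw'', ''qr''} s2 s3"
        and old3: "\<And>i. i < T \<or> T' \<le> i \<Longrightarrow> s3 ''qw'' i = s ''qw'' i \<and> s3 ''qr'' i = s ''qr'' i"
        and best: "\<And>i. T \<le> i \<Longrightarrow> i < T' \<Longrightarrow>
          best_among s2 s3 i (candidates s2 a b x ?U (el (s2 ''qc'' i)))"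
        unfolding eq2 by auto
      have eq3: "s3 ''np'' 0 = N" "s3 ''tl'' 0 = T'" "s3 ''qs'' = s ''qs''" "s3 ''qc'' = s2 ''qc''"
        "s3 ''qo'' = s2 ''qo''" "s3 ''st'' = s2 ''st''" "s3 ''tk'' = s2 ''tk''" "s3 ''t'' = s ''t''"
        using sm3 sm2 eq2 by (simp_all add: same_def T'_def)
      have pr3: "problem s3 ?U (insert x R) T T'"
        by (rule child_problem[OF pr1 g x(1-3) TT(2) eq3(4,5) eq2(2,3) best])
      have TT': "T < T'" by (rule problem_nonempty[OF pr3])
      let ?s = "s3(''np'' := (s3 ''np'')(0 := Suc N), ''qs'' := (s ''qs'')(Suc N := T'))"
      have "same child_vars s0 ?s"
        using sm sm2 sm3 by (simp add: same_def child_vars_def)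
      moreover have "children s0 a b (insert x e) ?s"
        unfolding children_def Let_def defs(1,2)[symmetric]
      proof (intro conjI allI impI ballI, goal_cases)
        case (6 i)
        show ?case
        proof (cases "i = N")
          case True
          then show ?thesis using TT' c(4) by simp
        next
          case False
          then show ?thesis using 6 c(6)[of i] by simp
        qed
      next
        case (7 i)
        show ?case
        proof (cases "i = N")
          case True
          then show ?thesis by (simp add: eq3)
        next
          case False
          then show ?thesis using 7 c(6)[of i] T' by (simp add: eq3)
        qed
      next
        case (8 i)
        show ?case
        proof (cases "i = N")
          case True
          have "problem ?s ?U (insert x R) T T'" by (rule problem_cong[OF pr3]) simp
          then show ?thesis using True c(4) by auto
        next
          case False
          then have i: "N0 \<le> i" "i < N" using 8 by simp_all
          then obtain U' R' where p: "problem s U' R' (s ''qs'' i) (s ''qs'' (i + 1))"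
            "s ''qs'' (i + 1) \<le> T" using c(6) by blast
          have "problem ?s U' R' (s ''qs'' i) (s ''qs'' (i + 1))"
            by (rule problem_cong[OF p(1)]) (use p(2) old2 old3 eq3 in auto)
          then show ?thesis using i by auto
        qed
      next
        \<comment> \<open>The new slots are reindexed along \<open>\<iota>\<close> by their parents,
          and these are exactly what \<open>hit\<close> gains when \<open>x\<close> joins
          \<open>e\<close>.\<close>
        case 16
        have "(\<Sum>i\<in>{T0..<T'}. lv (s2 ''qc'' i) + 1) =
            (\<Sum>i\<in>{T0..<T}. lv (s2 ''qc'' i) + 1) + (\<Sum>i\<in>{T..<T'}. lv (s2 ''qc'' i) + 1)"
          using TT(1) T'(1) by (simp add: sum.atLeastLessThan_concat)
        also have "(\<Sum>i\<in>{T0..<T}. lv (s2 ''qc'' i) + 1) = (\<Sum>i\<in>{T0..<T}. lv (s ''qc'' i) + 1)"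
          by (rule sum.cong) (auto simp: old2)
        also have "(\<Sum>i\<in>{T..<T'}. lv (s2 ''qc'' i) + 1) = (\<Sum>i\<in>{T..<T'}. lv (s ''qc'' (\<iota> i)))"
        proof (rule sum.cong)
          fix i assume "i \<in> {T..<T'}"
          then have i: "T \<le> i" "i < T'" by simp_all
          note N = members_child[OF pr1 groupedD(4)[OF g i]]
          show "lv (s2 ''qc'' i) + 1 = lv (s ''qc'' (\<iota> i))"
            unfolding gc(2)[OF i] using card_Suc_Diff1[OF finite_el[OF N(4)] N(3)] by simp
        qed simp
        also have "\<dots> = (\<Sum>i\<in>?N. lv (s ''qc'' i))"
          using g unfolding mem grouped_def by (intro sum.reindex_bij_betw) blast
        also have "\<dots> = (\<Sum>i\<in>?N. lv (s0 ''qc'' i))"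
          by (rule sum.cong) (auto simp: qc0 members_def)
        also have "(\<Sum>i\<in>{T0..<T}. lv (s ''qc'' i) + 1) + \<dots> = (\<Sum>i\<in>hit s0 a b (insert x e). lv (s0 ''qc'' i))"
          unfolding c(11) hit_insert(1)[OF x(2)]
          by (rule sum.union_disjoint[symmetric]) (use hit_insert(2-4) in auto)
        finally show ?case by (simp add: eq3)
      next
        case (17 i)
        then consider "i \<in> hit s0 a b e" | "i \<in> ?N" using hit_insert(1)[OF x(2)] by blast
        then show ?case
        proof cases
          case 1
          then obtain i' where "T0 \<le> i'" "i' < T" "s ''qo'' i' = s0 ''qo'' i" using c(12) by blast
          then show ?thesis using T' old2 by (intro exI[of _ i']) (simp add: eq3)
        next
          case 2
          then have "i \<in> \<iota> ` {T..<T'}" using g unfolding grouped_def mem bij_betw_def by blast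
          then obtain i' where i': "T \<le> i'" "i' < T'" "\<iota> i' = i" by auto
          have "i < b" using 2 by (auto simp: members_def)
          then have "s ''qo'' i = s0 ''qo'' i" using c(7) bT defs by simp
          then show ?thesis using i' TT groupedD(1)[OF g i'(1,2)] by (intro exI[of _ i']) (simp add: eq3)
        qed
      qed (use c T' TT' TT card old2 old3 eq3 st2v g mem hit_insert(1)[OF x(2)] in
          \<open>auto simp: grouped_def less_Suc_eq\<close>)
      moreover have "t2 + (t3 + 20) \<le> (b - a) * (D * 60 + 250) + 80"
        using t2 t3 by (simp add: algebra_simps)
      moreover have "N + 1 < W" "N < W" using c(2) T' bnd W mem by simp_all
      ultimately show ?case using W_gt by (simp add: eq3)
    qed
  qed
qed

end

section \<open>Processing one subproblem of the queue\<close>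

context wopp
begin

lemma children_cong:
  assumes "children s0 a b e s"
    and "\<And>x. x \<in> {''tl'', ''np'', ''qs'', ''qo'', ''qc'', ''qr'', ''qw'', ''st'', ''tk''} \<Longrightarrow> s' x = s x"
  shows "children s0 a b e s'"
proof -
  have eqs: "s' ''tl'' = s ''tl''" "s' ''np'' = s ''np''" "s' ''qs'' = s ''qs''" "s' ''qo'' = s ''qo''"
    "s' ''qc'' = s ''qc''" "s' ''qr'' = s ''qr''" "s' ''qw'' = s ''qw''" "s' ''st'' = s ''st''" "s' ''tk'' = s ''tk''"
    using assms(2) by simp_all
  show ?thesis using assms(1) unfolding children_def problem_def eqs .
qed

lemma wp_child_loop:
  assumes st: "static s0" and pr: "problem s0 U R a b" and bT: "b \<le> s0 ''tl'' 0"
    and tk0: "\<And>i. a \<le> i \<Longrightarrow> s0 ''tk'' i = 0" and bound: "s0 ''tl'' 0 + (b - a) \<le> n * n + 2 * n"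
    and v: "s0 ''h'' 0 = a" "s0 ''len'' 0 = b - a" "s0 ''z'' 0 = z" and z: "z < n" "el z \<subseteq> U"
    and ch: "children s0 a b {} s0"
  shows "wp W child_loop (\<lambda>t s. t \<le> D * ((b - a) * (D * 60 + 250) + 130) + 30 \<and>
    same child_vars s0 s \<and> children s0 a b (el z) s) s0"
proof -
  let ?e = "\<lambda>t. s0 ''el'' (z * n + t)"
  let ?step = "group_loop ;; project_loop ;; ''np'' ::= Plus (V ''np'') (Const 1) ;;
        Write ''qs'' (V ''np'') (V ''tl'')"
  have bij: "bij_betw ?e {..<lv z} (el z)" by (rule staticD(3)[OF st z(1)])
  show ?thesis
    unfolding child_loop_def
  proof (rule wp_For[where h = "lv z" and B = "(b - a) * (D * 60 + 250) + 100" and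
      I = "\<lambda>k s. same child_vars s0 s \<and> children s0 a b (?e ` {..<k}) s"], goal_cases)
    case 1
    have "children s0 a b {} (s0(''t'' := (s0 ''t'')(0 := 0)))" by (rule children_cong[OF ch]) auto
    then show ?case by (simp add: child_vars_def)
  next
    case (2 k s)
    then show ?case using v staticD(2)[OF st z(1)] W_gt by (simp add: same_def child_vars_def)
  next
    case (5 k s)
    have k: "s ''t'' 0 = k" "k < lv z" "k < n" and sm: "same child_vars s0 s"
      and c: "children s0 a b (?e ` {..<k}) s" using 5 lv_le_n[OF z(1)] by simp_all
    let ?x = "?e k"
    let ?s1 = "s(''x'' := (s ''x'')(0 := ?x))"
    have x: "?x \<in> el z" using bij_betwE[OF bij] k by simp
    have xe: "?x \<notin> ?e ` {..<k}"
    proof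
      assume "?x \<in> ?e ` {..<k}"
      then obtain k' where k': "k' < k" "?e k = ?e k'" by auto
      have "inj_on ?e {..<lv z}" using bij by (simp add: bij_betw_def)
      from inj_onD[OF this k'(2)] k' k(2) show False by simp
    qed
    have eq: "s ''z'' 0 = z" "s ''b'' z = z * n" "s ''el'' = s0 ''el''"
      using sm v staticD(1)[OF st z(1)] by (simp_all add: same_def child_vars_def)
    have H: "wp W ?step (\<lambda>t s'. t \<le> (b - a) * (D * 60 + 250) + 80 \<and> s' ''t'' 0 = ?s1 ''t'' 0 \<and>
      same child_vars s0 s' \<and> children s0 a b (insert ?x (?e ` {..<k})) s') ?s1"
    proof (rule child_step[OF st pr bT tk0 bound v(1,2)])
      show "same child_vars s0 ?s1" using sm by (simp add: child_vars_def)
      show "children s0 a b (?e ` {..<k}) ?s1" by (rule children_cong[OF c]) auto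
      show "{?x} \<in> K" by (rule in_K_single[OF el_K[OF z(1)] x])
    qed (use x z xe in auto)
    show ?case
    proof (rule wp_Write_Seq[where s' = ?s1, OF _ _ _ wp_conseq[OF H]], goal_cases)
      case 1
      then show ?case using W_gt by simp
    next
      case 2
      then show ?case using idx_less[OF z(1) k(3)] W_gt k by (simp add: eq)
    next
      case 3
      then show ?case by (simp add: eq k)
    next
      case (4 t s')
      have "?e ` {..<Suc k} = insert ?x (?e ` {..<k})" by (simp add: lessThan_Suc)
      moreover have "children s0 a b (insert ?x (?e ` {..<k})) (s'(''t'' := (s' ''t'')(0 := Suc k)))"
        by (rule children_cong[where s = s']) (use 4 in auto)
      ultimately show ?case using 4 k by (simp add: child_vars_def)
    qed
  next
    case (6 t s)
    have "?e ` {..<lv z} = el z" using bij by (simp add: bij_betw_def)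
    moreover have "t \<le> lv z * ((b - a) * (D * 60 + 250) + 115) + 15" using 6 by (simp add: algebra_simps)
    moreover have "\<dots> \<le> D * ((b - a) * (D * 60 + 250) + 130) + 30"
      using card_le_D[OF z(1)] by (intro add_mono mult_le_mono) auto
    ultimately show ?case using 6 by simp
  qed (use W_gt lv_le_n[OF z(1)] in auto)
qed

lemma vp_inj:
  assumes "static s" "u < n" "v < n"
  shows "s ''vp'' u = s ''vp'' v \<longleftrightarrow> u = v" "s ''vp'' u < n"
proof -
  have "\<exists>i<n. pv i = u" if "u < n" for u
    using pv_bij that unfolding bij_betw_def by (metis imageE lessThan_iff)
  then obtain i j where "i < n" "pv i = u" "j < n" "pv j = v" using assms by metis
  moreover then have "s ''vp'' u = i" "s ''vp'' v = j" using assms(1) unfolding static_def by blast+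
  ultimately show "s ''vp'' u = s ''vp'' v \<longleftrightarrow> u = v" "s ''vp'' u < n" by (metis, metis)
qed

lemma wp_best_loop:
  assumes "s0 ''h'' 0 = a" "s0 ''len'' 0 = b - a" "s0 ''bj'' 0 = a" "a < b" "b \<le> n * n + 2 * n"
  shows "wp W best_loop (\<lambda>t s. t \<le> (b - a) * 60 + 30 \<and> same {''j'', ''p'', ''bj''} s0 s \<and>
    a \<le> s ''bj'' 0 \<and> s ''bj'' 0 < b \<and>
    (\<forall>i\<in>{a..<b}. s0 ''qw'' i \<le> s0 ''qw'' (s ''bj'' 0))) s0"
  unfolding best_loop_def
proof (rule wp_For[where h = "b - a" and B = 45 and
    I = "\<lambda>k s. same {''j'', ''p'', ''bj''} s0 s \<and> a \<le> s ''bj'' 0 \<and> s ''bj'' 0 < b \<and>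
      (\<forall>i\<in>{a..<a + k}. s0 ''qw'' i \<le> s0 ''qw'' (s ''bj'' 0))"], goal_cases)
  case 1
  then show ?case using assms by simp
next
  case (2 k s)
  then show ?case using assms W_gt by (simp add: same_def)
next
  case (5 k s)
  have eq: "s ''qw'' = s0 ''qw''" "s ''h'' 0 = a" using 5 assms by (simp_all add: same_def)
  have kb: "a + k < b" "a + k < W" using 5 assms W by simp_all
  have j: "s ''j'' 0 = k" "same {''j'', ''p'', ''bj''} s0 s" "a \<le> s ''bj'' 0" "s ''bj'' 0 < b"
    and pre: "\<And>i. a \<le> i \<Longrightarrow> i < a + k \<Longrightarrow> s0 ''qw'' i \<le> s0 ''qw'' (s ''bj'' 0)" using 5 by simp_all
  have "s0 ''qw'' i \<le> s0 ''qw'' (a + k)"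
    if "s0 ''qw'' (s ''bj'' 0) < s0 ''qw'' (a + k)" "a \<le> i" "i < a + k" for i
    using pre[OF that(2,3)] that(1) by simp
  then show ?case using kb W_gt pre j(2-4) by (auto simp: eq j(1) less_Suc_eq)
next
  case (6 t s)
  then have t: "t \<le> (b - a) * 57 + 12" by simp
  have "(b - a) * 57 + 12 \<le> (b - a) * 60 + 30" by (intro add_mono mult_le_mono2) simp_all
  from le_trans[OF t this] show ?case using 6 assms(4) by auto
qed (use assms W in auto)

lemma wp_answer_loop:
  assumes st: "static s0" and pr: "problem s0 U R a b" and v: "s0 ''h'' 0 = a" "s0 ''len'' 0 = b - a"
    and b: "b \<le> n * n + 2 * n"
  shows "wp W answer_loop (\<lambda>t s. t \<le> (b - a) * 40 + 30 \<and> same {''j'', ''opp''} s0 s \<and>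
    (\<forall>i\<in>{a..<b}. s ''opp'' (s0 ''vp'' (s0 ''qo'' i)) = s0 ''y'' 0) \<and>
    (\<forall>X<n. X \<notin> s0 ''qo'' ` {a..<b} \<longrightarrow> s ''opp'' (s0 ''vp'' X) = s0 ''opp'' (s0 ''vp'' X))) s0"
  unfolding answer_loop_def
proof (rule wp_For[where h = "b - a" and B = 20 and
    I = "\<lambda>k s. same {''j'', ''opp''} s0 s \<and>
    (\<forall>i\<in>{a..<a + k}. s ''opp'' (s0 ''vp'' (s0 ''qo'' i)) = s0 ''y'' 0) \<and>
    (\<forall>X<n. X \<notin> s0 ''qo'' ` {a..<a + k} \<longrightarrow> s ''opp'' (s0 ''vp'' X) = s0 ''opp'' (s0 ''vp'' X))"], goal_cases)
  case 1
  then show ?case by simp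
next
  case (2 k s)
  then show ?case using v W_gt by (simp add: same_def)
next
  case (5 k s)
  have eq: "s ''qo'' = s0 ''qo''" "s ''vp'' = s0 ''vp''" "s ''h'' 0 = a" "s ''y'' 0 = s0 ''y'' 0" "s ''j'' 0 = k"
    using 5 v by (simp_all add: same_def)
  have k: "a \<le> a + k" "a + k < b" "a + k < W" using 5 b W by simp_all
  have q: "s0 ''qo'' (a + k) < n" using problemD(5)[OF pr k(1,2)] by simp
  let ?o = "(s ''opp'')(s0 ''vp'' (s0 ''qo'' (a + k)) := s0 ''y'' 0)"
  have iv: "{a..<Suc (a + k)} = insert (a + k) {a..<a + k}" by auto
  have 1: "\<forall>i\<in>{a..<Suc (a + k)}. ?o (s0 ''vp'' (s0 ''qo'' i)) = s0 ''y'' 0"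
    using 5 unfolding iv by simp
  have 2: "?o (s0 ''vp'' X) = s0 ''opp'' (s0 ''vp'' X)"
    if "X < n" "X \<notin> s0 ''qo'' ` {a..<Suc (a + k)}" for X
  proof -
    \<comment> \<open>\<open>vp\<close> is injective on the vertices, so writing one answer leaves
      the answers of other cliques alone.\<close>
    have "X \<noteq> s0 ''qo'' (a + k)" "X \<notin> s0 ''qo'' ` {a..<a + k}" using that(2) unfolding iv by auto
    then show ?thesis using 5 vp_inj(1)[OF st that(1) q] that(1) by simp
  qed
  have sm: "same {''j'', ''opp''} s0 s" using 5 by simp
  show ?case using 1 2 k W_gt sm by (simp add: eq)
next
  case (6 t s)
  have "a < b" using pr by (rule problem_nonempty)
  then show ?case using 6 by (simp add: algebra_simps)
qed (use b W in auto)

definition solved :: "memory \<Rightarrow> nat \<Rightarrow> bool" where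
  "solved s X \<longleftrightarrow> (\<exists>Y<n. el X \<inter> el Y = {} \<and> (\<forall>y<n. el X \<inter> el y = {} \<longrightarrow> w y \<le> w Y) \<and>
     s ''opp'' (s ''vp'' X) = s ''vp'' Y)"

text \<open>The potential. A waiting entry can take part in one problem now and in one more for
  every element it may still lose.\<close>

definition pending :: "memory \<Rightarrow> nat" where
  "pending s = (\<Sum>i\<in>{s ''qs'' (s ''k'' 0)..<s ''tl'' 0}. lv (s ''qc'' i) + 1)"

text \<open>The sum of \<open>T\<close> and \<open>pending\<close> never increases, because appended
  slots are paid for by the drop of the potential. Initially it is at most
  \<open>n + n * (D + 1)\<close>, and so it bounds the queue length for the word size. The last
  clause says that no vertex is lost: it has its final answer or is still wanted.\<close>

definition queue :: "memory \<Rightarrow> bool" where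
  "queue s \<longleftrightarrow> (let k = s ''k'' 0; N = s ''np'' 0; T = s ''tl'' 0 in
     k \<le> N \<and> 1 \<le> N \<and> N \<le> T \<and> s ''qs'' N = T \<and>
     (\<forall>i. k \<le> i \<longrightarrow> i < N \<longrightarrow> s ''qs'' i < s ''qs'' (i + 1) \<and> s ''qs'' (i + 1) \<le> T \<and>
        (\<exists>U R. problem s U R (s ''qs'' i) (s ''qs'' (i + 1)))) \<and>
     (\<forall>i\<ge>T. s ''qw'' i = 0) \<and> (\<forall>v<n. s ''st'' v < N) \<and>
     (\<forall>i\<ge>s ''qs'' k. s ''tk'' i = 0) \<and> T + pending s \<le> n * (D + 2) \<and>
     (\<forall>X<n. solved s X \<or> (\<exists>i. s ''qs'' k \<le> i \<and> i < T \<and> s ''qo'' i = X)))"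

definition step_vars :: "string set" where
  "step_vars = child_vars \<union> {''h'', ''len'', ''bj'', ''z'', ''y'', ''opp'', ''k''}"

text \<open>Every clique in the processed problem either is finished or loses an element, so the potential
  drops by the size of the problem.\<close>

lemma wp_problem_step:
  assumes st: "static s" and q: "queue s" and k: "s ''k'' 0 < s ''np'' 0"
  shows "wp W problem_step (\<lambda>t s'. same step_vars s s' \<and> queue s' \<and>
    pending s' * ((D + 1) * (D * 60 + 500) + 500) + t + 20 \<le> pending s * ((D + 1) * (D * 60 + 500) + 500)) s"
proof -
  define k0 N T where defs: "k0 = s ''k'' 0" "N = s ''np'' 0" "T = s ''tl'' 0"
  define a b where ab: "a = s ''qs'' k0" "b = s ''qs'' (k0 + 1)"
  have c: "k0 \<le> N" "1 \<le> N" "N \<le> T" "s ''qs'' N = T"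
     "\<And>i. k0 \<le> i \<Longrightarrow> i < N \<Longrightarrow> s ''qs'' i < s ''qs'' (i + 1) \<and> s ''qs'' (i + 1) \<le> T \<and>
        (\<exists>U R. problem s U R (s ''qs'' i) (s ''qs'' (i + 1)))"
     "\<And>i. T \<le> i \<Longrightarrow> s ''qw'' i = 0" "\<And>v. v < n \<Longrightarrow> s ''st'' v < N"
     "\<And>i. a \<le> i \<Longrightarrow> s ''tk'' i = 0" "T + pending s \<le> n * (D + 2)"
     "\<And>X. X < n \<Longrightarrow> solved s X \<or> (\<exists>i. a \<le> i \<and> i < T \<and> s ''qo'' i = X)"
    using q unfolding queue_def Let_def defs[symmetric] ab(1)[symmetric] by blast+
  have kN: "k0 < N" using k defs by simp
  obtain U R where pr: "problem s U R a b" and ltab: "a < b" "b \<le> T"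
    using c(5)[OF order_refl kN] ab by auto
  have pend: "pending s = (\<Sum>i\<in>{a..<b}. lv (s ''qc'' i) + 1) + (\<Sum>i\<in>{b..<T}. lv (s ''qc'' i) + 1)"
    unfolding pending_def defs[symmetric] ab(1)[symmetric]
    using ltab by (simp add: sum.atLeastLessThan_concat)
  have sumab: "(\<Sum>i\<in>{a..<b}. lv (s ''qc'' i) + 1) = (\<Sum>i\<in>{a..<b}. lv (s ''qc'' i)) + (b - a)"
    by (simp only: sum.distrib card_atLeastLessThan sum_constant mult_1_right of_nat_id)
  have Tn: "n * (D + 2) \<le> n * n + 2 * n" using D_le_n by (simp add: algebra_simps)
  have Tb: "T + (b - a) \<le> n * n + 2 * n" "b \<le> n * n + 2 * n" "T \<le> n * n + 2 * n"
  proof -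
    have "b - a \<le> pending s" unfolding pend sumab by simp
    then show "T + (b - a) \<le> n * n + 2 * n" "b \<le> n * n + 2 * n" "T \<le> n * n + 2 * n"
      using c(9) Tn ltab(2) by linarith+
  qed
  let ?s1 = "s(''h'' := (s ''h'')(0 := a), ''len'' := (s ''len'')(0 := b - a), ''bj'' := (s ''bj'')(0 := a))"
  let ?rest2 = "answer_loop ;; child_loop ;; ''k'' ::= Plus (V ''k'') (Const 1)"
  let ?rest1 = "''z'' ::= Read ''qc'' (V ''bj'') ;; ''y'' ::= Read ''vp'' (Read ''qr'' (V ''bj'')) ;; ?rest2"
  \<comment> \<open>The amount charged to each entry of the segment. Since the segment is not empty,
    it can absorb the constant overhead of the problem as well.\<close>
  define C where "C = (D + 1) * (D * 60 + 500) + 500"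
  have main: "wp W ?rest1 (\<lambda>t s'. same step_vars s s' \<and> queue s' \<and>
     t \<le> (b - a) * 40 + D * ((b - a) * (D * 60 + 250) + 130) + 150 \<and> pending s' + (b - a) \<le> pending s) s2"
    if sm: "same {''j'', ''p'', ''bj''} ?s1 s2" and bj: "a \<le> s2 ''bj'' 0" "s2 ''bj'' 0 < b"
      "\<And>i. a \<le> i \<Longrightarrow> i < b \<Longrightarrow> s ''qw'' i \<le> s ''qw'' (s2 ''bj'' 0)" for s2
  proof -
    define j where "j = s2 ''bj'' 0"
    let ?z = "s ''qc'' j" and ?y = "s ''vp'' (s ''qr'' j)"
    let ?s3 = "s2(''z'' := (s2 ''z'')(0 := ?z), ''y'' := (s2 ''y'')(0 := ?y))"
    have j: "a \<le> j" "j < b" using bj by (simp_all add: j_def)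
    have z: "?z < n" "el ?z \<subseteq> U" using problemD(4)[OF pr j] by simp_all
    have r: "s ''qr'' j < n" using problemD(6)[OF pr j] by simp
    have eq2: "s2 ''qc'' = s ''qc''" "s2 ''qr'' = s ''qr''" "s2 ''qo'' = s ''qo''" "s2 ''qw'' = s ''qw''"
      "s2 ''vp'' = s ''vp''" "s2 ''h'' 0 = a" "s2 ''len'' 0 = b - a" "s2 ''opp'' = s ''opp''" "s2 ''k'' 0 = k0"
      using sm defs by (simp_all add: same_def)
    have st3: "static ?s3" by (rule static_cong[OF st]) (use sm in \<open>simp_all add: same_def\<close>)
    have pr3: "problem ?s3 U R a b" by (rule problem_cong[OF pr]) (simp add: eq2)
    have "?s3 ''h'' 0 = a" "?s3 ''len'' 0 = b - a" using eq2 by simp_all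
    note al = wp_answer_loop[OF st3 pr3 this Tb(2)]
    have H: "wp W ?rest2 (\<lambda>t s'. same step_vars s s' \<and> queue s' \<and>
      t + 20 \<le> (b - a) * 40 + D * ((b - a) * (D * 60 + 250) + 130) + 150 \<and>
      pending s' + (b - a) \<le> pending s) ?s3"
      unfolding wp_Seq
    proof (rule wp_conseq[OF al], goal_cases)
      case (1 t4 s4)
      then have t4: "t4 \<le> (b - a) * 40 + 30" and sm4: "same {''j'', ''opp''} ?s3 s4"
        and ans: "\<And>i. a \<le> i \<Longrightarrow> i < b \<Longrightarrow> s4 ''opp'' (s ''vp'' (s ''qo'' i)) = ?y"
        and oth: "\<And>X. X < n \<Longrightarrow> X \<notin> s ''qo'' ` {a..<b} \<Longrightarrow> s4 ''opp'' (s ''vp'' X) = s ''opp'' (s ''vp'' X)"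
        by (blast, blast, simp_all add: eq2)
      have sm14: "same step_vars s s4"
        using sm sm4 by (simp add: same_def step_vars_def child_vars_def)
      have eq4: "s4 ''tl'' 0 = T" "s4 ''np'' 0 = N" "s4 ''h'' 0 = a" "s4 ''len'' 0 = b - a" "s4 ''z'' 0 = ?z"
        "s4 ''k'' 0 = k0" "s4 ''qs'' = s ''qs''" "s4 ''qc'' = s ''qc''" "s4 ''qo'' = s ''qo''"
        "s4 ''qw'' = s ''qw''" "s4 ''qr'' = s ''qr''" "s4 ''st'' = s ''st''" "s4 ''tk'' = s ''tk''"
        "s4 ''vp'' = s ''vp''"
        using sm sm4 eq2 defs by (simp_all add: same_def)
      have st4: "static s4" by (rule static_cong[OF st3]) (use sm4 in \<open>simp_all add: same_def\<close>)
      have pr4: "problem s4 U R a b" by (rule problem_cong[OF pr]) (simp add: eq4)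
      have ch: "children s4 a b {} s4"
        using c(3,4,6,7) by (simp add: children_def eq4 hit_def)
      have "b \<le> s4 ''tl'' 0" "\<And>i. a \<le> i \<Longrightarrow> s4 ''tk'' i = 0" "s4 ''tl'' 0 + (b - a) \<le> n * n + 2 * n"
        using ltab c(8) Tb by (simp_all add: eq4)
      note cl = wp_child_loop[OF st4 pr4 this eq4(3-5) z ch]
      show ?case
      proof (rule wp_conseq[OF cl], assumption, goal_cases)
        case (1 t5 s5)
        then have t5: "t5 \<le> D * ((b - a) * (D * 60 + 250) + 130) + 30"
          and sm5: "same child_vars s4 s5" and ch5: "children s4 a b (el ?z) s5" by blast+
        define N' T' where defs': "N' = s5 ''np'' 0" "T' = s5 ''tl'' 0"
        let ?G = "hit s a b (el ?z)"
        have hit: "hit s4 a b (el ?z) = ?G" by (simp add: hit_def eq4)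
        have d: "N \<le> N'" "N' \<le> T'" "T' = T + card ?G" "s5 ''qs'' N' = T'"
           "\<And>i. i \<le> N \<Longrightarrow> s5 ''qs'' i = s ''qs'' i"
           "\<And>i. N \<le> i \<Longrightarrow> i < N' \<Longrightarrow> s5 ''qs'' i < s5 ''qs'' (i + 1) \<and> s5 ''qs'' (i + 1) \<le> T' \<and>
              (\<exists>U R. problem s5 U R (s5 ''qs'' i) (s5 ''qs'' (i + 1)))"
           "\<And>i. i < T \<Longrightarrow> s5 ''qo'' i = s ''qo'' i \<and> s5 ''qc'' i = s ''qc'' i \<and>
              s5 ''qr'' i = s ''qr'' i \<and> s5 ''qw'' i = s ''qw'' i"
           "\<And>i. T' \<le> i \<Longrightarrow> s5 ''qw'' i = 0" "\<And>v. v < n \<Longrightarrow> s5 ''st'' v < N'"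
           "\<And>i. s5 ''tk'' i = (if i \<in> ?G then 1 else s ''tk'' i)"
           "(\<Sum>i\<in>{T..<T'}. lv (s5 ''qc'' i) + 1) = (\<Sum>i\<in>?G. lv (s ''qc'' i))"
           "\<And>i. i \<in> ?G \<Longrightarrow> \<exists>i'. T \<le> i' \<and> i' < T' \<and> s5 ''qo'' i' = s ''qo'' i"
          using ch5 unfolding children_def Let_def eq4 hit defs'[symmetric] by blast+
        let ?s6 = "s5(''k'' := (s5 ''k'')(0 := Suc k0))"
        have eq5: "s5 ''k'' 0 = k0" "s5 ''opp'' = s4 ''opp''" "s5 ''vp'' = s ''vp''"
          using sm5 eq4 by (simp_all add: same_def child_vars_def)
        have b5: "s5 ''qs'' (Suc k0) = b" using d(5)[of "Suc k0"] kN ab by simp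
        have sm6: "same step_vars s ?s6"
          using sm14 sm5 by (simp add: same_def step_vars_def)
        have "(\<Sum>i\<in>?G. lv (s ''qc'' i)) \<le> (\<Sum>i\<in>{a..<b}. lv (s ''qc'' i))"
          by (rule sum_mono2) (auto simp: hit_def)
        moreover have "pending ?s6 = (\<Sum>i\<in>{b..<T}. lv (s ''qc'' i) + 1) + (\<Sum>i\<in>?G. lv (s ''qc'' i))"
        proof -
          have "pending ?s6 = (\<Sum>i\<in>{b..<T'}. lv (s5 ''qc'' i) + 1)"
            by (simp add: pending_def b5 defs')
          also have "\<dots> = (\<Sum>i\<in>{b..<T}. lv (s5 ''qc'' i) + 1) + (\<Sum>i\<in>{T..<T'}. lv (s5 ''qc'' i) + 1)"
            using ltab d(3) by (simp add: sum.atLeastLessThan_concat)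
          also have "(\<Sum>i\<in>{b..<T}. lv (s5 ''qc'' i) + 1) = (\<Sum>i\<in>{b..<T}. lv (s ''qc'' i) + 1)"
            by (rule sum.cong) (use d(7) in auto)
          finally show ?thesis unfolding d(11) .
        qed
        ultimately have pend6: "pending ?s6 + (b - a) \<le> pending s" using pend sumab by simp
        have "queue ?s6"
          unfolding queue_def Let_def
        proof (intro conjI allI impI, goal_cases)
          case (5 i)
          then show ?case
            using c(5)[of i] d(5)[of i] d(5)[of "i + 1"] d(6)[of i] d(1) by (cases "i < N") (auto simp: defs')
        next
          case (6 i)
          then show ?case
            using c(5)[of i] d(5)[of "i + 1"] d(6)[of i] d(3) by (cases "i < N") (auto simp: defs')
        next
          case (7 i)
          then have i: "k0 \<le> i" "i < N'" by (simp_all add: defs')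
          have "\<exists>U R. problem s5 U R (s5 ''qs'' i) (s5 ''qs'' (i + 1))"
          proof (cases "i < N")
            case True
            then obtain U' R' where p: "problem s U' R' (s ''qs'' i) (s ''qs'' (i + 1))" "s ''qs'' (i + 1) \<le> T"
              using c(5) i by blast
            have "problem s5 U' R' (s ''qs'' i) (s ''qs'' (i + 1))"
              by (rule problem_cong[OF p(1)]) (use d(7) p(2) in auto)
            then show ?thesis using d(5)[of i] d(5)[of "i + 1"] True by auto
          next
            case False
            then show ?thesis using d(6) i by simp
          qed
          then obtain U' R' where p: "problem s5 U' R' (s5 ''qs'' i) (s5 ''qs'' (i + 1))" by blast
          have "problem ?s6 U' R' (s5 ''qs'' i) (s5 ''qs'' (i + 1))" by (rule problem_cong[OF p]) simp
          then show ?case by auto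
        next
          case (10 i)
          then have "b \<le> i" by (simp add: b5)
          then show ?case using d(10)[of i] c(8)[of i] ltab by (auto simp: hit_def)
        next
          case 11
          have "card ?G \<le> b - a" by (rule card_hit_le)
          then show ?case using pend6 c(9) d(3) by (simp add: defs'(2)[symmetric])
        next
          case (12 X)
          show ?case
          proof (cases "X \<in> s ''qo'' ` {a..<b}")
            case True
            then obtain i where i: "a \<le> i" "i < b" "X = s ''qo'' i" by auto
            show ?thesis
            proof (cases "el (s ''qc'' i) \<inter> el ?z = {}")
              case True
              \<comment> \<open>The branching clique is the heaviest entry and misses what is left
                of \<open>X\<close>, so the answer just written is final.\<close>
              note oo = optimal_opposite[OF pr j i(1,2) bj(3)[folded j_def] True]
              have "solved ?s6 X"
                unfolding solved_def i(3)
                by (rule exI[of _ "s ''qr'' j"]) (use r oo ans[OF i(1,2)] eq5 in auto)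
              then show ?thesis ..
            next
              case False
              \<comment> \<open>\<open>X\<close> meets the branching clique; the answer just written
                is tentative, and \<open>X\<close> is wanted again in a child.\<close>
              then have "i \<in> ?G" using i by (simp add: hit_def)
              then obtain i' where "T \<le> i'" "i' < T'" "s5 ''qo'' i' = X" using d(12) i by blast
              then show ?thesis using ltab by (intro disjI2 exI[of _ i']) (simp add: b5 defs')
            qed
          next
            case False
            consider "solved s X" | i where "a \<le> i" "i < T" "s ''qo'' i = X" using c(10)[OF 12] by blast
            then show ?thesis
            proof cases
              case 1
              then have "solved ?s6 X"
                unfolding solved_def using oth[OF 12 False] by (simp add: eq5)
              then show ?thesis ..
            next
              case 2
              then have "b \<le> i" using False by (metis atLeastLessThan_iff imageI not_le)
              then show ?thesis using 2 d(3,7) by (intro disjI2 exI[of _ i]) (simp add: b5 defs')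
            qed
          qed
        qed (use kN d c in \<open>simp_all add: defs'\<close>)
        moreover have "k0 + 1 < W" using kN c(3) Tb W by simp
        ultimately show ?case using t4 t5 sm6 pend6 W_gt by (simp add: eq5)
      qed
    qed
    show ?thesis
      by (rule wp_Write_Seq[where s' = "s2(''z'' := (s2 ''z'')(0 := ?z))"],
          use W_gt in simp, use W_gt in simp, simp add: eq2 j_def,
          rule wp_Write_Seq[where s' = ?s3, OF _ _ _ wp_conseq[OF H]])
        (use W_gt in \<open>auto simp: eq2 j_def\<close>)
  qed
  have bl: "wp W best_loop (\<lambda>t s2. t \<le> (b - a) * 60 + 30 \<and> same {''j'', ''p'', ''bj''} ?s1 s2 \<and>
    a \<le> s2 ''bj'' 0 \<and> s2 ''bj'' 0 < b \<and>
    (\<forall>i\<in>{a..<b}. ?s1 ''qw'' i \<le> ?s1 ''qw'' (s2 ''bj'' 0))) ?s1"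
    by (rule wp_best_loop) (use ltab Tb in simp_all)
  have fin: "wp W (best_loop ;; ?rest1) (\<lambda>t s'. same step_vars s s' \<and> queue s' \<and>
     t \<le> (b - a) * 100 + D * ((b - a) * (D * 60 + 250) + 130) + 180 \<and> pending s' + (b - a) \<le> pending s) ?s1"
    unfolding wp_Seq[of W best_loop]
    by (rule wp_conseq[OF bl], rule wp_conseq[OF main]) auto
  have cost: "(b - a) * 100 + D * ((b - a) * (D * 60 + 250) + 130) + 180 + 50 \<le> (b - a) * C"
  proof -
    obtain l where "b - a = Suc l" using ltab(1) by (metis Suc_diff_Suc)
    then show ?thesis unfolding C_def by (simp add: algebra_simps)
  qed
  have final: "wp W (best_loop ;; ?rest1) (\<lambda>t s'. same step_vars s s' \<and> queue s' \<and>
     pending s' * C + t + 50 \<le> pending s * C) ?s1"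
  proof (rule wp_conseq[OF fin], goal_cases)
    case (1 t s')
    then have p: "pending s' + (b - a) \<le> pending s" and t: "t + 50 \<le> (b - a) * C" using cost by simp_all
    have "pending s' * C + (b - a) * C \<le> pending s * C" using p by (metis add_mult_distrib mult_le_mono1)
    then show ?case using t 1 by simp
  qed
  have kW: "k0 + 1 < W" using kN c(3) Tb W by simp
  show ?thesis
    unfolding problem_step_def C_def[symmetric]
    apply (rule wp_Write_Seq[where s' = "s(''h'' := (s ''h'')(0 := a))"])
       apply (use W_gt in simp)
      apply (use W_gt in simp)
     apply (simp add: defs ab)
    apply (rule wp_Write_Seq[where s' = "s(''h'' := (s ''h'')(0 := a), ''len'' := (s ''len'')(0 := b - a))"])
       apply (use W_gt in simp)
      apply (use W_gt kW defs in simp)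
     apply (simp add: defs ab)
    apply (rule wp_Write_Seq[where s' = ?s1])
       apply (use W_gt in simp)
      apply (use W_gt in simp)
     apply simp
    apply (rule wp_conseq[OF final])
    apply auto
    done
qed

end

section \<open>The complete algorithm\<close>

definition wopp_prog :: com where
  "wopp_prog = init_prog ;; level_prog ;; elem_prog ;; table_prog ;; pof_prog ;; solve_prog"

context wopp
begin

abbreviation step_cost :: nat where "step_cost \<equiv> (D + 1) * (D * 60 + 500) + 500"

text \<open>In the initial problem \<open>U\<close> is \<open>UNIV\<close> and \<open>R\<close> is
  empty, so every clique is wanted and is the only competitor for its own slot. Once the queue is
  exhausted, the last clause of \<open>queue\<close> leaves only solved vertices.\<close>

lemma wp_solve_prog:
  assumes st: "static s0" and ord: "bij_betw (s0 ''ord'') {..<n} {..<n}"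
    and sorted: "\<And>i j. i < j \<Longrightarrow> j < n \<Longrightarrow> lv (s0 ''ord'' i) \<le> lv (s0 ''ord'' j)" and s0: "s0 ''n'' 0 = n" "s0 ''k'' 0 = 0"
      "s0 ''qw'' = (\<lambda>_. 0)" "s0 ''st'' = (\<lambda>_. 0)" "s0 ''tk'' = (\<lambda>_. 0)" "s0 ''qs'' = (\<lambda>_. 0)"
    and wt: "\<And>v. v < n \<Longrightarrow> s0 ''wt'' v = w v"
  shows "wp W solve_prog (\<lambda>t s. t \<le> n * 60 + n * (D + 1) * step_cost + 60 \<and> s ''vp'' = s0 ''vp'' \<and>
    (\<forall>X<n. solved s X)) s0"
  unfolding solve_prog_def
proof (subst wp_Seq, rule wp_For[where h = n and B = 45 and
      I = "\<lambda>k s. same {''i'', ''v'', ''qo'', ''qc'', ''qr'', ''qw''} s0 s \<and>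
        (\<forall>i<k. s ''qo'' i = s0 ''ord'' i \<and> s ''qc'' i = s0 ''ord'' i \<and> s ''qr'' i = s0 ''ord'' i \<and>
          s ''qw'' i = w (s0 ''ord'' i)) \<and> (\<forall>i\<ge>k. s ''qw'' i = 0)"], goal_cases)
  case 1
  then show ?case using s0 by simp
next
  case (2 k s)
  then show ?case using s0 W_gt by (simp add: same_def)
next
  case (5 k s)
  have ordk: "s0 ''ord'' k < n" using 5 bij_betwE[OF ord] by simp
  have eq: "s ''ord'' = s0 ''ord''" "s ''wt'' = s0 ''wt''" "s ''i'' 0 = k"
    and sm: "same {''i'', ''v'', ''qo'', ''qc'', ''qr'', ''qw''} s0 s" using 5 by (simp_all add: same_def)
  have old: "\<And>i. i < k \<Longrightarrow> s ''qo'' i = s0 ''ord'' i \<and> s ''qc'' i = s0 ''ord'' i \<and>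
      s ''qr'' i = s0 ''ord'' i \<and> s ''qw'' i = w (s0 ''ord'' i)"
    "\<And>i. k \<le> i \<Longrightarrow> s ''qw'' i = 0" using 5 by auto
  show ?case using W_gt wt[OF ordk] sm old by (auto simp: eq less_Suc_eq)
next
  case (6 t1 s1)
  let ?M1 = "{''i'', ''v'', ''qo'', ''qc'', ''qr'', ''qw''}"
  have t1: "t1 \<le> n * 60 + 20" and sm1: "same ?M1 s0 s1"
    and q1: "\<And>i. i < n \<Longrightarrow> s1 ''qo'' i = s0 ''ord'' i \<and> s1 ''qc'' i = s0 ''ord'' i \<and>
      s1 ''qr'' i = s0 ''ord'' i \<and> s1 ''qw'' i = w (s0 ''ord'' i)"
    "\<And>i. n \<le> i \<Longrightarrow> s1 ''qw'' i = 0"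
    using 6 by (simp_all add: mult.commute)
  let ?s2 = "s1(''qs'' := (s1 ''qs'')(1 := n), ''np'' := (s1 ''np'')(0 := 1), ''tl'' := (s1 ''tl'')(0 := n))"
  let ?M = "?M1 \<union> step_vars"
  have ord_lt: "\<And>i. i < n \<Longrightarrow> s0 ''ord'' i < n" using bij_betwE[OF ord] by simp
  have eq1: "s1 ''k'' 0 = 0" "s1 ''qs'' = (\<lambda>_. 0)" "s1 ''st'' = (\<lambda>_. 0)" "s1 ''tk'' = (\<lambda>_. 0)"
    "s1 ''n'' 0 = n" using sm1 s0 by (simp_all add: same_def)
  have pr: "problem ?s2 UNIV {} 0 n"
    unfolding problem_def
  proof (intro conjI ballI impI, goal_cases)
    case 1
    have "bij_betw (s1 ''qc'') {..<n} {..<n} = bij_betw (s0 ''ord'') {..<n} {..<n}"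
      by (rule bij_betw_cong) (simp add: q1)
    then show ?case using ord by (simp add: atLeast0LessThan lessThan_def)
  next
    case (3 i j)
    then have ij: "i < n" "j < n" and sub: "el (s0 ''ord'' i) \<subset> el (s0 ''ord'' j)" by (simp_all add: q1)
    \<comment> \<open>A proper subclique is smaller, so sorting by size suffices to put it
      first.\<close>
    have "lv (s0 ''ord'' i) < lv (s0 ''ord'' j)"
      using sub by (intro psubset_card_mono finite_el ord_lt ij)
    then show ?case using sorted[of j i] ij by (cases i j rule: linorder_cases) auto
  qed (auto simp: q1 ord_lt el_inj)
  have pend: "pending ?s2 \<le> n * (D + 1)"
  proof -
    have "pending ?s2 = (\<Sum>i\<in>{0..<n}. lv (s1 ''qc'' i) + 1)" by (simp add: pending_def eq1)
    also have "\<dots> \<le> (\<Sum>i\<in>{0..<n}. D + 1)"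
      by (rule sum_mono) (simp add: q1 card_le_D ord_lt)
    finally show ?thesis by simp
  qed
  have queue: "queue ?s2"
    unfolding queue_def Let_def
  proof (intro conjI allI impI, goal_cases)
    case (7 i)
    then show ?case using pr by (auto simp: eq1)
  next
    case 11
    then show ?case using pend by simp
  next
    case (12 X)
    have "X \<in> s0 ''ord'' ` {..<n}" using 12 ord by (simp add: bij_betw_def)
    then obtain i where "i < n" "s0 ''ord'' i = X" by auto
    then show ?case by (intro disjI2 exI[of _ i]) (simp add: eq1 q1)
  qed (use n_pos in \<open>simp_all add: eq1 q1\<close>)
  have st2: "static ?s2" by (rule static_cong[OF st]) (use sm1 in \<open>simp_all add: same_def\<close>)
  have sm2: "same ?M s0 ?s2" using sm1 by (simp add: same_def step_vars_def child_vars_def)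
  have H: "wp W (While (Less (V ''k'') (V ''np'')) problem_step)
    (\<lambda>t s. t \<le> n * (D + 1) * step_cost + 10 \<and> s ''vp'' = s0 ''vp'' \<and> (\<forall>X<n. solved s X)) ?s2"
  proof (rule wp_While[where I = "\<lambda>s. same ?M s0 s \<and> static s \<and> queue s" and
        p = "\<lambda>s. pending s * step_cost"], goal_cases)
    case 1
    then show ?case using sm2 st2 queue by blast
  next
    case (2 s)
    then show ?case using W_gt by simp
  next
    case (3 s)
    then have "s ''k'' 0 < s ''np'' 0" by simp
    with 3 have "wp W problem_step (\<lambda>t s'. same step_vars s s' \<and> queue s' \<and>
      pending s' * step_cost + t + 20 \<le> pending s * step_cost) s" by (intro wp_problem_step) auto
    then show ?case
    proof (rule wp_conseq, goal_cases)
      case (1 t s')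
      have "static s'"
        by (rule static_cong[of s]) (use 3 1 in \<open>simp_all add: same_def step_vars_def child_vars_def\<close>)
      moreover have "same ?M s0 s'"
        by (rule same_trans[of ?M _ s step_vars]) (use 3 1 in auto)
      ultimately show ?case using 1 by simp
    qed
  next
    case (4 t s)
    have "s ''vp'' = s0 ''vp''" using 4 by (simp add: same_def step_vars_def child_vars_def)
    moreover have "solved s X" if "X < n" for X
      using 4 that unfolding queue_def Let_def by fastforce
    moreover have "t \<le> n * (D + 1) * step_cost + 10"
    proof (rule le_trans)
      show "t \<le> pending ?s2 * step_cost + 10" using 4(3) by simp
      show "pending ?s2 * step_cost + 10 \<le> n * (D + 1) * step_cost + 10"
        by (intro add_mono mult_le_mono1 pend order_refl)
    qed
    ultimately show ?case by blast
  qed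
  show ?case
    apply (rule wp_Write_Seq[where s' = "s1(''qs'' := (s1 ''qs'')(1 := n))"])
       apply (use W_gt in simp)
      apply (use W_gt in simp)
     apply (simp add: eq1)
    apply (rule wp_Write_Seq[where s' = "s1(''qs'' := (s1 ''qs'')(1 := n), ''np'' := (s1 ''np'')(0 := 1))"])
       apply (use W_gt in simp)
      apply (use W_gt in simp)
     apply simp
    apply (rule wp_Write_Seq[where s' = ?s2])
       apply (use W_gt in simp)
      apply (use W_gt in simp)
     apply (simp add: eq1)
    apply (rule wp_conseq[OF H])
    using t1 apply simp
    done
qed (use W_gt in auto)

text \<open>After \<open>m \<le> n * D\<close> the sum is a polynomial of degree 1 in
  \<open>n\<close> and 3 in \<open>D\<close>, and 5000 dominates its coefficients; terms without
  \<open>n\<close> are absorbed because \<open>n\<close> is positive.\<close>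

lemma total_time:
  "50 * n + 100 * m + 100 + ((D + 2) * (120 * m + 60) + 30 +
    (n * 60 + (D + 2) * (m * (D * 140 + 180) + 60) + 50 + (m * (D * 140 + 180) + 30 +
    (n * (D * 60 + 100) + 30 + (n * 60 + n * (D + 1) * step_cost + 60))))) \<le> 5000 * (n * (D + 1) ^ 3)"
    (is "?T m \<le> _")
proof -
  have "?T m \<le> ?T (n * D)" by (intro add_mono mult_le_mono m_le order_refl)
  also have "\<dots> \<le> 5000 * (n * (D + 1) ^ 3)"
  proof -
    obtain q where "n = Suc q" using n_pos gr0_implies_Suc by blast
    then show ?thesis by (simp add: algebra_simps power3_eq_cube)
  qed
  finally show ?thesis .
qed

lemma edge_ends: "e < m \<Longrightarrow> fst (es ! e) < n \<and> snd (es ! e) < n"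
  using edge_levels[of "fst (es ! e)" "snd (es ! e)"] edge_at_E[of e] by (simp add: edge_at_def)

abbreviation input :: memory where
  "input \<equiv> WOPP_input n es v0 ps (map (\<lambda>p. \<omega> (pof_of es E p)) ps)"

lemma bnd_input: "bnd W input"
proof -
  have arr: "array_of xs i < W" if "\<And>x. x \<in> set xs \<Longrightarrow> x < W" for xs i
    using that W_gt by (simp add: array_of_def)
  have "fst p < W \<and> snd p < W" if "p \<in> set es" for p
    using that edge_ends W_gt by (metis in_set_conv_nth less_trans)
  moreover have "length (concat (take i ps)) < W" if "i < n + 1" for i
  proof -
    have "length (concat (take i ps)) \<le> i * D" using that by (intro pof_start_le) simp
    also have "\<dots> \<le> n * n" using that D_le_n by (intro mult_le_mono) auto
    finally show ?thesis using W_gt by simp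
  qed
  moreover have "x < W" if "x \<in> set p" "p \<in> set ps" for x p
  proof -
    have "x < m" using that ps by (auto simp: encodes_POFs_def)
    then show ?thesis using m_le_nn W_gt by simp
  qed
  moreover have "\<omega> (pof_of es E p) < W" if p: "p \<in> set ps" for p
  proof -
    obtain i where i: "i < n" "p = ps ! i"
      using p length_ps by (auto simp: in_set_conv_nth)
    show ?thesis
      unfolding i(2) pof_of_pv[OF i(1)] by (rule \<omega>_W[OF cl_image_POFs[OF el_K[OF pv_lt[OF i(1)]]]])
  qed
  moreover have "v0 < W" "n < W" "m < W" using v0 m_le_nn W_gt by simp_all
  ultimately have A: "array_of [n] i < W" "array_of [m] i < W" "array_of (map fst es) i < W"
    "array_of (map snd es) i < W" "array_of [v0] i < W" "array_of [length ps] i < W"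
    "array_of (map (\<lambda>i. length (concat (take i ps))) [0..<length ps + 1]) i < W"
    "array_of (concat ps) i < W" "array_of (map (\<lambda>p. \<omega> (pof_of es E p)) ps) i < W" "0 < W" for i
    using W_gt unfolding length_ps by (auto intro!: arr simp del: length_concat upt_Suc)
  have "input x i < W" for x i
    unfolding WOPP_input_def fun_upd_apply by (simp only: A simp_thms split: if_split)
  then show ?thesis by (simp add: bnd_def)
qed

text \<open>Later phases write none of the result arrays that are still to be read, so the frame
  conditions carry every table to the phases that use it.\<close>

lemma wp_wopp_prog:
  "wp W wopp_prog (\<lambda>t s. t \<le> 5000 * (n * (D + 1) ^ 3) \<and> WOPP_output es E ps \<omega> s) input"
proof -
  have i: "input ''n'' 0 = n" "input ''m'' 0 = m" "input ''acc'' 0 = 0" "input ''v0'' 0 = v0"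
    "input ''num_pofs'' 0 = n"
    "\<And>x. x \<in> {''lev'', ''prev'', ''el'', ''mem'', ''ec'', ''k'', ''qw'', ''st'', ''tk'', ''qs''} \<Longrightarrow> input x = (\<lambda>_. 0)"
    "\<And>e. e < m \<Longrightarrow> input ''edge_fst'' e = fst (es ! e) \<and> input ''edge_snd'' e = snd (es ! e)"
    "\<And>i. i \<le> n \<Longrightarrow> input ''pof_start'' i = length (concat (take i ps))"
    "\<And>i. input ''pof_elem'' i = (if i < length (concat ps) then concat ps ! i else 0)"
  proof goal_cases
    case (6 x)
    then show ?case by (elim insertE emptyE) (simp_all add: WOPP_input_def)
  next
    case (8 i)
    then show ?case
      by (simp add: WOPP_input_def array_of_def length_ps nth_append del: length_concat upt_Suc)
  next
    case (9 i)
    then show ?case by (simp add: WOPP_input_def array_of_def del: length_concat)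
  qed (simp_all add: WOPP_input_def array_of_def length_ps)
  have i_weight: "input ''weight'' i = w (pv i)" if "i < n" for i
    using that pof_of_pv by (simp add: WOPP_input_def array_of_def length_ps w_def)
  show ?thesis
    unfolding wopp_prog_def wp_Seq
  proof (rule wp_conseq[OF wp_init_prog], goal_cases)
    case (5 t1 s1)
    then have 1: "t1 \<le> 50 * n + 100 * m + 100" "bases s1" "arcs s1"
      "same {''i'', ''b'', ''acc'', ''src'', ''dst'', ''aid'', ''j'', ''m2''} input s1" by blast+
    show ?case
    proof (rule wp_conseq[OF wp_level_prog], goal_cases)
      case (5 t2 s2)
      then have 2: "t2 \<le> (D + 2) * (120 * m + 60) + 30" "levels s2"
        "same {''a'', ''v'', ''lev'', ''ord'', ''cnt'', ''r'', ''prev''} s1 s2" by blast+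
      have b2: "bases s2" "arcs s2" using 1 2(3) by (simp_all add: bases_def arcs_def same_def)
      show ?case
      proof (rule wp_conseq[OF wp_elem_prog], goal_cases)
        case (8 t3 s3)
        then have 3: "t3 \<le> n * 60 + (D + 2) * (m * (D * 140 + 180) + 60) + 50" "elrep s3 el"
          "same {''i'', ''R'', ''r'', ''a'', ''u'', ''v'', ''q'', ''x'', ''j'', ''mem'', ''el'', ''ec''} s2 s3"
          by blast+
        have b3: "bases s3" "arcs s3" using b2 3(3) by (simp_all add: bases_def arcs_def same_def)
        have "s3 ''lev'' = s2 ''lev''" "s3 ''ord'' = s2 ''ord''" using 3(3) by (simp_all add: same_def)
        show ?case
        proof (rule wp_conseq[OF wp_table_prog], goal_cases)
          case (5 t4 s4)
          then have 4: "t4 \<le> m * (D * 140 + 180) + 30" "tables s4"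
            "same {''a'', ''u'', ''v'', ''q'', ''x'', ''j'', ''cls'', ''up'', ''dn''} s3 s4" by blast+
          have b4: "bases s4" "elrep s4 el" 
            using b3 3(2) 4(3) by (simp_all add: bases_def elrep_def same_def)
          show ?case
          proof (rule wp_conseq[OF wp_pof_prog], goal_cases)
            case (8 t5 s5)
            then have 5: "t5 \<le> n * (D * 60 + 100) + 30" 
              "\<And>i. i < n \<Longrightarrow> s5 ''vp'' (pv i) = i \<and> s5 ''wt'' (pv i) = w (pv i)"
              "same {''i'', ''u'', ''q'', ''vp'', ''wt''} s4 s5" by blast+
            have b5: "bases s5" "elrep s5 el" 
              using b4 5(3) by (simp_all add: bases_def elrep_def same_def)
            have wt: "s5 ''wt'' v = w v" if "v < n" for v
            proof -
              have "v \<in> pv ` {..<n}" using pv_bij that by (simp add: bij_betw_def)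
              then show ?thesis using 5(2) by auto
            qed
            show ?case
            proof (rule wp_conseq[OF wp_solve_prog], goal_cases)
              case 1
              have "s5 ''dn'' = s4 ''dn''" using 5(3) by (simp add: same_def)
              then show ?case using b5 5(2) 4(2) by (simp add: static_def tables_def)
            next
              case (11 t6 s6)
              have "WOPP_output es E ps \<omega> s6"
                unfolding WOPP_output_def length_ps
              proof (intro allI impI)
                fix i assume i: "i < n"
                then have "solved s6 (pv i)" and vp: "s6 ''vp'' = s5 ''vp''" using 11 pv_lt by blast+
                then obtain Y where Y: "Y < n" "el (pv i) \<inter> el Y = {}"
                  "\<forall>y<n. el (pv i) \<inter> el y = {} \<longrightarrow> w y \<le> w Y" "s6 ''opp'' i = s5 ''vp'' Y"
                  unfolding solved_def using 5(2)[OF i] by auto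
                have "Y \<in> pv ` {..<n}" using pv_bij Y(1) by (simp add: bij_betw_def)
                then obtain j where j: "j < n" "Y = pv j" by auto
                then have "s6 ''opp'' i = j" using Y(4) 5(2) by simp
                then show "s6 ''opp'' i < n \<and>
                  max_opposite E \<omega> (pof_of es E (ps ! i)) (pof_of es E (ps ! s6 ''opp'' i))"
                  using Y(2,3) i j pv_lt by (simp add: pof_of_pv max_opposite_cl)
              qed
              moreover have "t1 + (t2 + (t3 + (t4 + (t5 + t6)))) \<le> 5000 * (n * (D + 1) ^ 3)"
                by (rule le_trans[OF _ total_time], intro add_mono 1(1) 2(1) 3(1) 4(1) 5(1)) (use 11 in blast)
              ultimately show ?case by blast
            qed (use 1(4) 2(2,3) 3(3) 4(3) 5(3) i wt in \<open>simp_all add: same_def levels_def\<close>)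
          qed (use b4 4(2) 1(4) 2(3) 3(3) 4(3) i i_weight in \<open>simp_all add: same_def\<close>)
        qed (use b3 3 2 in \<open>simp_all add: same_def levels_def\<close>)
      qed (use b2 1(4) 2 i in \<open>simp_all add: same_def\<close>)
    qed (use 1 i in \<open>simp_all add: same_def\<close>)
  qed (use i in simp_all)
qed

end

theorem theorem3:
  shows "\<exists>(P :: com) (c :: real) (k :: nat).
    \<forall>(n :: nat) (E :: nat set set) (v0 :: nat) (\<omega> :: nat set set set \<Rightarrow> nat)
     (es :: (nat \<times> nat) list) (ps :: nat list list).
      WOPP_instance {..<n} E v0 \<omega> \<longrightarrow> encodes_edges es E \<longrightarrow> encodes_POFs ps es E \<longrightarrow>
      (\<exists>(t :: nat) (s :: memory).
         exec ((n + Max (\<omega> ` POFs E)) ^ k) P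
              (WOPP_input n es v0 ps (map (\<lambda>p. \<omega> (pof_of es E p)) ps)) t s \<and>
         WOPP_output es E ps \<omega> s \<and>
         (n \<ge> 2 \<longrightarrow>
            real t \<le> c * ((real (dimension {..<n} E) ^ 3 + log 2 (real n)) * real n)))"
proof (rule exI[of _ wopp_prog], rule exI[of _ "40000 :: real"], rule exI[of _ "8 :: nat"], intro allI impI)
  fix n :: nat and E :: "nat set set" and v0 :: nat and \<omega> :: "nat set set set \<Rightarrow> nat"
    and es :: "(nat \<times> nat) list" and ps :: "nat list list"
  assume inst: "WOPP_instance {..<n} E v0 \<omega>" and es: "encodes_edges es E" and ps: "encodes_POFs ps es E"
  obtain el where "rooted_clique_graph n E el v0" using ex_rooted_clique_graph[OF inst] by blast
  then interpret rooted_clique_graph n E el v0 .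
  define N W where NW: "N = n + Max (\<omega> ` POFs E)" "W = N ^ 8"
  have fin: "finite (\<omega> ` POFs E)" unfolding POFs_eq using finite_K by simp
  have pos: "\<And>X. X \<in> POFs E \<Longrightarrow> 0 < \<omega> X" using inst by (simp add: WOPP_instance_def)
  have le: "\<omega> X \<le> Max (\<omega> ` POFs E)" if "X \<in> POFs E" for X using fin that by simp
  \<comment> \<open>The empty POF has positive weight and \<open>n\<close> is positive; together
    they give \<open>2 \<le> N\<close>.\<close>
  have "{} \<in> POFs E" by (simp add: POFs_def)
  then have N: "n + 1 \<le> N" "2 \<le> N" using pos[of "{}"] le[of "{}"] n_pos unfolding NW by linarith+
  \<comment> \<open>The exponent 8 leaves a factor \<open>2 ^ 6\<close> in front of
    \<open>N ^ 2\<close>, ample for the quadratic demand of the locale on \<open>W\<close>.\<close>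
  have "64 * N ^ 2 \<le> W"
  proof -
    have "(2 :: nat) ^ 6 * N ^ 2 \<le> N ^ 6 * N ^ 2" by (intro mult_le_mono1 power_mono N) simp
    then show ?thesis unfolding NW(2) by (simp flip: power_add)
  qed
  moreover have "n * n + n \<le> N ^ 2" "4 \<le> N ^ 2" "N \<le> N ^ 2"
    using mult_le_mono[OF N(1) N(1)] mult_le_mono[OF N(2) N(2)] mult_le_mono1[OF N(2), of N]
    by (simp_all add: power2_eq_square algebra_simps)
  ultimately have W: "4 * (n * n) + 4 * n + 10 \<le> W" "N \<le> W" by linarith+
  interpret wopp n E el v0 \<omega> es ps W
  proof
    show "\<omega> X < W" if "X \<in> POFs E" for X
      using le[OF that] n_pos W(2) unfolding NW(1) by linarith
  qed (fact es ps pos W(1))+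
  let ?input = "WOPP_input n es v0 ps (map (\<lambda>p. \<omega> (pof_of es E p)) ps)"
  obtain t s where run: "run W wopp_prog ?input t s" and t: "t \<le> 5000 * (n * (D + 1) ^ 3)"
    and out: "WOPP_output es E ps \<omega> s"
    using wp_wopp_prog unfolding wp_def by blast
  have "real t \<le> 40000 * ((real (dimension {..<n} E) ^ 3 + log 2 (real n)) * real n)" if n: "2 \<le> n"
  proof -
    let ?d = "dimension {..<n} E"
    \<comment> \<open>With two vertices not all cliques are empty. Then \<open>D + 1\<close> is at
      most twice the dimension, and the cube of this factor 2 turns 5000 into 40000.\<close>
    have "1 \<le> D"
    proof (rule ccontr)
      assume "\<not> 1 \<le> D"
      then have "lv v = 0" if "v < n" for v using card_le_D[OF that] by simp
      then have "0 = v0" "1 = v0" using lv_0[of 0] lv_0[of 1] n by simp_all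
      then show False by simp
    qed
    then have "D + 1 \<le> 2 * ?d" using D_le_dimension by simp
    then have "(D + 1) ^ 3 \<le> (2 * ?d) ^ 3" by (rule power_mono) simp
    from le_trans[OF t mult_le_mono2[OF mult_le_mono2[OF this]]]
    have "real t \<le> real (5000 * (n * (2 * ?d) ^ 3))" by (rule of_nat_mono)
    also have "\<dots> = 40000 * (real ?d ^ 3 * real n)" by simp
    also have "\<dots> \<le> 40000 * ((real ?d ^ 3 + log 2 (real n)) * real n)"
      using n by (intro mult_left_mono mult_right_mono) simp_all
    finally show ?thesis .
  qed
  then show "\<exists>t s. exec ((n + Max (\<omega> ` POFs E)) ^ 8) wopp_prog ?input t s \<and> WOPP_output es E ps \<omega> s \<and>
      (n \<ge> 2 \<longrightarrow> real t \<le> 40000 * ((real (dimension {..<n} E) ^ 3 + log 2 (real n)) * real n))"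
    using run_exec[OF run bnd_input] out unfolding NW[symmetric] by blast
qed

end
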